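(* Let $G=Sp(2)\times Sp(1)$ and $H=Sp(1)^2\times S^1$, and let $l,m,n$ be integers with $\gcd(l,m,n)=1$. Let $H$ act on $G$ via the homomorphism $f=(f_1,f_2):H\to G\times G$ given by $$f_1(p,q,z)=\left(\begin{bmatrix}p&\\&q\end{bmatrix},\,1\right),\qquad f_2(p,q,z)=\left(\begin{bmatrix}z^m&\\&z^n\end{bmatrix},\,z^l\right).$$ When $l=2$ and $m$ and $n$ are both odd, the quotient $G/\!\!/H$ is diffeomorphic to $S^4\,\hat{\times}\,S^2$.
   Context: A homomorphism $f=(f_1,f_2):H\to G\times G$ induces an action of $H$ on $G$ by $h\ast g=f_1(h)\,g\,f_2(h)^{-1}$. The action is effectively free if any $h\in H$ fixing some point of $G$ fixes every point of $G$; in that case the orbit space $G/\!\!/H$ is a smooth manifold, called a biquotient. $S^1$ is regarded as a subgroup of $Sp(1)$ (unit complex numbers inside unit quaternions). $S^4\,\hat{\times}\,S^2$ denotes the total space of the unique non-trivial linear $S^4$ bundle over $S^2$. *)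

theory Defs
  imports
    "HOL-Analysis.Analysis"
    "HOL-Algebra.Group_Action"
begin

section \<open>Quaternions\<close>

datatype quat = Quat (qre: real) (qi: real) (qj: real) (qk: real)

lemma quat_eq_iff: "x = y \<longleftrightarrow> qre x = qre y \<and> qi x = qi y \<and> qj x = qj y \<and> qk x = qk y"
  by (auto intro: quat.expand)

instantiation quat :: ring_1
begin
definition "0 = Quat 0 0 0 0"
definition "1 = Quat 1 0 0 0"
definition "x + y = Quat (qre x + qre y) (qi x + qi y) (qj x + qj y) (qk x + qk y)"
definition "- x = Quat (- qre x) (- qi x) (- qj x) (- qk x)"
definition "x - y = Quat (qre x - qre y) (qi x - qi y) (qj x - qj y) (qk x - qk y)"
definition "x * y = Quat
  (qre x * qre y - qi x * qi y - qj x * qj y - qk x * qk y)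
  (qre x * qi y + qi x * qre y + qj x * qk y - qk x * qj y)
  (qre x * qj y - qi x * qk y + qj x * qre y + qk x * qi y)
  (qre x * qk y + qi x * qj y - qj x * qi y + qk x * qre y)"
instance
  by standard
    (simp_all add: zero_quat_def one_quat_def plus_quat_def uminus_quat_def minus_quat_def
      times_quat_def quat_eq_iff algebra_simps)
end

instantiation quat :: real_vector
begin
definition "scaleR r x = Quat (r * qre x) (r * qi x) (r * qj x) (r * qk x)"
instance
  by standard (simp_all add: plus_quat_def scaleR_quat_def quat_eq_iff algebra_simps)
end

instantiation quat :: euclidean_space
begin
definition "inner x y = qre x * qre y + qi x * qi y + qj x * qj y + qk x * qk y"
definition "norm (x::quat) = sqrt (inner x x)"
definition "sgn (x::quat) = x /\<^sub>R norm x"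
definition "dist (x::quat) y = norm (x - y)"
definition [code del]:
  "(uniformity :: (quat \<times> quat) filter) = (INF e\<in>{0 <..}. principal {(x, y). dist x y < e})"
definition open_quat_def [code del]:
  "open (U :: quat set) \<longleftrightarrow> (\<forall>x\<in>U. eventually (\<lambda>(x', y). x' = x \<longrightarrow> y \<in> U) uniformity)"
definition "Basis = {Quat 1 0 0 0, Quat 0 1 0 0, Quat 0 0 1 0, Quat 0 0 0 1}"
instance
proof
  fix x y z :: quat and r :: real and U :: "quat set"
  show "0 \<le> inner x x" by (simp add: inner_quat_def)
  show "inner x x = 0 \<longleftrightarrow> x = 0"
  proof
    assume "inner x x = 0"
    then have "qre x * qre x = 0 \<and> qi x * qi x = 0 \<and> qj x * qj x = 0 \<and> qk x * qk x = 0"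
      unfolding inner_quat_def
      using zero_le_square[of "qre x"] zero_le_square[of "qi x"]
        zero_le_square[of "qj x"] zero_le_square[of "qk x"] by linarith
    then show "x = 0" by (simp add: quat_eq_iff zero_quat_def)
  qed (simp add: inner_quat_def zero_quat_def)
  show "(\<forall>u\<in>Basis. inner x u = 0) \<longleftrightarrow> x = 0"
    unfolding quat_eq_iff[of x 0] by (simp add: Basis_quat_def inner_quat_def zero_quat_def)
qed (auto simp: zero_quat_def plus_quat_def minus_quat_def scaleR_quat_def inner_quat_def
      norm_quat_def sgn_quat_def dist_quat_def uniformity_quat_def open_quat_def Basis_quat_def
      quat_eq_iff algebra_simps)
end

definition qcnj :: "quat \<Rightarrow> quat" where
  "qcnj x = Quat (qre x) (- qi x) (- qj x) (- qk x)"

instantiation quat :: "{real_normed_div_algebra}"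
begin
definition "inverse x = qcnj x /\<^sub>R (inner x x)"
definition "x div (y::quat) = x * inverse y"
instance
proof
  fix x y :: quat and a :: real
  show "a *\<^sub>R x * y = a *\<^sub>R (x * y)" "x * a *\<^sub>R y = a *\<^sub>R (x * y)"
    by (simp_all add: times_quat_def scaleR_quat_def algebra_simps)
  show "norm (x * y) = norm x * norm y"
    unfolding norm_quat_def real_sqrt_mult[symmetric]
    by (rule arg_cong[where f = sqrt]) (simp add: inner_quat_def times_quat_def algebra_simps)
  show "inverse (0::quat) = 0"
    by (simp add: inverse_quat_def)
  show "x div y = x * inverse y" by (simp add: divide_quat_def)
  assume "x \<noteq> 0"
  then have "inner x x \<noteq> 0" by simp
  moreover have "qcnj x * x = inner x x *\<^sub>R 1" "x * qcnj x = inner x x *\<^sub>R 1"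
    by (simp_all add: qcnj_def times_quat_def scaleR_quat_def one_quat_def inner_quat_def)
  moreover have "(a *\<^sub>R u) * v = a *\<^sub>R (u * v)" "u * (a *\<^sub>R v) = a *\<^sub>R (u * v)" for u v :: quat and a
    by (simp_all add: times_quat_def scaleR_quat_def algebra_simps)
  ultimately show "inverse x * x = 1" "x * inverse x = 1"
    by (simp_all add: inverse_quat_def)
qed
end

definition quat_of_complex :: "complex \<Rightarrow> quat" where
  "quat_of_complex z = Quat (Re z) (Im z) 0 0"


section \<open>The groups\<close>

definition qadjoint :: "quat ^ 'n ^ 'n \<Rightarrow> quat ^ 'n ^ 'n" where
  "qadjoint A = (\<chi> i j. qcnj (A $ j $ i))"

definition Sp :: "(quat ^ 'n ^ 'n) monoid" where
  "Sp = \<lparr> carrier = {A. A ** qadjoint A = mat 1 \<and> qadjoint A ** A = mat 1},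
         mult = (**), one = mat 1 \<rparr>"

definition Sp1 :: "quat monoid" where
  "Sp1 = \<lparr> carrier = {q. norm q = 1}, mult = (*), one = 1 \<rparr>"

definition S1 :: "quat monoid" where
  "S1 = Sp1 \<lparr> carrier := quat_of_complex ` {z. norm z = 1} \<rparr>"

definition diag2 :: "'a::zero \<Rightarrow> 'a \<Rightarrow> 'a ^ 2 ^ 2" where
  "diag2 a b = vector [vector [a, 0], vector [0, b]]"


section \<open>Smooth manifolds\<close>

text \<open>Only used on open sets \<open>S\<close>. Continuity of all iterated directional derivatives of order
  at most \<open>k\<close> is the usual notion of a \<open>C\<^sup>k\<close> function.\<close>

fun Ck_on :: "nat \<Rightarrow> 'a::euclidean_space set \<Rightarrow> ('a \<Rightarrow> 'b::euclidean_space) \<Rightarrow> bool" where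
  "Ck_on 0 S f \<longleftrightarrow> continuous_on S f"
| "Ck_on (Suc k) S f \<longleftrightarrow> (\<forall>x\<in>S. f differentiable (at x)) \<and>
     (\<forall>v. Ck_on k S (\<lambda>x. frechet_derivative f (at x) v))"

definition smooth_on :: "'a::euclidean_space set \<Rightarrow> ('a \<Rightarrow> 'b::euclidean_space) \<Rightarrow> bool" where
  "smooth_on S f \<longleftrightarrow> (\<forall>k. Ck_on k S f)"

text \<open>The atlas \<open>matlas\<close>, whose elements are pairs of a domain and a coordinate map, need not be
  maximal. The type \<open>'e\<close> is the model space.\<close>

record ('a, 'e) mfd =
  mtop :: "'a topology"
  matlas :: "('a set \<times> ('a \<Rightarrow> 'e)) set"

definition coord_dom :: "('a \<Rightarrow> 'b) \<Rightarrow> 'a set \<times> ('a \<Rightarrow> 'e) \<Rightarrow> 'b set \<times> ('b \<Rightarrow> 'f) \<Rightarrow> 'e set" where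
  "coord_dom f c d = snd c ` (fst c \<inter> f -` fst d)"

definition coord_rep ::
    "('a \<Rightarrow> 'b) \<Rightarrow> 'a set \<times> ('a \<Rightarrow> 'e) \<Rightarrow> 'b set \<times> ('b \<Rightarrow> 'f) \<Rightarrow> 'e \<Rightarrow> 'f" where
  "coord_rep f c d = snd d \<circ> f \<circ> inv_into (fst c) (snd c)"

definition smooth_manifold :: "('a, 'e::euclidean_space) mfd \<Rightarrow> bool" where
  "smooth_manifold M \<longleftrightarrow>
     Hausdorff_space (mtop M) \<and>
     (\<exists>\<B>. countable \<B> \<and> (\<forall>V\<in>\<B>. openin (mtop M) V) \<and>
        (\<forall>U x. openin (mtop M) U \<and> x \<in> U \<longrightarrow> (\<exists>V\<in>\<B>. x \<in> V \<and> V \<subseteq> U))) \<and>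
     (\<forall>(U, \<phi>)\<in>matlas M. openin (mtop M) U \<and> open (\<phi> ` U) \<and>
        homeomorphic_map (subtopology (mtop M) U) (top_of_set (\<phi> ` U)) \<phi>) \<and>
     (\<Union>(U, \<phi>)\<in>matlas M. U) = topspace (mtop M) \<and>
     (\<forall>c\<in>matlas M. \<forall>d\<in>matlas M. smooth_on (coord_dom id c d) (coord_rep id c d))"

definition smooth_map ::
    "('a, 'e::euclidean_space) mfd \<Rightarrow> ('b, 'f::euclidean_space) mfd \<Rightarrow> ('a \<Rightarrow> 'b) \<Rightarrow> bool" where
  "smooth_map M N f \<longleftrightarrow> smooth_manifold M \<and> smooth_manifold N \<and>
     continuous_map (mtop M) (mtop N) f \<and>
     (\<forall>c\<in>matlas M. \<forall>d\<in>matlas N. smooth_on (coord_dom f c d) (coord_rep f c d))"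

definition submersion ::
    "('a, 'e::euclidean_space) mfd \<Rightarrow> ('b, 'f::euclidean_space) mfd \<Rightarrow> ('a \<Rightarrow> 'b) \<Rightarrow> bool" where
  "submersion M N f \<longleftrightarrow> smooth_map M N f \<and>
     (\<forall>c\<in>matlas M. \<forall>d\<in>matlas N. \<forall>x\<in>coord_dom f c d.
        surj (frechet_derivative (coord_rep f c d) (at x)))"

definition diffeomorphism ::
    "('a, 'e::euclidean_space) mfd \<Rightarrow> ('b, 'e) mfd \<Rightarrow> ('a \<Rightarrow> 'b) \<Rightarrow> bool" where
  "diffeomorphism M N f \<longleftrightarrow> smooth_map M N f \<and>
     (\<exists>g. smooth_map N M g \<and>
        (\<forall>x\<in>topspace (mtop M). g (f x) = x) \<and> (\<forall>y\<in>topspace (mtop N). f (g y) = y))"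

definition diffeomorphic :: "('a, 'e::euclidean_space) mfd \<Rightarrow> ('b, 'e) mfd \<Rightarrow> bool" where
  "diffeomorphic M N \<longleftrightarrow> (\<exists>f. diffeomorphism M N f)"

definition open_submfd :: "('a, 'e) mfd \<Rightarrow> 'a set \<Rightarrow> ('a, 'e) mfd" where
  "open_submfd M W =
     \<lparr> mtop = subtopology (mtop M) W, matlas = (\<lambda>(U, \<phi>). (U \<inter> W, \<phi>)) ` matlas M \<rparr>"

definition smooth_on_subset ::
    "'a::euclidean_space set \<Rightarrow> ('a \<Rightarrow> 'b::euclidean_space) \<Rightarrow> bool" where
  "smooth_on_subset U f \<longleftrightarrow>
     (\<forall>x\<in>U. \<exists>W g. open W \<and> x \<in> W \<and> smooth_on W g \<and> (\<forall>y\<in>U \<inter> W. g y = f y))"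

text \<open>The standard (maximal) smooth structure on an embedded submanifold \<open>S\<close> of a Euclidean space.
  If \<open>S\<close> is not a submanifold of dimension \<open>DIM('e)\<close>, then the charts do not cover \<open>S\<close>, and the
  result is not a \<open>smooth_manifold\<close>.\<close>

definition euclidean_submfd :: "'a::euclidean_space set \<Rightarrow> ('a, 'e::euclidean_space) mfd" where
  "euclidean_submfd S =
     \<lparr> mtop = top_of_set S,
       matlas = {(U, \<phi>). openin (top_of_set S) U \<and> inj_on \<phi> U \<and> open (\<phi> ` U) \<and>
          smooth_on_subset U \<phi> \<and> smooth_on (\<phi> ` U) (inv_into U \<phi>)} \<rparr>"


section \<open>Biquotients\<close>

definition biquotient_action ::
    "('g, 'x) monoid_scheme \<Rightarrow> ('h \<Rightarrow> 'g \<times> 'g) \<Rightarrow> 'h \<Rightarrow> 'g \<Rightarrow> 'g" where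
  "biquotient_action G f h =
     (\<lambda>g\<in>carrier G. fst (f h) \<otimes>\<^bsub>G\<^esub> g \<otimes>\<^bsub>G\<^esub> inv\<^bsub>G\<^esub> (snd (f h)))"

definition effectively_free ::
    "('h, 'y) monoid_scheme \<Rightarrow> 'g set \<Rightarrow> ('h \<Rightarrow> 'g \<Rightarrow> 'g) \<Rightarrow> bool" where
  "effectively_free H X \<phi> \<longleftrightarrow>
     (\<forall>h\<in>carrier H. (\<exists>x\<in>X. \<phi> h x = x) \<longrightarrow> (\<forall>x\<in>X. \<phi> h x = x))"

text \<open>\<open>Q\<close> is the orbit space of the action \<open>\<phi>\<close> of \<open>H\<close> on the manifold \<open>M\<close>, with the unique topology
  and smooth structure for which the orbit projection is a smooth submersion.\<close>

definition orbit_manifold ::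
    "('h, 'y) monoid_scheme \<Rightarrow> ('g, 'e::euclidean_space) mfd \<Rightarrow> ('h \<Rightarrow> 'g \<Rightarrow> 'g) \<Rightarrow>
     ('g set, 'f::euclidean_space) mfd \<Rightarrow> bool" where
  "orbit_manifold H M \<phi> Q \<longleftrightarrow>
     topspace (mtop Q) = orbits H (topspace (mtop M)) \<phi> \<and> submersion M Q (orbit H \<phi>)"


section \<open>Linear sphere bundles\<close>

text \<open>A smooth bundle \<open>p\<close> over a submanifold \<open>B\<close> of a Euclidean space with fibre the unit sphere of
  \<open>'f\<close>, given by a set \<open>T\<close> of local trivialisations that cover \<open>B\<close> and differ by orthogonal maps on
  every fibre, i.e. with structure group \<open>O(DIM('f))\<close>. As the transition maps are smooth, these
  orthogonal maps depend smoothly on the base point. Likewise \<open>p\<close> is smooth.\<close>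

definition linear_sphere_bundle ::
    "'b::euclidean_space set \<Rightarrow> ('x, 'e::euclidean_space) mfd \<Rightarrow> ('x \<Rightarrow> 'b) \<Rightarrow>
     ('b set \<times> ('x \<Rightarrow> 'b \<times> 'f::euclidean_space)) set \<Rightarrow> bool" where
  "linear_sphere_bundle B E p T \<longleftrightarrow>
     smooth_manifold E \<and> continuous_map (mtop E) (top_of_set B) p \<and>
     (\<Union>(U, \<Phi>)\<in>T. U) = B \<and>
     (\<forall>(U, \<Phi>)\<in>T. openin (top_of_set B) U \<and>
        diffeomorphism (open_submfd E (topspace (mtop E) \<inter> p -` U))
          (euclidean_submfd (U \<times> sphere 0 1)) \<Phi> \<and>
        (\<forall>y\<in>topspace (mtop E) \<inter> p -` U. fst (\<Phi> y) = p y)) \<and>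
     (\<forall>(U, \<Phi>)\<in>T. \<forall>(V, \<Psi>)\<in>T. \<forall>x\<in>U \<inter> V. \<exists>g. orthogonal_transformation g \<and>
        (\<forall>y\<in>topspace (mtop E) \<inter> p -` {x}. snd (\<Psi> y) = g (snd (\<Phi> y))))"

text \<open>Trivial as a linear bundle: some trivialisation over all of \<open>B\<close> is compatible with \<open>T\<close>.\<close>

definition nontrivial_linear_sphere_bundle ::
    "'b::euclidean_space set \<Rightarrow> ('x, 'e::euclidean_space) mfd \<Rightarrow> ('x \<Rightarrow> 'b) \<Rightarrow>
     ('b set \<times> ('x \<Rightarrow> 'b \<times> 'f::euclidean_space)) set \<Rightarrow> bool" where
  "nontrivial_linear_sphere_bundle B E p T \<longleftrightarrow>
     linear_sphere_bundle B E p T \<and> \<not> (\<exists>\<Phi>. linear_sphere_bundle B E p (insert (B, \<Phi>) T))"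

text \<open>\<open>E\<close> is a copy of the total space of the non-trivial linear \<open>S\<^sup>4\<close> bundle over \<open>S\<^sup>2\<close>, which is
  unique up to isomorphism because its clutching function lies in \<open>\<pi>\<^sub>1(SO(5)) = \<int>/2\<close>. Since \<open>E\<close>
  carries its own topology, its underlying set may be taken to be any set of the cardinality of the
  continuum, such as \<open>S\<^sup>2 \<times> S\<^sup>4\<close> inside \<open>(real ^ 3) \<times> (real ^ 5)\<close> with \<open>p = fst\<close>.\<close>

definition is_S4_twisted_S2 :: "('x, real ^ 6) mfd \<Rightarrow> bool" where
  "is_S4_twisted_S2 E \<longleftrightarrow>
     (\<exists>p T. nontrivial_linear_sphere_bundle (sphere (0 :: real ^ 3) 1) E p
        (T :: ((real ^ 3) set \<times> ('x \<Rightarrow> (real ^ 3) \<times> (real ^ 5))) set))"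


section \<open>The biquotients of \<open>Sp(2) \<times> Sp(1)\<close> by \<open>Sp(1)\<^sup>2 \<times> S\<^sup>1\<close>\<close>

definition GG :: "((quat ^ 2 ^ 2) \<times> quat) monoid" where
  "GG = Sp \<times>\<times> Sp1"

definition HH :: "(quat \<times> quat \<times> quat) monoid" where
  "HH = Sp1 \<times>\<times> Sp1 \<times>\<times> S1"

definition ff :: "int \<Rightarrow> int \<Rightarrow> int \<Rightarrow> quat \<times> quat \<times> quat \<Rightarrow>
    ((quat ^ 2 ^ 2) \<times> quat) \<times> ((quat ^ 2 ^ 2) \<times> quat)" where
  "ff l m n = (\<lambda>(p, q, z). ((diag2 p q, 1), (diag2 (z powi m) (z powi n), z powi l)))"

lemma qcnj_mult: "qcnj (x * y) = qcnj y * qcnj x"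
  by (simp add: qcnj_def times_quat_def quat_eq_iff algebra_simps)

lemma qcnj_qcnj [simp]: "qcnj (qcnj x) = x"
  by (simp add: qcnj_def)

lemma qcnj_add: "qcnj (x + y) = qcnj x + qcnj y"
  by (simp add: qcnj_def plus_quat_def)

lemma qcnj_0 [simp]: "qcnj 0 = 0" and qcnj_1 [simp]: "qcnj 1 = 1"
  by (simp_all add: qcnj_def zero_quat_def one_quat_def)

lemma qcnj_sum: "qcnj (sum f A) = (\<Sum>x\<in>A. qcnj (f x))"
  by (induction A rule: infinite_finite_induct) (auto simp: qcnj_add)

lemma qadjoint_mult: "qadjoint (A ** B) = qadjoint B ** qadjoint A"
  by (simp add: qadjoint_def matrix_matrix_mult_def vec_eq_iff qcnj_sum qcnj_mult)

lemma qadjoint_qadjoint [simp]: "qadjoint (qadjoint A) = A"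
  by (simp add: qadjoint_def vec_eq_iff)

lemma qadjoint_mat_1 [simp]: "qadjoint (mat 1) = mat 1"
  by (simp add: qadjoint_def mat_def vec_eq_iff)

lemma mult_qcnj_self: "norm x = 1 \<Longrightarrow> x * qcnj x = 1" "norm x = 1 \<Longrightarrow> qcnj x * x = 1"
  by (simp_all add: norm_quat_def inner_quat_def qcnj_def times_quat_def one_quat_def)

lemma group_Sp: "group (Sp :: (quat ^ 'n ^ 'n) monoid)"
proof (rule groupI)
  fix A B :: "quat ^ 'n ^ 'n"
  assume A: "A \<in> carrier Sp"
  show "\<exists>B\<in>carrier Sp. B \<otimes>\<^bsub>Sp\<^esub> A = \<one>\<^bsub>Sp\<^esub>"
    using A by (intro bexI[of _ "qadjoint A"]) (simp_all add: Sp_def)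
  assume B: "B \<in> carrier Sp"
  have "A ** B ** (qadjoint B ** qadjoint A) = A ** (B ** qadjoint B) ** qadjoint A"
    "qadjoint B ** qadjoint A ** (A ** B) = qadjoint B ** (qadjoint A ** A) ** B"
    by (simp_all add: matrix_mul_assoc)
  then show "A \<otimes>\<^bsub>Sp\<^esub> B \<in> carrier Sp"
    using A B by (simp add: Sp_def qadjoint_mult)
qed (simp_all add: Sp_def matrix_mul_assoc)

lemma group_Sp1: "group Sp1"
proof (rule groupI)
  fix x assume x: "x \<in> carrier Sp1"
  then have "x \<noteq> 0" by (auto simp: Sp1_def)
  then show "\<exists>y\<in>carrier Sp1. y \<otimes>\<^bsub>Sp1\<^esub> x = \<one>\<^bsub>Sp1\<^esub>"
    using x by (intro bexI[of _ "inverse x"]) (simp_all add: Sp1_def norm_inverse)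
qed (auto simp: Sp1_def norm_mult mult.assoc)

lemma quat_of_complex_mult: "quat_of_complex (z * w) = quat_of_complex z * quat_of_complex w"
  by (simp add: quat_of_complex_def times_quat_def)

lemma norm_quat_of_complex [simp]: "norm (quat_of_complex z) = norm z"
  by (simp add: quat_of_complex_def norm_quat_def inner_quat_def cmod_def power2_eq_square)

lemma quat_of_complex_1 [simp]: "quat_of_complex 1 = 1"
  by (simp add: quat_of_complex_def one_quat_def)

lemma quat_of_complex_inverse: "quat_of_complex (inverse z) = inverse (quat_of_complex z)"
  by (simp add: quat_of_complex_def inverse_quat_def inner_quat_def qcnj_def scaleR_quat_def
      power2_eq_square divide_inverse mult.commute)

lemma quat_of_complex_power: "quat_of_complex (z ^ k) = quat_of_complex z ^ k"
  by (induction k) (simp_all add: quat_of_complex_mult)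

lemma quat_of_complex_powi: "quat_of_complex (z powi k) = quat_of_complex z powi k"
  by (simp add: power_int_def quat_of_complex_power quat_of_complex_inverse)

lemma group_S1: "group S1"
proof (rule groupI)
  fix x assume "x \<in> carrier S1"
  then obtain z where z: "x = quat_of_complex z" "norm z = 1" by (auto simp: S1_def)
  then have "z \<noteq> 0" by auto
  then show "\<exists>y\<in>carrier S1. y \<otimes>\<^bsub>S1\<^esub> x = \<one>\<^bsub>S1\<^esub>"
    using z by (intro bexI[of _ "quat_of_complex (inverse z)"])
      (simp_all add: S1_def Sp1_def norm_inverse quat_of_complex_mult[symmetric])
next
  show "\<one>\<^bsub>S1\<^esub> \<in> carrier S1"
    by (auto simp: S1_def Sp1_def intro: image_eqI[of _ _ 1])
qed (auto simp: S1_def Sp1_def norm_mult mult.assoc quat_of_complex_mult[symmetric]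
    intro!: imageI)

lemma group_GG: "group GG" and group_HH: "group HH"
  by (simp_all add: GG_def HH_def DirProd_group group_Sp group_Sp1 group_S1)

lemma diag2_mult: "diag2 a b ** diag2 c d = diag2 (a * c) (b * (d::quat))"
  by (simp add: diag2_def matrix_matrix_mult_def vec_eq_iff forall_2 sum_2)

lemma diag2_Sp: "norm a = 1 \<Longrightarrow> norm b = 1 \<Longrightarrow> diag2 a b \<in> carrier Sp"
proof -
  assume *: "norm a = 1" "norm b = 1"
  have "qadjoint (diag2 a b) = diag2 (qcnj a) (qcnj b)"
    by (simp add: diag2_def qadjoint_def vec_eq_iff forall_2)
  moreover have "diag2 1 1 = (mat 1 :: quat ^ 2 ^ 2)"
    by (simp add: diag2_def mat_def vec_eq_iff forall_2)
  ultimately show ?thesis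
    using * by (simp add: Sp_def diag2_mult mult_qcnj_self)
qed

lemma ff_hom: "ff l m n \<in> hom HH (GG \<times>\<times> GG)"
proof (rule homI)
  fix h assume "h \<in> carrier HH"
  then show "ff l m n h \<in> carrier (GG \<times>\<times> GG)"
    by (auto simp: ff_def HH_def GG_def S1_def norm_power_int intro!: diag2_Sp)
      (auto simp: Sp1_def norm_power_int)
next
  have powi: "(quat_of_complex z * quat_of_complex w) powi k =
      quat_of_complex z powi k * quat_of_complex w powi k" for z w k
    by (simp add: quat_of_complex_mult[symmetric] quat_of_complex_powi[symmetric]
        power_int_mult_distrib)
  fix h h' assume "h \<in> carrier HH" "h' \<in> carrier HH"
  then show "ff l m n (h \<otimes>\<^bsub>HH\<^esub> h') = ff l m n h \<otimes>\<^bsub>GG \<times>\<times> GG\<^esub> ff l m n h'"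
    by (auto simp: ff_def HH_def GG_def S1_def Sp1_def Sp_def diag2_mult powi)
qed

definition GG_mfd :: "((quat ^ 2 ^ 2) \<times> quat, real ^ 13) mfd" where
  "GG_mfd = euclidean_submfd (carrier GG)"

end

theory Submission
  imports Defs
begin

text \<open>The invariants of \<open>Sp(1)\<^sup>2\<close> identify the quotient of \<open>Sp(2)\<close> with \<open>S\<^sup>4 \<subseteq> \<real> \<times> \<complex> \<times> \<complex>\<close>, on
  which \<open>z\<close> acts with weights \<open>0\<close>, \<open>m - n\<close> and \<open>m + n\<close>. Since these are even, \<open>\<zeta> = z\<^sup>2\<close> acts freely on
  \<open>S\<^sup>3 \<times> S\<^sup>4\<close> with weights \<open>(m - n) / 2\<close> and \<open>(m + n) / 2\<close> on the second factor, and the biquotient is a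
  linear \<open>S\<^sup>4\<close> bundle over \<open>S\<^sup>3 / S\<^sup>1 = S\<^sup>2\<close>. Polynomial invariants embed this bundle in a Euclidean
  space, from where its structure is transported to the orbit space and to \<open>S\<^sup>2 \<times> S\<^sup>4\<close>.

  The clutching loop rotates two planes with weights whose sum is \<open>m\<close> up to signs, hence odd. A
  trivialisation would give a null-homotopy of this loop in \<open>O(5)\<close>. For orthogonal \<open>F\<close>, \<open>G\<close> the
  Clifford elements \<open>c(F b)\<close>, \<open>c(G b)\<close> are intertwined by an explicit matrix that depends continuously on
  \<open>F\<close> and \<open>G\<close> and is invertible when they are close. Multiplying these matrices along a loop gives
  a nonzero real number whose sign is constant under homotopies; it is positive for constant
  loops and negative for the clutching loop.\<close>

section \<open>Calculus of smooth functions\<close>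

text \<open>The product around the loop is real because it commutes with every Clifford element
  \<open>cl v\<close>, and among the quaternionic 2 by 2 matrices only the real scalars do so. Up to
  positive factors the partial products trace a lift of the loop to Spin(5) = Sp(2), and the sign
  tells whether this lift closes up. So the generator of pi_1(SO(5)) = Z/2 is detected by the
  intermediate value theorem, without covering spaces. Working with all of O(5) costs nothing,
  because nearby orthogonal maps always have an invertible intertwiner. The smooth structure of the
  orbit space is pinned down by the demand that the projection be a submersion. An explicit map into
  a Euclidean space that separates the orbits and has smooth local sections supplies this structure
  directly, in place of a slice theorem. The same sections show surjectivity of the derivative, so
  no rank has to be computed. The orbit set and the set underlying the bundle live in prescribed
  types, which is why structures are pulled back along bijections.\<close>

lemma Ck_on_Suc_D: "Ck_on (Suc k) S f \<Longrightarrow> Ck_on k S f"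
proof (induction k arbitrary: f)
  case 0
  then show ?case
    by (auto intro!: continuous_at_imp_continuous_on differentiable_imp_continuous_within)
next
  case (Suc k)
  then show ?case by (metis Ck_on.simps(2))
qed

lemma frechet_derivative_cong_open:
  assumes "open S" "x \<in> S" "\<And>y. y \<in> S \<Longrightarrow> f y = g y"
  shows "frechet_derivative f (at x) = frechet_derivative g (at x)"
proof -
  have "(f has_derivative D) (at x) \<longleftrightarrow> (g has_derivative D) (at x)" for D
    using assms by (metis has_derivative_transform_within_open)
  then show ?thesis unfolding frechet_derivative_def by simp
qed

lemma Ck_on_cong:
  assumes "open S" "\<And>x. x \<in> S \<Longrightarrow> f x = g x"
  shows "Ck_on k S f \<longleftrightarrow> Ck_on k S g"
  using assms(2)
proof (induction k arbitrary: f g)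
  case 0
  then show ?case by (auto cong: continuous_on_cong)
next
  case (Suc k)
  have *: "Ck_on k S (\<lambda>x. frechet_derivative f (at x) v) = Ck_on k S (\<lambda>x. frechet_derivative g (at x) v)" for v
    by (rule Suc.IH) (metis Suc.prems assms(1) frechet_derivative_cong_open)
  have "f differentiable at x \<longleftrightarrow> g differentiable at x" if "x \<in> S" for x
    using Suc.prems assms(1) that unfolding differentiable_def
    by (metis has_derivative_transform_within_open)
  then show ?case by (simp add: *)
qed

lemma Ck_on_subset: "Ck_on k S f \<Longrightarrow> T \<subseteq> S \<Longrightarrow> Ck_on k T f"
  by (induction k arbitrary: f) (auto intro: continuous_on_subset)

lemma Ck_on_local:
  assumes "\<And>x. x \<in> S \<Longrightarrow> \<exists>W. open W \<and> x \<in> W \<and> Ck_on k W f"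
  shows "Ck_on k S f"
  using assms
proof (induction k arbitrary: f)
  case 0
  have "isCont f x" if "x \<in> S" for x
    using 0[OF that] by (auto simp: continuous_on_eq_continuous_at)
  then show ?case by (simp add: continuous_at_imp_continuous_on)
next
  case (Suc k)
  have "Ck_on k S (\<lambda>x. frechet_derivative f (at x) v)" for v
    by (rule Suc.IH) (metis Suc.prems Ck_on.simps(2))
  then show ?case using Suc.prems by fastforce
qed

lemma Ck_on_const [simp]: "Ck_on k S (\<lambda>x. c)"
  by (induction k arbitrary: c) auto

lemma frechet_derivative_bounded_linear:
  "bounded_linear L \<Longrightarrow> frechet_derivative L (at x) = L"
  by (metis bounded_linear_imp_has_derivative frechet_derivative_at)

lemma Ck_on_bounded_linear: "bounded_linear L \<Longrightarrow> Ck_on k S L"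
proof (cases k)
  case (Suc n)
  assume "bounded_linear L"
  then show ?thesis
    by (simp add: Suc frechet_derivative_bounded_linear bounded_linear_imp_differentiable)
qed (simp add: bounded_linear.continuous_on continuous_on_id linear_continuous_on)

lemma Ck_on_add:
  assumes "open S" "Ck_on k S f" "Ck_on k S g"
  shows "Ck_on k S (\<lambda>x. f x + g x)"
  using assms(2,3)
proof (induction k arbitrary: f g)
  case (Suc k)
  have "frechet_derivative (\<lambda>x. f x + g x) (at x) v =
      frechet_derivative f (at x) v + frechet_derivative g (at x) v" if "x \<in> S" for x v
  proof -
    have "((\<lambda>x. f x + g x) has_derivative
        (\<lambda>v. frechet_derivative f (at x) v + frechet_derivative g (at x) v)) (at x)"
      using Suc.prems that by (intro has_derivative_add) (auto simp: frechet_derivative_works[symmetric])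
    from frechet_derivative_at[OF this, symmetric] show ?thesis by simp
  qed
  then have "Ck_on k S (\<lambda>x. frechet_derivative (\<lambda>x. f x + g x) (at x) v) \<longleftrightarrow>
      Ck_on k S (\<lambda>x. frechet_derivative f (at x) v + frechet_derivative g (at x) v)" for v
    by (intro Ck_on_cong assms)
  then show ?case using Suc by auto
qed (auto intro: continuous_on_add)

lemma Ck_on_bounded_bilinear:
  fixes f :: "'a::euclidean_space \<Rightarrow> 'b::euclidean_space" and g :: "'a \<Rightarrow> 'c::euclidean_space"
    and B :: "'b \<Rightarrow> 'c \<Rightarrow> 'd::euclidean_space"
  assumes "bounded_bilinear B" "open S" "Ck_on k S f" "Ck_on k S g"
  shows "Ck_on k S (\<lambda>x. B (f x) (g x))"
  using assms(3,4)
proof (induction k arbitrary: f g)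
  case 0
  then show ?case using bounded_bilinear.continuous_on[OF assms(1)] by auto
next
  case (Suc k)
  have *: "((\<lambda>x. B (f x) (g x)) has_derivative
        (\<lambda>v. B (f x) (frechet_derivative g (at x) v) + B (frechet_derivative f (at x) v) (g x))) (at x)"
    if "x \<in> S" for x
    using Suc.prems that
    by (intro bounded_bilinear.FDERIV[OF assms(1)]) (auto simp: frechet_derivative_works[symmetric])
  then have "Ck_on k S (\<lambda>x. frechet_derivative (\<lambda>x. B (f x) (g x)) (at x) v) \<longleftrightarrow>
      Ck_on k S (\<lambda>x. B (f x) (frechet_derivative g (at x) v) + B (frechet_derivative f (at x) v) (g x))" for v
    by (intro Ck_on_cong assms) (simp add: frechet_derivative_at[OF *, symmetric])
  moreover have "Ck_on k S (\<lambda>x. B (f x) (frechet_derivative g (at x) v) + B (frechet_derivative f (at x) v) (g x))" for v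
    using Suc.prems Ck_on_Suc_D[OF Suc.prems(1)] Ck_on_Suc_D[OF Suc.prems(2)]
    by (intro Ck_on_add Suc.IH assms) auto
  ultimately show ?case using * by (auto simp: differentiable_def)
qed

lemma Ck_on_sum:
  assumes "open S" "\<And>i. i \<in> I \<Longrightarrow> Ck_on k S (f i)"
  shows "Ck_on k S (\<lambda>x. \<Sum>i\<in>I. f i x)"
  using assms(2)
  by (induction I rule: infinite_finite_induct) (auto intro: Ck_on_add assms)

text \<open>The derivative of a composition expands along a basis into products of compositions of lower
  order, which is what makes the induction go through.\<close>

lemma Ck_on_compose:
  fixes f :: "'a::euclidean_space \<Rightarrow> 'b::euclidean_space" and g :: "'b \<Rightarrow> 'c::euclidean_space"
  assumes "open S" "Ck_on k S f" "open T" "Ck_on k T g" "f ` S \<subseteq> T"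
  shows "Ck_on k S (\<lambda>x. g (f x))"
  using assms(2,4)
proof (induction k arbitrary: g)
  case 0
  then show ?case using assms by (auto intro: continuous_on_compose2)
next
  case (Suc k)
  have fx: "f x \<in> T" if "x \<in> S" for x using assms that by auto
  have *: "((\<lambda>x. g (f x)) has_derivative
      (\<lambda>v. frechet_derivative g (at (f x)) (frechet_derivative f (at x) v))) (at x)" if "x \<in> S" for x
    using has_derivative_compose[of f "frechet_derivative f (at x)" x UNIV g "frechet_derivative g (at (f x))"]
      Suc.prems that fx[OF that]
    by (auto simp: frechet_derivative_works[symmetric])
  have lin: "linear (frechet_derivative g (at (f x)))" if "x \<in> S" for x
    using Suc.prems fx that by (auto intro: linear_frechet_derivative)
  have **: "frechet_derivative (\<lambda>x. g (f x)) (at x) v =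
     (\<Sum>b\<in>Basis. (frechet_derivative f (at x) v \<bullet> b) *\<^sub>R frechet_derivative g (at (f x)) b)"
    if "x \<in> S" for x v
  proof -
    have "frechet_derivative (\<lambda>x. g (f x)) (at x) v =
        frechet_derivative g (at (f x)) (\<Sum>b\<in>Basis. (frechet_derivative f (at x) v \<bullet> b) *\<^sub>R b)"
      using frechet_derivative_at[OF *[OF that], symmetric] by (simp add: euclidean_representation)
    also have "\<dots> = (\<Sum>b\<in>Basis. (frechet_derivative f (at x) v \<bullet> b) *\<^sub>R frechet_derivative g (at (f x)) b)"
      by (simp add: linear_sum[OF lin[OF that]] linear_scale[OF lin[OF that]])
    finally show ?thesis .
  qed
  have f': "Ck_on k S f" using Suc.prems Ck_on_Suc_D by blast
  have "Ck_on k S (\<lambda>x. \<Sum>b\<in>Basis. (frechet_derivative f (at x) v \<bullet> b) *\<^sub>R frechet_derivative g (at (f x)) b)" for v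
  proof (intro Ck_on_sum assms)
    fix b :: 'b assume "b \<in> Basis"
    have "Ck_on k S (\<lambda>x. frechet_derivative f (at x) v \<bullet> b)"
      by (rule Ck_on_bounded_bilinear[OF bounded_bilinear_inner assms(1)]) (use Suc.prems in auto)
    moreover have "Ck_on k S (\<lambda>x. frechet_derivative g (at (f x)) b)"
      using Suc.IH[of "\<lambda>y. frechet_derivative g (at y) b"] f' Suc.prems by auto
    ultimately show "Ck_on k S (\<lambda>x. (frechet_derivative f (at x) v \<bullet> b) *\<^sub>R frechet_derivative g (at (f x)) b)"
      by (rule Ck_on_bounded_bilinear[OF bounded_bilinear_scaleR assms(1)])
  qed
  then have "Ck_on k S (\<lambda>x. frechet_derivative (\<lambda>x. g (f x)) (at x) v)" for v
    by (subst Ck_on_cong[OF assms(1) **])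
  then show ?case using * by (auto simp: differentiable_def)
qed

section \<open>Smooth functions on open sets, with inverse and square root\<close>

lemma smooth_on_cong: "open S \<Longrightarrow> (\<And>x. x \<in> S \<Longrightarrow> f x = g x) \<Longrightarrow> smooth_on S f \<longleftrightarrow> smooth_on S g"
  using Ck_on_cong unfolding smooth_on_def by blast

lemma smooth_on_subset: "smooth_on S f \<Longrightarrow> T \<subseteq> S \<Longrightarrow> smooth_on T f"
  using Ck_on_subset unfolding smooth_on_def by blast

lemma smooth_on_local:
  assumes "\<And>x. x \<in> S \<Longrightarrow> \<exists>W. open W \<and> x \<in> W \<and> smooth_on W f"
  shows "smooth_on S f"
  using assms unfolding smooth_on_def by (metis Ck_on_local)

lemma smooth_on_imp_continuous_on: "smooth_on S f \<Longrightarrow> continuous_on S f"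
  unfolding smooth_on_def by (metis Ck_on.simps(1))

lemma smooth_on_imp_differentiable: "smooth_on S f \<Longrightarrow> x \<in> S \<Longrightarrow> f differentiable at x"
  unfolding smooth_on_def by (metis Ck_on.simps(2))

lemma smooth_on_const: "smooth_on S (\<lambda>x. c)"
  by (simp add: smooth_on_def)

lemma smooth_on_bounded_linear: "bounded_linear L \<Longrightarrow> smooth_on S L"
  by (simp add: smooth_on_def Ck_on_bounded_linear)

lemma smooth_on_compose:
  assumes "open S" "smooth_on S f" "open T" "smooth_on T g" "f ` S \<subseteq> T"
  shows "smooth_on S (\<lambda>x. g (f x))"
  using assms unfolding smooth_on_def by (metis Ck_on_compose)

lemma smooth_on_linear_compose:
  assumes "bounded_linear L" "open S" "smooth_on S f"
  shows "smooth_on S (\<lambda>x. L (f x))"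
  using smooth_on_compose[OF assms(2,3) open_UNIV smooth_on_bounded_linear[OF assms(1)]] by simp

lemma smooth_on_bounded_bilinear:
  assumes "bounded_bilinear B" "open S" "smooth_on S f" "smooth_on S g"
  shows "smooth_on S (\<lambda>x. B (f x) (g x))"
  using assms unfolding smooth_on_def by (metis Ck_on_bounded_bilinear)

lemma smooth_on_add: "open S \<Longrightarrow> smooth_on S f \<Longrightarrow> smooth_on S g \<Longrightarrow> smooth_on S (\<lambda>x. f x + g x)"
  unfolding smooth_on_def by (metis Ck_on_add)

lemma smooth_on_Pair:
  fixes f :: "'a::euclidean_space \<Rightarrow> 'b::euclidean_space" and g :: "'a \<Rightarrow> 'c::euclidean_space"
  assumes "open S" "smooth_on S f" "smooth_on S g"
  shows "smooth_on S (\<lambda>x. (f x, g x))"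
proof -
  have "bounded_linear (\<lambda>x::'b. (x, 0::'c))" "bounded_linear (\<lambda>y::'c. (0::'b, y))"
    by (auto intro!: bounded_linear_intros)
  then have "smooth_on S (\<lambda>x. (f x, 0::'c) + (0::'b, g x))"
    by (intro smooth_on_add smooth_on_linear_compose[of "\<lambda>x::'b. (x, 0::'c)"]
        smooth_on_linear_compose[of "\<lambda>y::'c. (0::'b, y)"] assms)
  then show ?thesis by simp
qed

text \<open>Bootstrapping for solutions of a differential equation: the derivative is expressed
  through \<open>f\<close> itself, so class C^k of \<open>f\<close> passes to the derivative and
  raises the class of \<open>f\<close> by one. \<open>inverse\<close> and \<open>sqrt\<close> are
  treated in this way.\<close>

lemma smooth_on_SucI:
  assumes "open S" "\<And>x. x \<in> S \<Longrightarrow> (f has_derivative D x) (at x)" "\<And>k v. Ck_on k S f \<Longrightarrow> Ck_on k S (\<lambda>x. D x v)"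
  shows "smooth_on S f"
proof -
  have "Ck_on k S f" for k
  proof (induction k)
    case 0
    have "isCont f x" if "x \<in> S" for x
      using assms(2)[OF that] has_derivative_continuous by blast
    then show ?case by (simp add: continuous_at_imp_continuous_on)
  next
    case (Suc k)
    have "Ck_on k S (\<lambda>x. frechet_derivative f (at x) v)" for v
      using Ck_on_cong[OF assms(1), of "\<lambda>x. frechet_derivative f (at x) v" "\<lambda>x. D x v" k]
        assms(3)[OF Suc] frechet_derivative_at[OF assms(2), symmetric] by simp
    then show ?case using assms(2) by (auto simp: differentiable_def)
  qed
  then show ?thesis by (simp add: smooth_on_def)
qed

lemma Ck_on_mult:
  fixes f g :: "'a::euclidean_space \<Rightarrow> real"
  shows "open S \<Longrightarrow> Ck_on k S f \<Longrightarrow> Ck_on k S g \<Longrightarrow> Ck_on k S (\<lambda>x. f x * g x)"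
  by (rule Ck_on_bounded_bilinear[OF bounded_bilinear_mult])

lemma smooth_on_inverse_real: "smooth_on (- {0::real}) inverse"
proof (rule smooth_on_SucI)
  fix k and v :: real
  assume *: "Ck_on k (- {0::real}) inverse"
  have "Ck_on k (- {0::real}) (\<lambda>x. (- v) * (inverse x * inverse x))"
    by (intro Ck_on_mult * Ck_on_const) auto
  then show "Ck_on k (- {0::real}) (\<lambda>x. - (inverse x * v * inverse x))"
    by (simp add: mult_ac)
qed (auto intro!: derivative_eq_intros)

lemma smooth_on_sqrt: "smooth_on {0<..} sqrt"
proof (rule smooth_on_SucI)
  fix k and v :: real
  assume *: "Ck_on k {0<..} sqrt"
  have inv: "Ck_on k {0<..} (\<lambda>x. inverse (sqrt x))"
    by (rule Ck_on_compose[OF _ * , of "- {0}"])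
      (use smooth_on_inverse_real in \<open>auto simp: smooth_on_def\<close>)
  show "Ck_on k {0<..} (\<lambda>x. (v / 2) * inverse (sqrt x))"
    by (intro Ck_on_mult Ck_on_const inv) auto
qed (auto intro!: derivative_eq_intros simp: field_simps)

section \<open>Smoothness on arbitrary subsets, by local extension\<close>

lemma smooth_on_subsetI:
  "open W \<Longrightarrow> U \<subseteq> W \<Longrightarrow> smooth_on W f \<Longrightarrow> smooth_on_subset U f"
  unfolding smooth_on_subset_def by blast

text \<open>The bridge between two notions: coordinate representatives are tested with
  \<open>smooth_on\<close> on open sets, while explicit maps are built with
  \<open>smooth_on_subset\<close>, whose rules ask for no openness.\<close>

lemma smooth_on_subset_open_iff: "open U \<Longrightarrow> smooth_on_subset U f \<longleftrightarrow> smooth_on U f"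
proof
  assume U: "open U" and f: "smooth_on_subset U f"
  show "smooth_on U f"
  proof (rule smooth_on_local)
    fix x assume x: "x \<in> U"
    then obtain W g where W: "open W" "x \<in> W" "smooth_on W g" "\<forall>y\<in>U \<inter> W. g y = f y"
      using f unfolding smooth_on_subset_def by blast
    have "smooth_on (U \<inter> W) f"
      using smooth_on_cong[of "U \<inter> W" f g] smooth_on_subset[OF W(3), of "U \<inter> W"] U W by auto
    then show "\<exists>W. open W \<and> x \<in> W \<and> smooth_on W f" using U W x by blast
  qed
qed (auto intro: smooth_on_subsetI)

lemma smooth_on_subset_mono: "smooth_on_subset U f \<Longrightarrow> V \<subseteq> U \<Longrightarrow> smooth_on_subset V f"
  unfolding smooth_on_subset_def
proof
  fix x assume U: "\<forall>x\<in>U. \<exists>W g. open W \<and> x \<in> W \<and> smooth_on W g \<and> (\<forall>y\<in>U \<inter> W. g y = f y)"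
    and "V \<subseteq> U" "x \<in> V"
  then obtain W g where "open W" "x \<in> W" "smooth_on W g" "\<forall>y\<in>U \<inter> W. g y = f y" by blast
  with \<open>V \<subseteq> U\<close> show "\<exists>W g. open W \<and> x \<in> W \<and> smooth_on W g \<and> (\<forall>y\<in>V \<inter> W. g y = f y)"
    by (intro exI[of _ W] exI[of _ g]) auto
qed

lemma smooth_on_subset_cong:
  "(\<And>x. x \<in> U \<Longrightarrow> f x = g x) \<Longrightarrow> smooth_on_subset U f \<longleftrightarrow> smooth_on_subset U g"
  unfolding smooth_on_subset_def by (metis Int_iff)

lemma smooth_on_subset_imp_continuous_on:
  assumes "smooth_on_subset U f"
  shows "continuous_on U f"
proof -
  have "continuous (at x within U) f" if x: "x \<in> U" for x
  proof -
    obtain W g where W: "open W" "x \<in> W" "smooth_on W g" "\<forall>y\<in>U \<inter> W. g y = f y"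
      using assms x unfolding smooth_on_subset_def by blast
    have "isCont g x"
      using smooth_on_imp_continuous_on[OF W(3)] W(1,2) continuous_on_eq_continuous_at by blast
    then have cont: "continuous (at x within U) g" by (rule continuous_at_imp_continuous_at_within)
    obtain d where d: "0 < d" "ball x d \<subseteq> W" using W(1,2) openE by blast
    show ?thesis
      by (rule continuous_transform_within[OF cont d(1) x])
       (use d W(4) in \<open>auto simp: subset_iff dist_commute\<close>)
  qed
  then show ?thesis by (simp add: continuous_on_eq_continuous_within)
qed

lemma smooth_on_subset_compose:
  assumes "smooth_on_subset U f" "smooth_on_subset V g" "f ` U \<subseteq> V"
  shows "smooth_on_subset U (\<lambda>x. g (f x))"
  unfolding smooth_on_subset_def
proof
  fix x assume x: "x \<in> U"
  obtain W f' where W: "open W" "x \<in> W" "smooth_on W f'" "\<forall>y\<in>U \<inter> W. f' y = f y"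
    using assms(1) x unfolding smooth_on_subset_def by blast
  obtain X g' where X: "open X" "f x \<in> X" "smooth_on X g'" "\<forall>y\<in>V \<inter> X. g' y = g y"
    using assms(2,3) x unfolding smooth_on_subset_def by blast
  \<comment> \<open>The extension \<open>f'\<close> may leave the set \<open>X\<close> on which
    \<open>g'\<close> is smooth, so the neighbourhood is cut down to where it stays inside.\<close>
  let ?W = "W \<inter> f' -` X"
  have "open ?W"
    using smooth_on_imp_continuous_on[OF W(3)] W(1) X(1)
    by (simp add: continuous_on_open_vimage Int_commute)
  moreover have "smooth_on ?W (\<lambda>x. g' (f' x))"
    by (rule smooth_on_compose[OF \<open>open ?W\<close> smooth_on_subset[OF W(3)] X(1,3)]) auto
  moreover have "x \<in> ?W" using x W X by auto
  moreover have "\<forall>y\<in>U \<inter> ?W. g' (f' y) = g (f y)" using W X assms(3) by auto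
  ultimately show "\<exists>W h. open W \<and> x \<in> W \<and> smooth_on W h \<and> (\<forall>y\<in>U \<inter> W. h y = g (f y))"
    by blast
qed

lemma smooth_on_subset_Pair:
  assumes "smooth_on_subset U f" "smooth_on_subset U g"
  shows "smooth_on_subset U (\<lambda>x. (f x, g x))"
  unfolding smooth_on_subset_def
proof
  fix x assume x: "x \<in> U"
  obtain W f' where W: "open W" "x \<in> W" "smooth_on W f'" "\<forall>y\<in>U \<inter> W. f' y = f y"
    using assms(1) x unfolding smooth_on_subset_def by blast
  obtain X g' where X: "open X" "x \<in> X" "smooth_on X g'" "\<forall>y\<in>U \<inter> X. g' y = g y"
    using assms(2) x unfolding smooth_on_subset_def by blast
  have "smooth_on (W \<inter> X) (\<lambda>x. (f' x, g' x))"
    using W X by (intro smooth_on_Pair smooth_on_subset[OF W(3)] smooth_on_subset[OF X(3)]) auto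
  then show "\<exists>W h. open W \<and> x \<in> W \<and> smooth_on W h \<and> (\<forall>y\<in>U \<inter> W. h y = (f y, g y))"
    using W X by (intro exI[of _ "W \<inter> X"] exI[of _ "\<lambda>x. (f' x, g' x)"]) auto
qed

lemma smooth_on_subset_const: "smooth_on_subset U (\<lambda>x. c)"
  by (rule smooth_on_subsetI[OF open_UNIV _ smooth_on_const]) auto

lemma smooth_on_subset_bounded_linear: "bounded_linear L \<Longrightarrow> smooth_on_subset U L"
  by (rule smooth_on_subsetI[OF open_UNIV _ smooth_on_bounded_linear]) auto

lemma smooth_on_subset_ident: "smooth_on_subset U (\<lambda>x. x)"
  by (rule smooth_on_subset_bounded_linear) (rule bounded_linear_ident)

lemma smooth_on_subset_linear_compose:
  "bounded_linear L \<Longrightarrow> smooth_on_subset U f \<Longrightarrow> smooth_on_subset U (\<lambda>x. L (f x))"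
  by (rule smooth_on_subset_compose[OF _ smooth_on_subset_bounded_linear[of _ UNIV]]) auto

lemma smooth_on_subset_bounded_bilinear:
  fixes f :: "'a::euclidean_space \<Rightarrow> 'b::euclidean_space" and g :: "'a \<Rightarrow> 'c::euclidean_space"
    and B :: "'b \<Rightarrow> 'c \<Rightarrow> 'd::euclidean_space"
  assumes "bounded_bilinear B" "smooth_on_subset U f" "smooth_on_subset U g"
  shows "smooth_on_subset U (\<lambda>x. B (f x) (g x))"
proof -
  have "smooth_on UNIV (\<lambda>p. B (fst p) (snd p))"
    by (rule smooth_on_bounded_bilinear[OF assms(1) open_UNIV
          smooth_on_bounded_linear[OF bounded_linear_fst] smooth_on_bounded_linear[OF bounded_linear_snd]])
  then have "smooth_on_subset UNIV (\<lambda>p. B (fst p) (snd p))"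
    by (simp add: smooth_on_subset_open_iff)
  from smooth_on_subset_compose[OF smooth_on_subset_Pair[OF assms(2,3)] this] show ?thesis by simp
qed

lemma smooth_on_subset_sqrt:
  "smooth_on_subset U f \<Longrightarrow> (\<And>x. x \<in> U \<Longrightarrow> 0 < f x) \<Longrightarrow> smooth_on_subset U (\<lambda>x. sqrt (f x))"
  by (rule smooth_on_subset_compose[of U f "{0<..}" sqrt])
    (auto simp: smooth_on_subset_open_iff smooth_on_sqrt)

lemma smooth_on_subset_inverse:
  "smooth_on_subset U f \<Longrightarrow> (\<And>x. x \<in> U \<Longrightarrow> f x \<noteq> 0) \<Longrightarrow> smooth_on_subset U (\<lambda>x. inverse (f x :: real))"
  by (rule smooth_on_subset_compose[of U f "- {0}" inverse])
    (auto intro: smooth_on_subset_open_iff[THEN iffD2] smooth_on_inverse_real)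

named_theorems smooth_intros

lemmas [smooth_intros] = smooth_on_subset_const smooth_on_subset_ident smooth_on_subset_Pair
  smooth_on_subset_sqrt smooth_on_subset_inverse
  smooth_on_subset_linear_compose[OF bounded_linear_fst]
  smooth_on_subset_linear_compose[OF bounded_linear_snd]
  smooth_on_subset_linear_compose[OF bounded_linear_Re]
  smooth_on_subset_linear_compose[OF bounded_linear_Im]
  smooth_on_subset_linear_compose[OF bounded_linear_cnj]
  smooth_on_subset_linear_compose[OF bounded_linear_of_real[where ?'a = complex]]
  smooth_on_subset_bounded_bilinear[OF bounded_bilinear_mult]
  smooth_on_subset_bounded_bilinear[OF bounded_bilinear_scaleR]
  smooth_on_subset_bounded_bilinear[OF bounded_bilinear_inner]

lemma smooth_on_subset_add [smooth_intros]:
  fixes f g :: "'a::euclidean_space \<Rightarrow> 'b::euclidean_space"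
  assumes "smooth_on_subset U f" "smooth_on_subset U g"
  shows "smooth_on_subset U (\<lambda>x. f x + g x)"
proof -
  have "bounded_linear (\<lambda>p::'b \<times> 'b. fst p + snd p)"
    by (intro bounded_linear_add bounded_linear_fst bounded_linear_snd)
  from smooth_on_subset_linear_compose[OF this smooth_on_subset_Pair[OF assms]] show ?thesis by simp
qed

lemma smooth_on_subset_minus [smooth_intros]:
  "smooth_on_subset U f \<Longrightarrow> smooth_on_subset U (\<lambda>x. - f x)"
  by (rule smooth_on_subset_linear_compose) (rule bounded_linear_minus[OF bounded_linear_ident])

lemma smooth_on_subset_diff [smooth_intros]:
  "smooth_on_subset U f \<Longrightarrow> smooth_on_subset U g \<Longrightarrow> smooth_on_subset U (\<lambda>x. f x - g x)"
  using smooth_on_subset_add[OF _ smooth_on_subset_minus, of U f g] by simp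

lemma smooth_on_subset_divide_real [smooth_intros]:
  fixes f g :: "'a::euclidean_space \<Rightarrow> real"
  shows "smooth_on_subset U f \<Longrightarrow> smooth_on_subset U g \<Longrightarrow> (\<And>x. x \<in> U \<Longrightarrow> g x \<noteq> 0) \<Longrightarrow>
    smooth_on_subset U (\<lambda>x. f x / g x)"
  unfolding divide_inverse by (intro smooth_intros)

lemma smooth_on_subset_power [smooth_intros]:
  fixes f :: "'a::euclidean_space \<Rightarrow> 'b::{euclidean_space, real_normed_algebra_1}"
  shows "smooth_on_subset U f \<Longrightarrow> smooth_on_subset U (\<lambda>x. f x ^ n)"
  by (induction n) (auto intro!: smooth_intros)


section \<open>Submanifolds of Euclidean spaces\<close>

text \<open>A diffeomorphism between arbitrary subsets of Euclidean spaces with its inverse named,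
  so that maps can be composed and restricted before any manifold structure is chosen.\<close>

definition ediff :: "'a::euclidean_space set \<Rightarrow> 'b::euclidean_space set \<Rightarrow> ('a \<Rightarrow> 'b) \<Rightarrow> ('b \<Rightarrow> 'a) \<Rightarrow> bool" where
  "ediff A B f g \<longleftrightarrow> smooth_on_subset A f \<and> smooth_on_subset B g \<and> f ` A \<subseteq> B \<and> g ` B \<subseteq> A \<and>
     (\<forall>x\<in>A. g (f x) = x) \<and> (\<forall>y\<in>B. f (g y) = y)"

lemma ediff_sym: "ediff A B f g \<Longrightarrow> ediff B A g f"
  by (auto simp: ediff_def)

lemma ediff_trans: "ediff A B f g \<Longrightarrow> ediff B C f' g' \<Longrightarrow> ediff A C (\<lambda>x. f' (f x)) (\<lambda>x. g (g' x))"
  unfolding ediff_def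
  by (auto intro!: smooth_on_subset_compose[of A f B f'] smooth_on_subset_compose[of C g' B g]
      simp: image_subset_iff)

lemma ediff_restrict:
  "ediff A B f g \<Longrightarrow> ediff (A \<inter> f -` V) (B \<inter> V) f g"
  by (auto simp: ediff_def intro: smooth_on_subset_mono)

lemma ediff_times:
  assumes "ediff A B f g" "ediff A' B' f' g'"
  shows "ediff (A \<times> A') (B \<times> B') (map_prod f f') (map_prod g g')"
proof -
  have sm: "smooth_on_subset (A \<times> A') (map_prod f f')" if
    "smooth_on_subset A f" "smooth_on_subset A' f'"
    for A :: "'x::euclidean_space set" and A' :: "'y::euclidean_space set" and f :: "'x \<Rightarrow> 'v::euclidean_space" and f' :: "'y \<Rightarrow> 'w::euclidean_space"
    unfolding map_prod_def case_prod_unfold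
    by (intro smooth_intros smooth_on_subset_compose[of "A \<times> A'" fst A f]
        smooth_on_subset_compose[of "A \<times> A'" snd A' f'] that) auto
  show ?thesis
    using assms sm[of A f A' f'] sm[of B g B' g'] unfolding ediff_def
    by (intro conjI) (simp_all add: image_subset_iff)
qed

lemma ediff_relative_open:
  assumes "ediff A B f g" "openin (top_of_set B) V"
  shows "openin (top_of_set A) (A \<inter> f -` V)"
proof -
  have "continuous_on A f" "f \<in> A \<rightarrow> B"
    using assms by (auto simp: ediff_def intro: smooth_on_subset_imp_continuous_on)
  then show ?thesis using assms(2) by (metis continuous_openin_preimage)
qed

text \<open>The \<open>itself\<close> argument names the model space and thereby encodes the
  dimension.\<close>

definition submfd :: "'e::euclidean_space itself \<Rightarrow> 'a::euclidean_space set \<Rightarrow> bool" where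
  "submfd _ S \<longleftrightarrow> (\<forall>x\<in>S. \<exists>U O' f g. x \<in> U \<and> openin (top_of_set S) U \<and> open O' \<and> ediff U (O' :: 'e set) f g)"

text \<open>The local models may themselves be submanifolds, not only open sets. A bundle thus
  inherits its charts from products such as \<open>S2N \<times> sphere 0 1\<close> through local
  trivialisations.\<close>

lemma submfd_local:
  assumes "\<And>x. x \<in> T \<Longrightarrow> \<exists>U (S :: 'b::euclidean_space set) f g. x \<in> U \<and> openin (top_of_set T) U \<and>
    submfd TYPE('e::euclidean_space) S \<and> ediff U S f g"
  shows "submfd TYPE('e) T"
  unfolding submfd_def
proof
  fix x assume "x \<in> T"
  then obtain U f g and S :: "'b set" where U: "x \<in> U" "openin (top_of_set T) U" "submfd TYPE('e) S" "ediff U S f g"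
    using assms[OF \<open>x \<in> T\<close>] by (elim exE conjE)
  then have "f x \<in> S" by (auto simp: ediff_def)
  then obtain V f' g' and O' :: "'e set" where V: "f x \<in> V" "openin (top_of_set S) V" "open O'" "ediff V O' f' g'"
    using U(3) unfolding submfd_def by blast
  have "openin (top_of_set U) (U \<inter> f -` V)" by (rule ediff_relative_open[OF U(4) V(2)])
  then have "openin (top_of_set T) (U \<inter> f -` V)" using U(2) openin_trans by blast
  moreover have "V \<subseteq> S" using V(2) openin_imp_subset by blast
  then have "ediff (U \<inter> f -` V) V f g" using ediff_restrict[OF U(4), of V] by (simp add: Int_absorb1)
  ultimately have "openin (top_of_set T) (U \<inter> f -` V)" "ediff (U \<inter> f -` V) O' (\<lambda>x. f' (f x)) (\<lambda>x. g (g' x))"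
    using ediff_trans[OF _ V(4)] by auto
  then show "\<exists>U O' f g. x \<in> U \<and> openin (top_of_set T) U \<and> open O' \<and> ediff U (O'::'e set) f g"
    using V(1,3) U(1) by (intro exI[of _ "U \<inter> f -` V"] exI[of _ O'] exI conjI) auto
qed

lemma submfd_open:
  assumes "submfd TYPE('e::euclidean_space) S" "openin (top_of_set S) V"
  shows "submfd TYPE('e) V"
  unfolding submfd_def
proof
  fix x assume x: "x \<in> V"
  have VS: "V \<subseteq> S" using assms(2) openin_imp_subset by blast
  then obtain U O' f g where U: "x \<in> U" "openin (top_of_set S) U" "open (O'::'e set)" "ediff U O' f g"
    using assms(1)[unfolded submfd_def, rule_format, of x] x by blast
  have *: "openin (top_of_set S) (U \<inter> V)" using U assms by blast
  then have "openin (top_of_set V) (U \<inter> V)"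
    by (metis Int_lower2 VS openin_subset_trans)
  moreover have "openin (top_of_set U) (U \<inter> V)"
    using * U(2) by (meson Int_lower1 openin_imp_subset openin_subset_trans)
  from ediff_relative_open[OF ediff_sym[OF U(4)] this]
  have "open (O' \<inter> g -` (U \<inter> V))" using U(3) openin_open_eq by blast
  moreover have "ediff (U \<inter> V) (O' \<inter> g -` (U \<inter> V)) f g"
    using ediff_sym[OF ediff_restrict[OF ediff_sym[OF U(4)], of "U \<inter> V"]]
    by (simp add: Int_assoc[symmetric])
  ultimately show "\<exists>U O' f g. x \<in> U \<and> openin (top_of_set V) U \<and> open O' \<and> ediff U (O'::'e set) f g"
    using U(1) x by blast
qed

text \<open>A linear isomorphism carries the charts over. Products produce models such as
  \<open>(real ^ 2) \<times> (real ^ 4)\<close>, which this lemma exchanges for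
  \<open>real ^ 6\<close>.\<close>

lemma submfd_model:
  assumes "submfd TYPE('e::euclidean_space) S" "DIM('e) = DIM('f::euclidean_space)"
  shows "submfd TYPE('f) S"
  unfolding submfd_def
proof
  obtain L :: "'e \<Rightarrow> 'f" and L' where L: "linear L" "linear L'" "\<And>x. L' (L x) = x" "\<And>y. L (L' y) = y"
    using isomorphisms_UNIV_UNIV[OF assms(2)] by metis
  fix x assume x: "x \<in> S"
  then obtain U O' f g where U: "x \<in> U" "openin (top_of_set S) U" "open (O'::'e set)" "ediff U O' f g"
    using assms(1) unfolding submfd_def by blast
  have eq: "L ` O' = L' -` O'" using L by (auto simp: image_iff) metis
  have "open (L ` O')" unfolding eq using U(3) L(2)
    by (intro open_vimage linear_continuous_on) (auto simp: linear_conv_bounded_linear)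
  moreover have "ediff O' (L ` O') L L'"
    using L by (auto simp: ediff_def linear_conv_bounded_linear intro!: smooth_on_subset_bounded_linear)
  ultimately show "\<exists>U O' f g. x \<in> U \<and> openin (top_of_set S) U \<and> open O' \<and> ediff U (O'::'f set) f g"
    using U by (intro exI[of _ U] exI[of _ "L ` O'"] exI conjI) (auto intro: ediff_trans[OF U(4)])
qed

lemma submfd_times:
  assumes "submfd TYPE('e::euclidean_space) S" "submfd TYPE('f::euclidean_space) T"
  shows "submfd TYPE('e \<times> 'f) (S \<times> T)"
  unfolding submfd_def
proof
  fix p assume p: "p \<in> S \<times> T"
  then obtain U O' f g where U: "fst p \<in> U" "openin (top_of_set S) U" "open (O'::'e set)" "ediff U O' f g"
    using assms(1) unfolding submfd_def by (metis mem_Times_iff)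
  obtain U' O'' f' g' where U': "snd p \<in> U'" "openin (top_of_set T) U'" "open (O''::'f set)" "ediff U' O'' f' g'"
    using assms(2) p unfolding submfd_def by (metis mem_Times_iff)
  show "\<exists>U O' f g. p \<in> U \<and> openin (top_of_set (S \<times> T)) U \<and> open O' \<and> ediff U (O'::('e \<times> 'f) set) f g"
    by (rule exI[of _ "U \<times> U'"], rule exI[of _ "O' \<times> O''"],
        rule exI[of _ "map_prod f f'"], rule exI[of _ "map_prod g g'"])
      (use U(1) U'(1) openin_Times[OF U(2) U'(2)] open_Times[OF U(3) U'(3)] ediff_times[OF U(4) U'(4)]
        in \<open>simp add: mem_Times_iff\<close>)
qed

text \<open>The hemisphere around \<open>x\<close> is the graph of \<open>y \<mapsto> sqrt (1 - |y|\<^sup>2)\<close> over the unit ball of the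
  hyperplane orthogonal to \<open>x\<close>.\<close>

lemma submfd_sphere:
  assumes "DIM('a::euclidean_space) = Suc DIM('e::euclidean_space)"
  shows "submfd TYPE('e) (sphere (0::'a) 1)"
  unfolding submfd_def
proof
  fix x :: 'a assume x: "x \<in> sphere 0 1"
  then have "x \<noteq> 0" by auto
  then have "dim {v. x \<bullet> v = 0} = DIM('e)"
    using dim_hyperplane[of x] assms by simp
  then have dim: "dim (UNIV :: 'e set) = dim {v. x \<bullet> v = 0}" by (simp add: dim_UNIV)
  obtain L :: "'e \<Rightarrow> 'a" and L' where L0: "linear L" "linear L'" "L ` UNIV = {v. x \<bullet> v = 0}"
     "L' ` {v. x \<bullet> v = 0} = UNIV"
     "\<And>y. y \<in> UNIV \<Longrightarrow> norm (L y) = norm y" "\<And>v. v \<in> {v. x \<bullet> v = 0} \<Longrightarrow> norm (L' v) = norm v" "\<And>y. y \<in> UNIV \<Longrightarrow> L' (L y) = y"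
     "\<And>v. v \<in> {v. x \<bullet> v = 0} \<Longrightarrow> L (L' v) = v"
    by (rule isometries_subspaces[OF subspace_UNIV subspace_hyperplane dim]) (rule that)
  then have L: "linear L" "linear L'" "\<And>y. norm (L y) = norm y" "\<And>y. L' (L y) = y"
     "L ` UNIV = {v. x \<bullet> v = 0}" "\<And>v. x \<bullet> v = 0 \<Longrightarrow> L (L' v) = v"
    by simp_all
  have bl: "bounded_linear L" "bounded_linear L'" using L(1,2) linear_conv_bounded_linear by auto
  have xL: "x \<bullet> L y = 0" for y using L(5) by blast
  have nx: "x \<bullet> x = 1" using x by (simp add: norm_eq_sqrt_inner)
  define U where "U = sphere 0 1 \<inter> {v. 0 < x \<bullet> v}"
  define f where "f = (\<lambda>v. L' (v - (x \<bullet> v) *\<^sub>R x))"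
  define g where "g = (\<lambda>y. L y + sqrt (1 - y \<bullet> y) *\<^sub>R x)"
  have "ediff U (ball 0 1) f g"
    unfolding ediff_def
  proof (intro conjI ballI)
    show "smooth_on_subset U f"
      unfolding f_def by (intro smooth_on_subset_linear_compose[OF bl(2)] smooth_intros)
    show "smooth_on_subset (ball 0 1) g"
      unfolding g_def
      by (intro smooth_intros smooth_on_subset_linear_compose[OF bl(1)])
       (auto simp: norm_eq_sqrt_inner)
    have nL: "L y \<bullet> L y = y \<bullet> y" for y using L(3)[of y] by (simp add: norm_eq_sqrt_inner)
    {
      fix v assume v: "v \<in> U"
      then have vv: "v \<bullet> v = 1" "0 < x \<bullet> v" by (auto simp: U_def norm_eq_sqrt_inner)
      have Lf: "L (f v) = v - (x \<bullet> v) *\<^sub>R x"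
        unfolding f_def by (rule L(6)) (simp add: inner_diff_right nx)
      have "f v \<bullet> f v = L (f v) \<bullet> L (f v)" by (simp add: nL)
      also have "\<dots> = 1 - (x \<bullet> v)\<^sup>2"
        by (simp add: Lf inner_diff nx vv inner_commute power2_eq_square)
      finally have ff: "f v \<bullet> f v = 1 - (x \<bullet> v)\<^sup>2" .
      then show "g (f v) = v" using vv by (simp add: g_def Lf)
      have "f v \<bullet> f v < 1" using ff vv by simp
      then have "f v \<in> ball 0 1" by (simp add: norm_eq_sqrt_inner real_sqrt_lt_1_iff)
    }
    then show "f ` U \<subseteq> ball 0 1" by blast
    {
      fix y :: 'e assume "y \<in> ball 0 1"
      then have y: "y \<bullet> y < 1" by (simp add: norm_eq_sqrt_inner real_sqrt_lt_1_iff)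
      have "g y \<bullet> g y = 1" using y
        by (simp add: g_def inner_add inner_commute[of "L y"] xL nx nL power2_eq_square[symmetric])
      moreover have xg: "x \<bullet> g y = sqrt (1 - y \<bullet> y)" by (simp add: g_def inner_add xL nx)
      ultimately have "g y \<in> U" using y by (simp add: U_def norm_eq_sqrt_inner)
      moreover show "f (g y) = y" unfolding f_def xg by (simp add: g_def L(4))
      ultimately have "g y \<in> U" by simp
    }
    then show "g ` ball 0 1 \<subseteq> U" by blast
  qed
  moreover have "openin (top_of_set (sphere 0 1)) U"
    unfolding U_def by (intro openin_open_Int open_halfspace_gt)
  moreover have "x \<in> U" using x nx by (simp add: U_def)
  ultimately show "\<exists>U O' f g. x \<in> U \<and> openin (top_of_set (sphere 0 1)) U \<and> open O' \<and> ediff U (O'::'e set) f g"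
    using open_ball by blast
qed

section \<open>The charts of an embedded submanifold\<close>

lemma euclidean_submfd_simps [simp]:
  "mtop (euclidean_submfd S) = top_of_set S"
  "(U, \<phi>) \<in> matlas (euclidean_submfd S) \<longleftrightarrow> openin (top_of_set S) U \<and> inj_on \<phi> U \<and> open (\<phi> ` U) \<and>
          smooth_on_subset U \<phi> \<and> smooth_on (\<phi> ` U) (inv_into U \<phi>)"
  by (simp_all add: euclidean_submfd_def)

lemma euclidean_submfd_atlas_iff:
  "(U, \<phi>) \<in> matlas (euclidean_submfd S) \<longleftrightarrow>
    openin (top_of_set S) U \<and> open (\<phi> ` U) \<and> ediff U (\<phi> ` U) \<phi> (inv_into U \<phi>)"
proof -
  have "inj_on \<phi> U" if "\<forall>x\<in>U. inv_into U \<phi> (\<phi> x) = x" using that by (metis inj_on_inverseI)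
  then show ?thesis
    by (auto simp: ediff_def smooth_on_subset_open_iff inv_into_into f_inv_into_f)
qed

text \<open>The atlas fixes the inverse of a chart as \<open>inv_into\<close>, which agrees with the
  named inverse \<open>g\<close> on the open image.\<close>

lemma ediff_imp_atlas:
  assumes "ediff U O' f g" "openin (top_of_set S) U" "open O'"
  shows "(U, f) \<in> matlas (euclidean_submfd S)"
proof -
  have gf: "\<And>x. x \<in> U \<Longrightarrow> g (f x) = x" and fg: "\<And>y. y \<in> O' \<Longrightarrow> f (g y) = y \<and> g y \<in> U"
    and "f ` U \<subseteq> O'"
    using assms(1) by (auto simp: ediff_def)
  have "f ` U = O'" using \<open>f ` U \<subseteq> O'\<close> fg by (metis image_eqI subsetI subset_antisym)
  have "inj_on f U" using gf by (rule inj_on_inverseI)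
  then have "inv_into U f y = g y" if "y \<in> O'" for y using fg[OF that] by (simp add: inv_into_f_eq)
  note * = \<open>f ` U = O'\<close> \<open>inj_on f U\<close> this
  show ?thesis
    using assms * smooth_on_cong[of O' "inv_into U f" g]
    by (auto simp: ediff_def smooth_on_subset_open_iff)
qed

lemma top_of_set_subtopology:
  "U \<subseteq> S \<Longrightarrow> subtopology (top_of_set S) U = top_of_set U"
  by (simp add: subtopology_subtopology Int_absorb1)

lemma ediff_homeomorphic_map: "ediff A B f g \<Longrightarrow> homeomorphic_map (top_of_set A) (top_of_set B) f"
  unfolding homeomorphic_map_maps homeomorphic_maps_def ediff_def
  by (intro exI[of _ g]) (auto intro: smooth_on_subset_imp_continuous_on)

lemma smooth_coord_rep_euclidean:
  assumes "c \<in> matlas (euclidean_submfd S)" "d \<in> matlas (euclidean_submfd T)"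
    "smooth_on_subset S f" "f ` S \<subseteq> T"
  shows "smooth_on (coord_dom f c d) (coord_rep f c d)"
proof -
  obtain U \<phi> V \<psi> where cd: "c = (U, \<phi>)" "d = (V, \<psi>)" by (cases c, cases d) auto
  let ?g = "inv_into U \<phi>"
  have U: "openin (top_of_set S) U" "open (\<phi> ` U)" "ediff U (\<phi> ` U) \<phi> ?g"
    using assms(1) by (auto simp: cd euclidean_submfd_atlas_iff simp del: euclidean_submfd_simps)
  have V: "openin (top_of_set T) V" "smooth_on_subset V \<psi>"
    using assms(2) by (auto simp: cd)
  have US: "U \<subseteq> S" using U(1) openin_imp_subset by blast
  have dom: "coord_dom f c d = \<phi> ` U \<inter> ?g -` (U \<inter> f -` V)"
    using U(3) by (auto simp: coord_dom_def cd ediff_def)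
  have "openin (top_of_set S) (S \<inter> f -` V)"
    by (rule continuous_openin_preimage[OF smooth_on_subset_imp_continuous_on[OF assms(3)] _ V(1)])
      (use assms(4) in auto)
  then have "openin (top_of_set S) (U \<inter> (S \<inter> f -` V))" using U(1) by blast
  then have "openin (top_of_set S) (U \<inter> f -` V)" using US by (simp add: Int_assoc[symmetric] Int_absorb2)
  then have "openin (top_of_set U) (U \<inter> f -` V)" using US by (meson Int_lower1 openin_subset_trans)
  from ediff_relative_open[OF ediff_sym[OF U(3)] this] U(2)
  have op: "open (coord_dom f c d)" unfolding dom using openin_open_eq by blast
  have "smooth_on_subset (coord_dom f c d) ?g"
    using U(3) by (auto simp: dom ediff_def intro: smooth_on_subset_mono)
  then have "smooth_on_subset (coord_dom f c d) (\<lambda>x. f (?g x))"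
    by (rule smooth_on_subset_compose[OF _ assms(3)]) (use US in \<open>auto simp: dom\<close>)
  then have "smooth_on_subset (coord_dom f c d) (\<lambda>x. \<psi> (f (?g x)))"
    by (rule smooth_on_subset_compose[OF _ V(2)]) (auto simp: dom)
  then show ?thesis using op by (simp add: smooth_on_subset_open_iff coord_rep_def comp_def cd)
qed

lemma smooth_manifold_euclidean_submfd:
  assumes "submfd TYPE('e::euclidean_space) S"
  shows "smooth_manifold (euclidean_submfd S :: ('a::euclidean_space, 'e) mfd)"
  unfolding smooth_manifold_def
proof (intro conjI)
  let ?M = "euclidean_submfd S :: ('a, 'e) mfd"
  show "Hausdorff_space (mtop ?M)"
    by (simp add: Hausdorff_space_subtopology)
  obtain B :: "'a set set" where B: "countable B" "topological_basis B"
    using ex_countable_basis by blast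
  show "\<exists>\<B>. countable \<B> \<and> (\<forall>V\<in>\<B>. openin (mtop ?M) V) \<and>
        (\<forall>U x. openin (mtop ?M) U \<and> x \<in> U \<longrightarrow> (\<exists>V\<in>\<B>. x \<in> V \<and> V \<subseteq> U))"
  proof (intro exI[of _ "(\<lambda>b. S \<inter> b) ` B"] conjI ballI allI impI)
    show "countable ((\<inter>) S ` B)" using B by simp
    show "openin (mtop ?M) V" if "V \<in> (\<inter>) S ` B" for V
      using that topological_basis_open[OF B(2)] by (auto simp: openin_open)
    fix U x assume U: "openin (mtop ?M) U \<and> x \<in> U"
    then obtain W where W: "open W" "U = S \<inter> W" by (auto simp: openin_open)
    then obtain b where "b \<in> B" "x \<in> b" "b \<subseteq> W"
      using topological_basisE[OF B(2) W(1), of x] U by blast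
    then show "\<exists>V\<in>(\<inter>) S ` B. x \<in> V \<and> V \<subseteq> U" using U W by (intro bexI[of _ "S \<inter> b"]) auto
  qed
  show "\<forall>(U, \<phi>)\<in>matlas ?M. openin (mtop ?M) U \<and> open (\<phi> ` U) \<and>
        homeomorphic_map (subtopology (mtop ?M) U) (top_of_set (\<phi> ` U)) \<phi>"
  proof (safe del: euclidean_submfd_simps)
    fix U \<phi> assume "(U, \<phi>) \<in> matlas ?M"
    then have U: "openin (top_of_set S) U" "open (\<phi> ` U)" "ediff U (\<phi> ` U) \<phi> (inv_into U \<phi>)"
      by (auto simp: euclidean_submfd_atlas_iff simp del: euclidean_submfd_simps)
    then show "openin (mtop ?M) U" "open (\<phi> ` U)"
      "homeomorphic_map (subtopology (mtop ?M) U) (top_of_set (\<phi> ` U)) \<phi>"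
      using ediff_homeomorphic_map[OF U(3)]
      by (simp_all add: top_of_set_subtopology openin_imp_subset)
  qed
  show "(\<Union>(U, \<phi>)\<in>matlas ?M. U) = topspace (mtop ?M)"
  proof
    show "(\<Union>(U, \<phi>)\<in>matlas ?M. U) \<subseteq> topspace (mtop ?M)"
      by (auto dest!: openin_imp_subset)
    show "topspace (mtop ?M) \<subseteq> (\<Union>(U, \<phi>)\<in>matlas ?M. U)"
    proof
      fix x assume "x \<in> topspace (mtop ?M)"
      then have "x \<in> S" by simp
      then obtain U O' f g where "x \<in> U" "openin (top_of_set S) U" "open (O' :: 'e set)" "ediff U O' f g"
        using bspec[OF assms[unfolded submfd_def] \<open>x \<in> S\<close>] by (elim exE conjE) (rule that)
      then have "(U, f) \<in> matlas ?M" "x \<in> U" by (simp_all add: ediff_imp_atlas del: euclidean_submfd_simps)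
      then show "x \<in> (\<Union>(U, \<phi>)\<in>matlas ?M. U)" by blast
    qed
  qed
  show "\<forall>c\<in>matlas ?M. \<forall>d\<in>matlas ?M. smooth_on (coord_dom id c d) (coord_rep id c d)"
    using smooth_coord_rep_euclidean[where f = id and S = S and T = S]
    by (auto simp: smooth_on_subset_ident id_def simp del: euclidean_submfd_simps)
qed

lemma smooth_map_euclidean_submfd:
  assumes "submfd TYPE('e::euclidean_space) S" "submfd TYPE('f::euclidean_space) T"
    "smooth_on_subset S f" "f ` S \<subseteq> T"
  shows "smooth_map (euclidean_submfd S :: ('a::euclidean_space, 'e) mfd)
    (euclidean_submfd T :: ('b::euclidean_space, 'f) mfd) f"
  unfolding smooth_map_def
  using assms smooth_coord_rep_euclidean[OF _ _ assms(3,4)] smooth_on_subset_imp_continuous_on[OF assms(3)]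
  by (auto simp: smooth_manifold_euclidean_submfd simp del: euclidean_submfd_simps(2))

lemma ediff_imp_diffeomorphism:
  assumes "submfd TYPE('e::euclidean_space) S" "submfd TYPE('e) T" "ediff S T f g"
  shows "diffeomorphism (euclidean_submfd S :: ('a::euclidean_space, 'e) mfd)
    (euclidean_submfd T :: ('b::euclidean_space, 'e) mfd) f"
  unfolding diffeomorphism_def
  using assms smooth_map_euclidean_submfd[OF assms(1,2)] smooth_map_euclidean_submfd[OF assms(2,1)]
  by (intro conjI exI[of _ g]) (auto simp: ediff_def)

text \<open>The two atlases are equal, not merely compatible: since the atlas of
  \<open>euclidean_submfd\<close> is maximal, charts of \<open>W\<close> already are charts of
  \<open>S\<close>, and charts of \<open>S\<close> restrict to charts of \<open>W\<close>.\<close>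

lemma open_submfd_euclidean:
  assumes "openin (top_of_set S) W"
  shows "open_submfd (euclidean_submfd S :: ('a::euclidean_space, 'e::euclidean_space) mfd) W = euclidean_submfd W"
proof -
  have WS: "W \<subseteq> S" using assms openin_imp_subset by blast
  have "(\<lambda>(U, \<phi>). (U \<inter> W, \<phi>)) ` matlas (euclidean_submfd S :: ('a, 'e) mfd) = matlas (euclidean_submfd W)"
  proof (intro equalityI subsetI)
    fix c assume "c \<in> (\<lambda>(U, \<phi>). (U \<inter> W, \<phi>)) ` matlas (euclidean_submfd S :: ('a, 'e) mfd)"
    then obtain U \<phi> where c: "c = (U \<inter> W, \<phi>)" "(U, \<phi>) \<in> matlas (euclidean_submfd S :: ('a, 'e) mfd)" by auto
    then have U: "openin (top_of_set S) U" "open (\<phi> ` U)" "ediff U (\<phi> ` U) \<phi> (inv_into U \<phi>)"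
      by (auto simp: euclidean_submfd_atlas_iff simp del: euclidean_submfd_simps)
    have *: "openin (top_of_set S) (U \<inter> W)" using U(1) assms by blast
    then have "openin (top_of_set U) (U \<inter> W)"
      using U(1) by (meson Int_lower1 openin_imp_subset openin_subset_trans)
    from ediff_relative_open[OF ediff_sym[OF U(3)] this]
    have "open (\<phi> ` U \<inter> inv_into U \<phi> -` (U \<inter> W))" using U(2) openin_open_eq by blast
    moreover have "ediff (U \<inter> W) (\<phi> ` U \<inter> inv_into U \<phi> -` (U \<inter> W)) \<phi> (inv_into U \<phi>)"
      using ediff_sym[OF ediff_restrict[OF ediff_sym[OF U(3)], of "U \<inter> W"]]
      by (simp add: Int_assoc[symmetric])
    moreover have "openin (top_of_set W) (U \<inter> W)"
      using * WS by (metis Int_lower2 openin_subset_trans)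
    ultimately show "c \<in> matlas (euclidean_submfd W)"
      unfolding c(1) by (intro ediff_imp_atlas)
  next
    fix c assume c: "c \<in> matlas (euclidean_submfd W :: ('a, 'e) mfd)"
    obtain U \<phi> where U: "c = (U, \<phi>)" by (cases c)
    have "openin (top_of_set W) U" using c U by simp
    then have "openin (top_of_set S) U" "U \<inter> W = U"
      using assms openin_trans openin_imp_subset by blast+
    then have "(U, \<phi>) \<in> matlas (euclidean_submfd S :: ('a, 'e) mfd)" "c = (U \<inter> W, \<phi>)" using c U by simp_all
    then show "c \<in> (\<lambda>(U, \<phi>). (U \<inter> W, \<phi>)) ` matlas (euclidean_submfd S :: ('a, 'e) mfd)"
      by (metis (mono_tags, lifting) case_prod_conv image_eqI)
  qed
  then show ?thesis
    unfolding open_submfd_def using WS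
    by (simp add: euclidean_submfd_def top_of_set_subtopology)
qed


section \<open>Smooth maps between manifolds\<close>

lemma smooth_manifold_chart:
  assumes "smooth_manifold M" "(U, \<phi>) \<in> matlas M"
  shows "openin (mtop M) U" "open (\<phi> ` U)" "inj_on \<phi> U" "U \<subseteq> topspace (mtop M)"
    "homeomorphic_map (subtopology (mtop M) U) (top_of_set (\<phi> ` U)) \<phi>"
    "\<And>A. openin (mtop M) A \<Longrightarrow> open (\<phi> ` (U \<inter> A))"
proof -
  show U: "openin (mtop M) U" "open (\<phi> ` U)"
    and h: "homeomorphic_map (subtopology (mtop M) U) (top_of_set (\<phi> ` U)) \<phi>"
    using assms by (auto simp: smooth_manifold_def)
  then show UM: "U \<subseteq> topspace (mtop M)" by (simp add: openin_subset)
  show "inj_on \<phi> U" using homeomorphic_imp_injective_map[OF h] UM by (simp add: Int_absorb1)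
  show "open (\<phi> ` (U \<inter> A))" if "openin (mtop M) A" for A
  proof -
    have "openin (subtopology (mtop M) U) (U \<inter> A)" using that by (metis openin_subtopology_Int2)
    then have "openin (top_of_set (\<phi> ` U)) (\<phi> ` (U \<inter> A))"
      using homeomorphic_imp_open_map[OF h] by (simp add: open_map_def)
    then show ?thesis using U(2) openin_open_eq by blast
  qed
qed

lemma smooth_manifold_chart_at:
  assumes "smooth_manifold M" "x \<in> topspace (mtop M)"
  obtains U \<phi> where "(U, \<phi>) \<in> matlas M" "x \<in> U"
  using assms unfolding smooth_manifold_def by blast

lemma coord_dom_open:
  assumes "smooth_manifold M" "smooth_manifold N" "continuous_map (mtop M) (mtop N) f"
    "c \<in> matlas M" "d \<in> matlas N"
  shows "open (coord_dom f c d)"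
proof -
  obtain U \<phi> V \<psi> where cd: "c = (U, \<phi>)" "d = (V, \<psi>)" by (cases c, cases d) auto
  have "openin (mtop M) {x \<in> topspace (mtop M). f x \<in> V}"
    using assms(5) by (intro openin_continuous_map_preimage[OF assms(3)] smooth_manifold_chart(1)[OF assms(2)])
      (simp add: cd)
  from smooth_manifold_chart(6)[OF assms(1) assms(4)[unfolded cd] this]
  have "open (\<phi> ` (U \<inter> {x \<in> topspace (mtop M). f x \<in> V}))" .
  moreover have "U \<inter> {x \<in> topspace (mtop M). f x \<in> V} = U \<inter> f -` V"
    using smooth_manifold_chart(4)[OF assms(1) assms(4)[unfolded cd]] by auto
  ultimately show ?thesis by (simp add: coord_dom_def cd)
qed

lemma smooth_map_compose:
  assumes "smooth_map M N f" "smooth_map N P g"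
  shows "smooth_map M P (g \<circ> f)"
  unfolding smooth_map_def
proof (intro conjI ballI)
  show M: "smooth_manifold M" and P: "smooth_manifold P"
    and cont: "continuous_map (mtop M) (mtop P) (g \<circ> f)"
    using assms continuous_map_compose by (auto simp: smooth_map_def)
  have N: "smooth_manifold N" and f: "continuous_map (mtop M) (mtop N) f"
    and g: "continuous_map (mtop N) (mtop P) g"
    using assms by (auto simp: smooth_map_def)
  fix c d assume c: "c \<in> matlas M" and d: "d \<in> matlas P"
  obtain U \<phi> V \<psi> where cd: "c = (U, \<phi>)" "d = (V, \<psi>)" by (cases c, cases d) auto
  note C = smooth_manifold_chart[OF M c[unfolded cd]]
  show "smooth_on (coord_dom (g \<circ> f) c d) (coord_rep (g \<circ> f) c d)"
  proof (rule smooth_on_local)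
    fix x assume "x \<in> coord_dom (g \<circ> f) c d"
    then obtain u where u: "x = \<phi> u" "u \<in> U" "g (f u) \<in> V" by (auto simp: coord_dom_def cd)
    have "f u \<in> topspace (mtop N)"
      using f u(2) C(4) unfolding continuous_map_def by blast
    then obtain W \<xi> where e: "(W, \<xi>) \<in> matlas N" "f u \<in> W"
      by (rule smooth_manifold_chart_at[OF N])
    note E = smooth_manifold_chart[OF N e(1)]
    \<comment> \<open>The part of the domain that \<open>f\<close> sends into the intermediate chart
      chosen for this point; on it the coordinate representatives compose.\<close>
    let ?D = "coord_dom (g \<circ> f) c d \<inter> coord_dom f c (W, \<xi>)"
    have inv: "inv_into U \<phi> (\<phi> v) = v" if "v \<in> U" for v using C(3) that by simp
    have "open ?D"
      by (intro open_Int coord_dom_open[OF M P cont c d] coord_dom_open[OF M N f c e(1)])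
    moreover have "x \<in> ?D" using u e by (auto simp: coord_dom_def cd)
    moreover have sm: "smooth_on ?D (\<lambda>x. coord_rep g (W, \<xi>) d (coord_rep f c (W, \<xi>) x))"
    proof (rule smooth_on_compose[OF \<open>open ?D\<close>, of "coord_rep f c (W, \<xi>)" "coord_dom g (W, \<xi>) d"
          "coord_rep g (W, \<xi>) d"])
      show "smooth_on ?D (coord_rep f c (W, \<xi>))"
        using assms(1) c e(1) by (auto simp: smooth_map_def intro: smooth_on_subset)
      show "open (coord_dom g (W, \<xi>) d)" by (rule coord_dom_open[OF N P g e(1) d])
      show "smooth_on (coord_dom g (W, \<xi>) d) (coord_rep g (W, \<xi>) d)"
        using assms(2) d e(1) by (auto simp: smooth_map_def)
      show "coord_rep f c (W, \<xi>) ` ?D \<subseteq> coord_dom g (W, \<xi>) d"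
      proof
        fix y assume "y \<in> coord_rep f c (W, \<xi>) ` ?D"
        then obtain z where z: "z \<in> ?D" "y = coord_rep f c (W, \<xi>) z" by blast
        have "z \<in> \<phi> ` (U \<inter> (g \<circ> f) -` V)" using z by (simp add: coord_dom_def cd)
        then obtain v where v: "z = \<phi> v" "v \<in> U" "g (f v) \<in> V" by auto
        obtain v' where v': "z = \<phi> v'" "v' \<in> U" "f v' \<in> W" using z by (auto simp: coord_dom_def cd)
        have "v = v'" using v v' C(3) by (metis inj_onD)
        then show "y \<in> coord_dom g (W, \<xi>) d"
          using v v' z(2) inv by (auto simp: coord_dom_def coord_rep_def cd)
      qed
    qed
    moreover have eq: "coord_rep (g \<circ> f) c d y = coord_rep g (W, \<xi>) d (coord_rep f c (W, \<xi>) y)" if "y \<in> ?D" for y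
    proof -
      have "y \<in> \<phi> ` (U \<inter> f -` W)" using that by (simp add: coord_dom_def cd)
      then obtain v where v: "y = \<phi> v" "v \<in> U" "f v \<in> W" by auto
      then show ?thesis using inv E(3) by (simp add: coord_rep_def cd)
    qed
    ultimately show "\<exists>X. open X \<and> x \<in> X \<and> smooth_on X (coord_rep (g \<circ> f) c d)"
      using smooth_on_cong[OF \<open>open ?D\<close> eq] sm by (intro exI[of _ ?D]) auto
  qed
qed

lemma diffeomorphism_compose:
  assumes "diffeomorphism M N f" "diffeomorphism N P g"
  shows "diffeomorphism M P (g \<circ> f)"
proof -
  obtain f' where f': "smooth_map N M f'" "\<And>x. x \<in> topspace (mtop M) \<Longrightarrow> f' (f x) = x"
      "\<And>y. y \<in> topspace (mtop N) \<Longrightarrow> f (f' y) = y"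
    using assms(1) unfolding diffeomorphism_def by blast
  obtain g' where g': "smooth_map P N g'" "\<And>x. x \<in> topspace (mtop N) \<Longrightarrow> g' (g x) = x"
      "\<And>y. y \<in> topspace (mtop P) \<Longrightarrow> g (g' y) = y"
    using assms(2) unfolding diffeomorphism_def by blast
  have "f x \<in> topspace (mtop N)" if "x \<in> topspace (mtop M)" for x
    using assms(1) that by (auto simp: diffeomorphism_def smooth_map_def continuous_map_def)
  moreover have "g' y \<in> topspace (mtop N)" if "y \<in> topspace (mtop P)" for y
    using g'(1) that by (auto simp: smooth_map_def continuous_map_def)
  ultimately show ?thesis
    using assms smooth_map_compose[of M N f P g] smooth_map_compose[OF g'(1) f'(1)] f' g'
    unfolding diffeomorphism_def by (intro conjI exI[of _ "f' \<circ> g'"]) auto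
qed

text \<open>If \<open>s\<close> is a smooth section through \<open>x\<close>, the chain rule applied
  to f (s y) = y says that the derivative of \<open>f\<close> after that of \<open>s\<close> is the
  identity, so the derivative of \<open>f\<close> is onto.\<close>

lemma submersion_via_sections:
  assumes S: "submfd TYPE('e::euclidean_space) S" and T: "submfd TYPE('f::euclidean_space) T"
    and f: "smooth_on_subset S f" "f ` S \<subseteq> T"
    and sec: "\<And>x. x \<in> S \<Longrightarrow> \<exists>W s. openin (top_of_set T) W \<and> f x \<in> W \<and> smooth_on_subset W s \<and>
       s ` W \<subseteq> S \<and> s (f x) = x \<and> (\<forall>y\<in>W. f (s y) = y)"
  shows "submersion (euclidean_submfd S :: ('a::euclidean_space, 'e) mfd)
    (euclidean_submfd T :: ('b::euclidean_space, 'f) mfd) f"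
  unfolding submersion_def
proof (intro conjI ballI)
  let ?M = "euclidean_submfd S :: ('a, 'e) mfd" and ?N = "euclidean_submfd T :: ('b, 'f) mfd"
  show sm: "smooth_map ?M ?N f" by (rule smooth_map_euclidean_submfd[OF S T f])
  fix c d x assume c: "c \<in> matlas ?M" and d: "d \<in> matlas ?N" and x: "x \<in> coord_dom f c d"
  obtain U \<phi> V \<psi> where cd: "c = (U, \<phi>)" "d = (V, \<psi>)" by (cases c, cases d) auto
  obtain u where u: "x = \<phi> u" "u \<in> U" "f u \<in> V" using x by (auto simp: coord_dom_def cd)
  have M: "smooth_manifold ?M" and N: "smooth_manifold ?N" and cf: "continuous_map (mtop ?M) (mtop ?N) f"
    using sm by (auto simp: smooth_map_def)
  note C = smooth_manifold_chart[OF M c[unfolded cd]] and D = smooth_manifold_chart[OF N d[unfolded cd]]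
  have "u \<in> S" using u C(4) by auto
  then obtain W s where W: "openin (top_of_set T) W" "f u \<in> W" "smooth_on_subset W s" "s ` W \<subseteq> S"
      "s (f u) = u" "\<forall>y\<in>W. f (s y) = y"
    using sec by meson
  \<comment> \<open>\<open>s\<close> is smooth on the open piece \<open>W\<close> of
    \<open>T\<close> only, so the chart \<open>d\<close> is cut down to \<open>W\<close> before
    \<open>s\<close> is read in coordinates.\<close>
  let ?P = "euclidean_submfd W :: ('b, 'f) mfd" and ?d = "(V \<inter> W, \<psi>)"
  have sms: "smooth_map ?P ?M s"
    by (rule smooth_map_euclidean_submfd[OF submfd_open[OF T W(1)] S W(3,4)])
  have d': "?d \<in> matlas ?P"
    using d unfolding open_submfd_euclidean[OF W(1), symmetric] cd
    by (auto simp: open_submfd_def simp del: euclidean_submfd_simps intro!: image_eqI)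
  let ?F = "coord_rep f c d" and ?G = "coord_rep s ?d c" and ?E = "coord_dom s ?d c"
  have invU: "inv_into U \<phi> (\<phi> v) = v" if "v \<in> U" for v using C(3) that by simp
  have invV: "inv_into (V \<inter> W) \<psi> (\<psi> v) = v" if "v \<in> V" "v \<in> W" for v
    using D(3) that by (meson Int_iff inf_le1 inj_on_subset inv_into_f_f)
  have invV': "inv_into V \<psi> (\<psi> v) = v" if "v \<in> V" for v using D(3) that by simp
  let ?y = "\<psi> (f u)"
  have yE: "?y \<in> ?E" using u W by (auto simp: coord_dom_def cd)
  have Gy: "?G ?y = x" using u W by (simp add: coord_rep_def cd invV)
  have oE: "open ?E"
    using sms d' c by (intro coord_dom_open) (auto simp: smooth_map_def)
  have FG: "?F (?G y) = y" if "y \<in> ?E" for y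
    using that W(6) by (auto simp: coord_dom_def coord_rep_def cd invV invU)
  have "smooth_on ?E ?G" using sms d' c by (auto simp: smooth_map_def)
  then have dG: "(?G has_derivative frechet_derivative ?G (at ?y)) (at ?y)"
    using yE by (metis frechet_derivative_works smooth_on_imp_differentiable)
  have "smooth_on (coord_dom f c d) ?F" using sm c d by (auto simp: smooth_map_def)
  then have dF: "(?F has_derivative frechet_derivative ?F (at x)) (at (?G ?y))"
    using x Gy by (metis frechet_derivative_works smooth_on_imp_differentiable)
  have "((\<lambda>y. ?F (?G y)) has_derivative (\<lambda>v. frechet_derivative ?F (at x) (frechet_derivative ?G (at ?y) v))) (at ?y)"
    using has_derivative_compose[OF dG dF] .
  then have "((\<lambda>y. y) has_derivative (\<lambda>v. frechet_derivative ?F (at x) (frechet_derivative ?G (at ?y) v))) (at ?y)"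
    by (rule has_derivative_transform_within_open[OF _ oE yE]) (rule FG)
  then have "(\<lambda>v. frechet_derivative ?F (at x) (frechet_derivative ?G (at ?y) v)) = (\<lambda>v. v)"
    using has_derivative_unique has_derivative_ident by blast
  then show "surj (frechet_derivative ?F (at x))" by (metis surjI)
qed


section \<open>Transport of structure\<close>

text \<open>A pullback along a bijection. It places a structure on a prescribed type, here on sets
  of orbits and on a subset of \<open>(real ^ 3) \<times> (real ^ 5)\<close>.\<close>

definition transport :: "'b set \<Rightarrow> ('b \<Rightarrow> 'a) \<Rightarrow> ('a, 'e) mfd \<Rightarrow> ('b, 'e) mfd" where
  "transport Y \<gamma> M = \<lparr> mtop = pullback_topology Y \<gamma> (mtop M),
     matlas = (\<lambda>(U, \<phi>). (Y \<inter> \<gamma> -` U, \<phi> \<circ> \<gamma>)) ` matlas M \<rparr>"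

lemma transport_open_submfd:
  fixes \<gamma> :: "'a \<Rightarrow> 'b"
  shows "open_submfd (transport Y \<gamma> M) (Y \<inter> \<gamma> -` W) = transport (Y \<inter> \<gamma> -` W) \<gamma> (open_submfd M W)"
proof -
  have "subtopology (pullback_topology Y \<gamma> X) (Y \<inter> \<gamma> -` W) =
      pullback_topology (Y \<inter> \<gamma> -` W) \<gamma> (subtopology X W)" for X
  proof (rule topology_eq[THEN iffD2], intro allI)
    fix S
    have "\<gamma> -` U \<inter> Y \<inter> (Y \<inter> \<gamma> -` W) = \<gamma> -` (U \<inter> W) \<inter> (Y \<inter> \<gamma> -` W)" for U by auto
    then show "openin (subtopology (pullback_topology Y \<gamma> X) (Y \<inter> \<gamma> -` W)) S \<longleftrightarrow>
        openin (pullback_topology (Y \<inter> \<gamma> -` W) \<gamma> (subtopology X W)) S"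
      unfolding openin_subtopology openin_pullback_topology by metis
  qed
  moreover have "(\<lambda>(U, \<phi>). (U \<inter> (Y \<inter> \<gamma> -` W), \<phi>)) ` (\<lambda>(U, \<phi>). (Y \<inter> \<gamma> -` U, \<phi> \<circ> \<gamma>)) ` A =
      (\<lambda>(U, \<phi>). (Y \<inter> \<gamma> -` W \<inter> \<gamma> -` U, \<phi> \<circ> \<gamma>)) ` (\<lambda>(U, \<phi>). (U \<inter> W, \<phi>)) ` A"
    for A :: "('b set \<times> ('b \<Rightarrow> 'c)) set"
    unfolding image_image by (intro image_cong) auto
  ultimately show ?thesis by (simp add: open_submfd_def transport_def)
qed

context
  fixes Y :: "'b set" and \<gamma> :: "'b \<Rightarrow> 'a" and M :: "('a, 'e::euclidean_space) mfd"
  assumes bij: "bij_betw \<gamma> Y (topspace (mtop M))" and M: "smooth_manifold M"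
begin

private abbreviation "\<delta> \<equiv> inv_into Y \<gamma>"
private abbreviation "N \<equiv> transport Y \<gamma> M"

lemma topspace_transport: "topspace (mtop (transport Y \<gamma> M)) = Y"
  using bij by (auto simp: transport_def topspace_pullback_topology bij_betw_def)

private lemma gd: "x \<in> topspace (mtop M) \<Longrightarrow> \<gamma> (\<delta> x) = x \<and> \<delta> x \<in> Y"
  using bij by (metis bij_betw_def f_inv_into_f inv_into_into)

private lemma dg: "y \<in> Y \<Longrightarrow> \<delta> (\<gamma> y) = y \<and> \<gamma> y \<in> topspace (mtop M)"
  using bij by (metis bij_betw_def bij_betw_inv_into_left image_eqI)

private lemma homeo: "homeomorphic_maps (mtop (transport Y \<gamma> M)) (mtop M) \<gamma> \<delta>"
  unfolding homeomorphic_maps_def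
proof (intro conjI ballI)
  show "continuous_map (mtop N) (mtop M) \<gamma>"
    using continuous_map_pullback[of "mtop M" "mtop M" id Y \<gamma>] by (simp add: transport_def)
  show "continuous_map (mtop M) (mtop N) \<delta>"
    unfolding continuous_map_def
  proof (intro conjI allI impI)
    show "\<delta> \<in> topspace (mtop M) \<rightarrow> topspace (mtop N)" using gd by (auto simp: topspace_transport)
    fix U assume "openin (mtop N) U"
    then obtain V where V: "openin (mtop M) V" "U = \<gamma> -` V \<inter> Y"
      by (auto simp: transport_def openin_pullback_topology)
    then have "{x \<in> topspace (mtop M). \<delta> x \<in> U} = V" using gd openin_subset[OF V(1)] by auto
    then show "openin (mtop M) {x \<in> topspace (mtop M). \<delta> x \<in> U}" using V by simp
  qed
qed (use gd dg in \<open>auto simp: topspace_transport\<close>)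

private lemma chart_dom:
  assumes "A \<subseteq> topspace (mtop M)"
  shows "(\<phi> \<circ> \<gamma>) ` (Y \<inter> \<gamma> -` (U \<inter> A)) = \<phi> ` (U \<inter> A)"
proof -
  have "\<gamma> ` (Y \<inter> \<gamma> -` (U \<inter> A)) = U \<inter> A"
  proof (intro equalityI subsetI)
    fix x assume "x \<in> U \<inter> A"
    then show "x \<in> \<gamma> ` (Y \<inter> \<gamma> -` (U \<inter> A))"
      using gd[of x] assms by (intro image_eqI[of _ _ "\<delta> x"]) auto
  qed auto
  then show ?thesis by (metis image_comp)
qed

private lemma chart_inv:
  assumes "(U, \<phi>) \<in> matlas M" "u \<in> U"
  shows "inv_into (Y \<inter> \<gamma> -` U) (\<phi> \<circ> \<gamma>) (\<phi> u) = \<delta> u" "\<gamma> (\<delta> u) = u" "\<delta> u \<in> Y"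
proof -
  note C = smooth_manifold_chart[OF M assms(1)]
  show *: "\<gamma> (\<delta> u) = u" "\<delta> u \<in> Y" using gd C(4) assms(2) by auto
  have "inj_on (\<phi> \<circ> \<gamma>) (Y \<inter> \<gamma> -` U)"
  proof (rule inj_onI)
    fix x y assume "x \<in> Y \<inter> \<gamma> -` U" "y \<in> Y \<inter> \<gamma> -` U" "(\<phi> \<circ> \<gamma>) x = (\<phi> \<circ> \<gamma>) y"
    then have "\<gamma> x = \<gamma> y" "x \<in> Y" "y \<in> Y" using C(3) by (auto dest: inj_onD)
    then show "x = y" using dg by metis
  qed
  then show "inv_into (Y \<inter> \<gamma> -` U) (\<phi> \<circ> \<gamma>) (\<phi> u) = \<delta> u"
    by (rule inv_into_f_eq) (use * assms(2) in auto)
qed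

text \<open>Since the new charts are the old ones precomposed with \<open>\<gamma>\<close>, every
  coordinate representative of \<open>id\<close>, of \<open>\<gamma>\<close> or of its inverse
  coincides with one of the identity of \<open>M\<close>.\<close>

lemma smooth_manifold_transport: "smooth_manifold (transport Y \<gamma> M)"
  and diffeomorphism_transport: "diffeomorphism (transport Y \<gamma> M) M \<gamma>"
proof -
  have hm: "homeomorphic_map (mtop N) (mtop M) \<gamma>"
    using homeo homeomorphic_map_maps by blast
  have atlasE: "\<exists>c'\<in>matlas M. c = (Y \<inter> \<gamma> -` fst c', snd c' \<circ> \<gamma>)" if "c \<in> matlas N" for c
    using that by (auto simp: transport_def intro!: bexI)
  have eq: "coord_dom id (Y \<inter> \<gamma> -` fst c, snd c \<circ> \<gamma>) (Y \<inter> \<gamma> -` fst d, snd d \<circ> \<gamma>) = coord_dom id c d"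
      "coord_dom \<gamma> (Y \<inter> \<gamma> -` fst c, snd c \<circ> \<gamma>) d = coord_dom id c d"
      "coord_dom \<delta> c (Y \<inter> \<gamma> -` fst d, snd d \<circ> \<gamma>) = coord_dom id c d"
      "\<And>x. x \<in> coord_dom id c d \<Longrightarrow>
        coord_rep id (Y \<inter> \<gamma> -` fst c, snd c \<circ> \<gamma>) (Y \<inter> \<gamma> -` fst d, snd d \<circ> \<gamma>) x = coord_rep id c d x"
      "\<And>x. x \<in> coord_dom id c d \<Longrightarrow> coord_rep \<gamma> (Y \<inter> \<gamma> -` fst c, snd c \<circ> \<gamma>) d x = coord_rep id c d x"
      "\<And>x. x \<in> coord_dom id c d \<Longrightarrow> coord_rep \<delta> c (Y \<inter> \<gamma> -` fst d, snd d \<circ> \<gamma>) x = coord_rep id c d x"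
    if c: "c \<in> matlas M" and d: "d \<in> matlas M" for c d
  proof -
    obtain U \<phi> V \<psi> where cd: "c = (U, \<phi>)" "d = (V, \<psi>)" by (cases c, cases d) auto
    have VM: "V \<subseteq> topspace (mtop M)" and UM: "U \<subseteq> topspace (mtop M)"
      and inj: "inj_on \<phi> U"
      using smooth_manifold_chart(3,4)[OF M] c d cd by auto
    have 1: "(\<phi> \<circ> \<gamma>) ` (Y \<inter> \<gamma> -` (U \<inter> V)) = \<phi> ` (U \<inter> V)" by (rule chart_dom[OF VM])
    have 2: "Y \<inter> \<gamma> -` U \<inter> id -` (Y \<inter> \<gamma> -` V) = Y \<inter> \<gamma> -` (U \<inter> V)"
      "Y \<inter> \<gamma> -` U \<inter> \<gamma> -` V = Y \<inter> \<gamma> -` (U \<inter> V)" by auto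
    have 3: "U \<inter> \<delta> -` (Y \<inter> \<gamma> -` V) = U \<inter> V" using gd UM by auto
    show "coord_dom id (Y \<inter> \<gamma> -` fst c, snd c \<circ> \<gamma>) (Y \<inter> \<gamma> -` fst d, snd d \<circ> \<gamma>) = coord_dom id c d"
      "coord_dom \<gamma> (Y \<inter> \<gamma> -` fst c, snd c \<circ> \<gamma>) d = coord_dom id c d"
      "coord_dom \<delta> c (Y \<inter> \<gamma> -` fst d, snd d \<circ> \<gamma>) = coord_dom id c d"
      unfolding coord_dom_def cd fst_conv snd_conv 2 3 1 by simp_all
    fix x assume "x \<in> coord_dom id c d"
    then obtain u where u: "x = \<phi> u" "u \<in> U" "u \<in> V" by (auto simp: coord_dom_def cd)
    note i = chart_inv[OF c[unfolded cd] u(2)]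
    show "coord_rep id (Y \<inter> \<gamma> -` fst c, snd c \<circ> \<gamma>) (Y \<inter> \<gamma> -` fst d, snd d \<circ> \<gamma>) x = coord_rep id c d x"
      "coord_rep \<gamma> (Y \<inter> \<gamma> -` fst c, snd c \<circ> \<gamma>) d x = coord_rep id c d x"
      "coord_rep \<delta> c (Y \<inter> \<gamma> -` fst d, snd d \<circ> \<gamma>) x = coord_rep id c d x"
      using u inj by (simp_all add: coord_rep_def cd i)
  qed
  have sm: "smooth_on (coord_dom id c d) (coord_rep id c d)" "open (coord_dom id c d)"
    if "c \<in> matlas M" "d \<in> matlas M" for c d
    using M that coord_dom_open[OF M M continuous_map_id, of c d] by (auto simp: smooth_manifold_def)
  have smI: "smooth_on D h" if "D = coord_dom id c d" "\<And>x. x \<in> coord_dom id c d \<Longrightarrow> h x = coord_rep id c d x"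
    "c \<in> matlas M" "d \<in> matlas M" for D h c d
    unfolding that(1) using smooth_on_cong[OF sm(2)[OF that(3,4)] that(2)] sm(1)[OF that(3,4)] by simp
  show N: "smooth_manifold N"
    unfolding smooth_manifold_def
  proof (intro conjI)
    show "Hausdorff_space (mtop N)"
      using M hm homeomorphic_Hausdorff_space homeomorphic_map_imp_homeomorphic_space
      by (metis smooth_manifold_def)
    obtain B where B: "countable B" "\<forall>V\<in>B. openin (mtop M) V"
        "\<forall>U x. openin (mtop M) U \<and> x \<in> U \<longrightarrow> (\<exists>V\<in>B. x \<in> V \<and> V \<subseteq> U)"
      using M by (auto simp: smooth_manifold_def)
    let ?B = "(\<lambda>V. \<gamma> -` V \<inter> Y) ` B"
    have "\<exists>V\<in>?B. x \<in> V \<and> V \<subseteq> U" if U: "openin (mtop N) U" "x \<in> U" for U x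
    proof -
      obtain W where W: "openin (mtop M) W" "U = \<gamma> -` W \<inter> Y"
        using U by (auto simp: transport_def openin_pullback_topology)
      then obtain V where "V \<in> B" "\<gamma> x \<in> V" "V \<subseteq> W" using B(3) U(2) by blast
      then show ?thesis using W U by (intro bexI[of _ "\<gamma> -` V \<inter> Y"]) auto
    qed
    moreover have "\<forall>V\<in>?B. openin (mtop N) V"
      using B(2) by (auto simp: transport_def openin_pullback_topology)
    moreover have "countable ?B" using B(1) by simp
    ultimately show "\<exists>\<B>. countable \<B> \<and> (\<forall>V\<in>\<B>. openin (mtop N) V) \<and>
        (\<forall>U x. openin (mtop N) U \<and> x \<in> U \<longrightarrow> (\<exists>V\<in>\<B>. x \<in> V \<and> V \<subseteq> U))"
      by (intro exI[of _ ?B]) auto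
    show "\<forall>(U, \<phi>)\<in>matlas N. openin (mtop N) U \<and> open (\<phi> ` U) \<and>
        homeomorphic_map (subtopology (mtop N) U) (top_of_set (\<phi> ` U)) \<phi>"
    proof (clarify)
      fix U' \<phi>' assume "(U', \<phi>') \<in> matlas N"
      then obtain U \<phi> where c: "(U, \<phi>) \<in> matlas M" "U' = Y \<inter> \<gamma> -` U" "\<phi>' = \<phi> \<circ> \<gamma>"
        by (auto simp: transport_def)
      note C = smooth_manifold_chart[OF M c(1)]
      have im: "\<phi>' ` U' = \<phi> ` U" using chart_dom[where U = U and A = U and \<phi> = \<phi>] C(4) c by simp
      have "\<gamma> ` (Y \<inter> \<gamma> -` U) = U" using chart_dom[where U = U and A = U and \<phi> = id] C(4) by simp
      then have "homeomorphic_map (subtopology (mtop N) U') (subtopology (mtop M) U) \<gamma>"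
        using C(4) by (intro homeomorphic_map_subtopologies[OF hm])
          (simp add: topspace_transport c Int_absorb1 Int_assoc[symmetric])
      from homeomorphic_map_compose[OF this C(5)]
      show "openin (mtop N) U' \<and> open (\<phi>' ` U') \<and>
        homeomorphic_map (subtopology (mtop N) U') (top_of_set (\<phi>' ` U')) \<phi>'"
        unfolding im using C c by (auto simp: transport_def openin_pullback_topology)
    qed
    show "(\<Union>(U, \<phi>)\<in>matlas N. U) = topspace (mtop N)"
    proof -
      have "(\<Union>(U, \<phi>)\<in>matlas N. U) = (\<Union>c\<in>matlas M. Y \<inter> \<gamma> -` fst c)"
        by (auto simp: transport_def)
      also have "\<dots> = Y \<inter> \<gamma> -` (\<Union>(U, \<phi>)\<in>matlas M. U)" by (auto simp: case_prod_unfold)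
      also have "(\<Union>(U, \<phi>)\<in>matlas M. U) = topspace (mtop M)" using M by (simp add: smooth_manifold_def)
      finally show ?thesis using dg by (auto simp: topspace_transport)
    qed
    show "\<forall>c\<in>matlas N. \<forall>d\<in>matlas N. smooth_on (coord_dom id c d) (coord_rep id c d)"
    proof (intro ballI)
      fix c d assume "c \<in> matlas N" "d \<in> matlas N"
      then obtain c' d' where "c' \<in> matlas M" "c = (Y \<inter> \<gamma> -` fst c', snd c' \<circ> \<gamma>)"
        "d' \<in> matlas M" "d = (Y \<inter> \<gamma> -` fst d', snd d' \<circ> \<gamma>)" using atlasE by meson
      then show "smooth_on (coord_dom id c d) (coord_rep id c d)"
        using smI[OF eq(1) eq(4)] by blast
    qed
  qed
  have "smooth_map N M \<gamma>"
    unfolding smooth_map_def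
  proof (intro conjI ballI N M)
    fix c d assume "c \<in> matlas N" "d \<in> matlas M"
    then obtain c' where "c' \<in> matlas M" "c = (Y \<inter> \<gamma> -` fst c', snd c' \<circ> \<gamma>)"
      "d \<in> matlas M" using atlasE by meson
    then show "smooth_on (coord_dom \<gamma> c d) (coord_rep \<gamma> c d)"
      using smI[OF eq(2) eq(5)] by blast
  qed (use homeo in \<open>auto simp: homeomorphic_maps_def\<close>)
  moreover have "smooth_map M N \<delta>"
    unfolding smooth_map_def
  proof (intro conjI ballI N M)
    fix c d assume "c \<in> matlas M" "d \<in> matlas N"
    then obtain d' where "c \<in> matlas M"
      "d' \<in> matlas M" "d = (Y \<inter> \<gamma> -` fst d', snd d' \<circ> \<gamma>)" using atlasE by meson
    then show "smooth_on (coord_dom \<delta> c d) (coord_rep \<delta> c d)"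
      using smI[OF eq(3) eq(6)] by blast
  qed (use homeo in \<open>auto simp: homeomorphic_maps_def\<close>)
  ultimately show "diffeomorphism N M \<gamma>"
    unfolding diffeomorphism_def using gd dg by (auto simp: topspace_transport)
qed

text \<open>Applied to the orbit projection \<open>h\<close> and the invariant map \<open>f\<close>:
  both have the same coordinate representatives, because \<open>\<gamma>\<close> is absorbed into
  the charts.\<close>

lemma submersion_transport:
  assumes "submersion L M f" "\<And>x. x \<in> topspace (mtop L) \<Longrightarrow> h x \<in> Y \<and> \<gamma> (h x) = f x"
  shows "submersion L (transport Y \<gamma> M) h"
proof -
  have L: "smooth_manifold L" and cf: "continuous_map (mtop L) (mtop M) f"
    using assms(1) by (auto simp: submersion_def smooth_map_def)
  have "continuous_map (mtop L) (mtop N) (\<delta> \<circ> f)"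
    using continuous_map_compose[OF cf] homeo by (auto simp: homeomorphic_maps_def)
  then have ch: "continuous_map (mtop L) (mtop N) h"
    by (rule continuous_map_eq) (use assms(2) dg in \<open>metis comp_apply\<close>)
  have *: "coord_dom h c d = coord_dom f c d' \<and> (\<forall>x\<in>coord_dom f c d'. coord_rep h c d x = coord_rep f c d' x)"
    if "c \<in> matlas L" and d': "d' \<in> matlas M" and d: "d = (Y \<inter> \<gamma> -` fst d', snd d' \<circ> \<gamma>)" for c d d'
  proof -
    obtain U \<phi> where c: "c = (U, \<phi>)" by (cases c)
    note C = smooth_manifold_chart[OF L that(1)[unfolded c]]
    have "U \<inter> h -` (Y \<inter> \<gamma> -` fst d') = U \<inter> f -` fst d'" using C(4) assms(2) by auto
    then have "coord_dom h c d = coord_dom f c d'" by (simp add: coord_dom_def c d)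
    moreover have "coord_rep h c d x = coord_rep f c d' x" if "x \<in> coord_dom f c d'" for x
      using that C(3,4) assms(2) by (auto simp: coord_dom_def coord_rep_def c d subset_iff)
    ultimately show ?thesis by blast
  qed
  have **: "smooth_on (coord_dom h c d) (coord_rep h c d) \<and>
      (\<forall>x\<in>coord_dom h c d. surj (frechet_derivative (coord_rep h c d) (at x)))"
    if c: "c \<in> matlas L" and d: "d \<in> matlas N" for c d
  proof -
    obtain d' where d': "d' \<in> matlas M" "d = (Y \<inter> \<gamma> -` fst d', snd d' \<circ> \<gamma>)"
      using d by (auto simp: transport_def case_prod_unfold)
    note e = *[OF c d']
    have o: "open (coord_dom f c d')" by (rule coord_dom_open[OF L M cf c d'(1)])
    have "smooth_on (coord_dom f c d') (coord_rep f c d')"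
      using assms(1) c d' by (auto simp: submersion_def smooth_map_def)
    then have "smooth_on (coord_dom f c d') (coord_rep h c d)"
      using smooth_on_cong[OF o, of "coord_rep h c d"] e by blast
    moreover have "surj (frechet_derivative (coord_rep h c d) (at x))" if "x \<in> coord_dom f c d'" for x
      using assms(1) c d' that frechet_derivative_cong_open[OF o that, of "coord_rep h c d"] e
      by (auto simp: submersion_def)
    ultimately show ?thesis using e by auto
  qed
  then show ?thesis unfolding submersion_def smooth_map_def using L smooth_manifold_transport ch by blast
qed

end

section \<open>The Clifford representation and its holonomy\<close>

lemma qmat_eq_iff: "(A :: quat ^ 2 ^ 2) = B \<longleftrightarrow>
    A $ 1 $ 1 = B $ 1 $ 1 \<and> A $ 1 $ 2 = B $ 1 $ 2 \<and> A $ 2 $ 1 = B $ 2 $ 1 \<and> A $ 2 $ 2 = B $ 2 $ 2"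
  by (auto simp: vec_eq_iff forall_2)

lemma qmat_mult_nth: "((A :: quat ^ 2 ^ 2) ** B) $ i $ j = A $ i $ 1 * B $ 1 $ j + A $ i $ 2 * B $ 2 $ j"
  by (simp add: matrix_matrix_mult_def sum_2)

lemma bounded_bilinear_qmat_mult: "bounded_bilinear ((**) :: quat ^ 2 ^ 2 \<Rightarrow> quat ^ 2 ^ 2 \<Rightarrow> quat ^ 2 ^ 2)"
  unfolding bilinear_conv_bounded_bilinear[symmetric] bilinear_def
  by (auto intro!: linearI simp: qmat_eq_iff qmat_mult_nth algebra_simps)

interpretation qmat: bounded_bilinear "(**) :: quat ^ 2 ^ 2 \<Rightarrow> quat ^ 2 ^ 2 \<Rightarrow> quat ^ 2 ^ 2"
  by (rule bounded_bilinear_qmat_mult)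

lemma qmat_assoc: "(A :: quat ^ 2 ^ 2) ** B ** C = A ** (B ** C)"
  by (simp add: matrix_mul_assoc)

type_synonym fib = "real \<times> complex \<times> complex"

text \<open>The quaternion u + v j.\<close>

definition qpair :: "complex \<Rightarrow> complex \<Rightarrow> quat" where
  "qpair u v = Quat (Re u) (Im u) (Re v) (Im v)"

text \<open>The self-adjoint quaternionic 2 by 2 matrices of trace zero. They square to |x|^2 and
  give a Clifford representation of R^5 on H^2.\<close>

definition cl :: "fib \<Rightarrow> quat ^ 2 ^ 2" where
  "cl x = vector [vector [Quat (fst x) 0 0 0, qpair (fst (snd x)) (snd (snd x))],
     vector [qcnj (qpair (fst (snd x)) (snd (snd x))), Quat (- fst x) 0 0 0]]"

lemmas quat_defs = quat_eq_iff plus_quat_def times_quat_def minus_quat_def uminus_quat_def zero_quat_def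
  one_quat_def scaleR_quat_def qcnj_def

lemma linear_cl: "linear cl"
  by (rule linearI) (simp_all add: cl_def qmat_eq_iff qpair_def quat_defs)

lemma cl_anticomm: "cl x ** cl y + cl y ** cl x = (2 * (x \<bullet> y)) *\<^sub>R mat 1"
  by (simp add: cl_def qmat_eq_iff qmat_mult_nth qpair_def quat_defs mat_def inner_complex_def inner_prod_def
      algebra_simps)

text \<open>Commuting with \<open>cl (1, 0, 0)\<close> = diag(1, -1) makes \<open>A\<close>
  diagonal. Commuting with \<open>cl (0, 1, 0)\<close>, which exchanges the coordinates, makes the
  diagonal entries equal, and the elements for i and j then make this entry real.\<close>

lemma cl_centralizer:
  assumes "\<And>x. cl x ** A = A ** cl x"
  shows "\<exists>r. A = r *\<^sub>R mat 1"
proof (rule exI[of _ "qre (A $ 1 $ 1)"])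
  have C: "(cl x ** A) $ i $ j = (A ** cl x) $ i $ j" for x i j using assms by simp
  have "A $ 1 $ 2 = - A $ 1 $ 2" "A $ 2 $ 1 = - A $ 2 $ 1"
    using C[of "(1, 0, 0)" 1 2] C[of "(1, 0, 0)" 2 1]
    by (simp_all add: qmat_mult_nth cl_def qpair_def quat_defs)
  then have off: "A $ 1 $ 2 = 0" "A $ 2 $ 1 = 0" by (simp_all add: quat_defs)
  have w: "qpair u v * A $ 2 $ 2 = A $ 1 $ 1 * qpair u v" for u v
    using C[of "(0, u, v)" 1 2] by (simp add: qmat_mult_nth cl_def off)
  have "qpair 1 0 = 1" by (simp add: qpair_def quat_defs)
  then have d: "A $ 2 $ 2 = A $ 1 $ 1" using w[of 1 0] by simp
  have "qi (A $ 1 $ 1) = 0" "qj (A $ 1 $ 1) = 0" "qk (A $ 1 $ 1) = 0"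
    using w[of \<i> 0] w[of 0 1] by (auto simp: d qpair_def times_quat_def)
  then show "A = qre (A $ 1 $ 1) *\<^sub>R mat 1"
    by (simp add: qmat_eq_iff off d mat_def) (simp add: quat_defs)
qed

text \<open>If \<open>f\<^sup>2 = e\<^sup>2 = 1\<close>, then \<open>x + f x e\<close> intertwines \<open>f\<close> and \<open>e\<close>, and it still intertwines every
  pair that \<open>x\<close> intertwines and whose members anticommute with \<open>f\<close> and \<open>e\<close>.\<close>

fun spin_lift :: "('a \<Rightarrow> fib) \<Rightarrow> ('a \<Rightarrow> fib) \<Rightarrow> 'a list \<Rightarrow> quat ^ 2 ^ 2" where
  "spin_lift F G [] = mat 1"
| "spin_lift F G (b # bs) = spin_lift F G bs + cl (F b) ** spin_lift F G bs ** cl (G b)"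

lemma cl_sq: "norm x = 1 \<Longrightarrow> cl x ** cl x = mat 1"
  using cl_anticomm[of x x] by (simp add: dot_square_norm scaleR_2[symmetric])

lemma cl_anticomm_orth: "x \<bullet> y = 0 \<Longrightarrow> cl x ** cl y = - (cl y ** cl x)"
  using cl_anticomm[of x y] by (simp add: add_eq_0_iff)

lemma spin_lift_intertwines_Basis:
  assumes "orthogonal_transformation F" "orthogonal_transformation G"
    and "distinct bs" "set bs \<subseteq> Basis" "b \<in> set bs"
  shows "cl (F b) ** spin_lift F G bs = spin_lift F G bs ** cl (G b)"
  using assms(3-5)
proof (induction bs)
  case (Cons a bs)
  let ?x = "spin_lift F G bs" and ?f = "cl (F a)" and ?e = "cl (G a)"
  have n: "norm (F a) = 1" "norm (G a) = 1"
    using assms(1,2) Cons.prems by (auto simp: orthogonal_transformation_norm)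
  show ?case
  proof (cases "b = a")
    case True
    have "?f ** (?x + ?f ** ?x ** ?e) = ?f ** ?x + (?f ** ?f) ** ?x ** ?e"
      by (simp add: qmat.add_right qmat_assoc)
    also have "\<dots> = ?x ** ?e + ?f ** ?x ** (?e ** ?e)" by (simp add: cl_sq n)
    also have "\<dots> = (?x + ?f ** ?x ** ?e) ** ?e" by (simp add: qmat.add_left qmat_assoc)
    finally show ?thesis by (simp add: True)
  next
    case False
    then have b: "b \<in> set bs" using Cons.prems by auto
    have "a \<bullet> b = 0" using False Cons.prems by (auto simp: inner_Basis)
    then have o: "F b \<bullet> F a = 0" "G b \<bullet> G a = 0"
      using assms(1,2) by (auto simp: orthogonal_transformation_def inner_commute)
    have IH: "cl (F b) ** ?x = ?x ** cl (G b)" using Cons b by auto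
    have "cl (F b) ** (?x + ?f ** ?x ** ?e) = cl (F b) ** ?x + (cl (F b) ** ?f) ** ?x ** ?e"
      by (simp add: qmat.add_right qmat_assoc)
    also have "\<dots> = ?x ** cl (G b) - ?f ** (cl (F b) ** ?x) ** ?e"
      by (simp add: IH cl_anticomm_orth[OF o(1)] qmat.minus_left qmat_assoc)
    also have "\<dots> = ?x ** cl (G b) - ?f ** ?x ** (cl (G b) ** ?e)" by (simp add: IH qmat_assoc)
    also have "\<dots> = (?x + ?f ** ?x ** ?e) ** cl (G b)"
      by (simp add: cl_anticomm_orth[OF o(2)] qmat.minus_right qmat.add_left qmat_assoc)
    finally show ?thesis by simp
  qed
qed simp

definition basis_list :: "fib list" where
  "basis_list = (SOME bs. distinct bs \<and> set bs = Basis)"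

lemma basis_list: "distinct basis_list" "set basis_list = Basis"
proof -
  have "\<exists>bs :: fib list. distinct bs \<and> set bs = Basis"
    using finite_distinct_list[OF finite_Basis] by blast
  from someI_ex[OF this] show "distinct basis_list" "set basis_list = Basis"
    by (simp_all add: basis_list_def)
qed

abbreviation "spin F G \<equiv> spin_lift F G basis_list"

lemma spin_intertwines:
  assumes "orthogonal_transformation F" "orthogonal_transformation G"
  shows "cl (F v) ** spin F G = spin F G ** cl (G v)"
proof -
  have lin: "linear F" "linear G" using assms by (auto simp: orthogonal_transformation_linear)
  have "(\<lambda>v. cl (F v) ** spin F G) = (\<lambda>v. spin F G ** cl (G v))"
  proof (rule linear_eq_stdbasis)
    show "linear (\<lambda>v. cl (F v) ** spin F G)"
      using linear_compose[OF linear_compose[OF lin(1) linear_cl] bounded_linear.linear[OF qmat.bounded_linear_left]]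
      by (simp add: comp_def)
    show "linear (\<lambda>v. spin F G ** cl (G v))"
      using linear_compose[OF linear_compose[OF lin(2) linear_cl] bounded_linear.linear[OF qmat.bounded_linear_right]]
      by (simp add: comp_def)
  qed (use spin_lift_intertwines_Basis[OF assms basis_list(1)] basis_list(2) in auto)
  then show ?thesis by metis
qed

text \<open>Each step of the recursion doubles the matrix because Clifford elements of unit vectors
  square to 1. This positive value on the diagonal is what keeps \<open>spin F G\<close> invertible
  when \<open>F\<close> and \<open>G\<close> are close.\<close>

lemma spin_lift_same:
  assumes "orthogonal_transformation F" "set bs \<subseteq> Basis"
  shows "spin_lift F F bs = (2 ^ length bs) *\<^sub>R mat 1"
  using assms(2)
proof (induction bs)
  case (Cons a bs)
  have "norm (F a) = 1" using assms(1) Cons.prems by (auto simp: orthogonal_transformation_norm)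
  then show ?case
    using Cons by (simp add: qmat.scaleR_left qmat.scaleR_right cl_sq flip: scaleR_add_left)
qed simp

lemma continuous_on_spin_lift:
  assumes "\<And>v. continuous_on X (\<lambda>x. F x v)" "\<And>v. continuous_on X (\<lambda>x. G x v)"
  shows "continuous_on X (\<lambda>x. spin_lift (F x) (G x) bs)"
proof -
  have cl: "continuous_on UNIV cl" using linear_cl by (simp add: linear_continuous_on linear_conv_bounded_linear)
  show ?thesis
    by (induction bs)
      (auto intro!: continuous_intros qmat.continuous_on assms continuous_on_compose2[OF cl])
qed

lemma orthogonal_transformation_commute_scalar:
  fixes F :: "fib \<Rightarrow> fib"
  assumes "orthogonal_transformation F" "\<And>v. cl (F v) ** A = A ** cl (F v)"
  shows "\<exists>r. A = r *\<^sub>R mat 1"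
proof (rule cl_centralizer)
  fix x obtain v where "x = F v" using surjD[OF orthogonal_transformation_surj[OF assms(1)]] by blast
  then show "cl x ** A = A ** cl x" using assms(2) by simp
qed

text \<open>The product commutes with every \<open>cl (F v)\<close> and so is a real scalar,
  recovered as the real part of a diagonal entry. This number varies continuously with
  \<open>F\<close> and \<open>G\<close> and certifies invertibility where it is positive.\<close>

lemma spin_product:
  assumes "orthogonal_transformation F" "orthogonal_transformation G"
  shows "spin F G ** spin G F = qre ((spin F G ** spin G F) $ 1 $ 1) *\<^sub>R mat 1"
proof -
  have "cl (F v) ** (spin F G ** spin G F) = spin F G ** spin G F ** cl (F v)" for v
    using spin_intertwines[OF assms] spin_intertwines[OF assms(2,1)]
    by (metis qmat_assoc)
  then obtain r where "spin F G ** spin G F = r *\<^sub>R mat 1"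
    using orthogonal_transformation_commute_scalar[OF assms(1)] by meson
  then show ?thesis by (simp add: mat_def quat_defs)
qed

section \<open>Rotations of two planes and their lifts to Sp(2)\<close>

definition rot :: "nat \<Rightarrow> nat \<Rightarrow> complex \<Rightarrow> fib \<Rightarrow> fib" where
  "rot j k \<zeta> = (\<lambda>(t, u, v). (t, \<zeta> ^ j * u, \<zeta> ^ k * v))"

text \<open>The lift of the rotation by the angles j h and k h. Conjugation by diag(A, B) sends the
  quaternion u + v j to A (u + v j) B^(-1), turning u by A / B and v by A B; the half angles solve A
  / B = cis (j h) and A B = cis (k h).\<close>

definition spin_rot :: "nat \<Rightarrow> nat \<Rightarrow> real \<Rightarrow> quat ^ 2 ^ 2" where
  "spin_rot j k h = diag2 (quat_of_complex (cis ((real k + real j) * h / 2)))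
     (quat_of_complex (cis ((real k - real j) * h / 2)))"

lemma spin_rot_add: "spin_rot j k g ** spin_rot j k h = spin_rot j k (g + h)"
  by (simp add: spin_rot_def diag2_mult quat_of_complex_mult[symmetric] cis_mult distrib_left add_divide_distrib)

lemma spin_rot_0: "spin_rot j k 0 = mat 1"
  by (simp add: spin_rot_def diag2_def qmat_eq_iff mat_def)

lemma qpair_mult: "quat_of_complex a * qpair u v = qpair (a * u) (a * v)"
    "qpair u v * quat_of_complex b = qpair (u * b) (v * cnj b)"
  by (simp_all add: quat_of_complex_def qpair_def quat_defs algebra_simps)

lemma qcnj_qpair: "qcnj (qpair u v) = qpair (cnj u) (- v)"
  by (simp add: qpair_def quat_defs)

lemma rot_intertwines:
  "cl (rot j k (cis h) x) ** spin_rot j k h = spin_rot j k h ** cl x"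
proof -
  have real: "Quat t 0 0 0 = qpair (of_real t) 0" for t by (simp add: qpair_def)
  let ?A = "cis ((real k + real j) * h / 2)" and ?B = "cis ((real k - real j) * h / 2)"
  have cs: "cis x * cis y = cis z" if "x + y = z" for x y z using that by (simp add: cis_mult)
  have "cis h ^ j * ?B = ?A" unfolding Complex.DeMoivre by (rule cs) argo
  moreover have "cis h ^ k * cnj ?B = ?A" unfolding Complex.DeMoivre cis_cnj by (rule cs) argo
  moreover have "cnj (cis h ^ j) * ?A = ?B" unfolding Complex.DeMoivre cis_cnj by (rule cs) argo
  moreover have "cis h ^ k * cnj ?A = ?B" unfolding Complex.DeMoivre cis_cnj by (rule cs) argo
  ultimately have e: "cis h ^ j * ?B = ?A" "cis h ^ k * cnj ?B = ?A" "cnj (cis h ^ j) * ?A = ?B"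
    "cis h ^ k * cnj ?A = ?B" by blast+
  show ?thesis
    using e
    by (simp add: qmat_eq_iff qmat_mult_nth spin_rot_def diag2_def cl_def rot_def case_prod_unfold
        qpair_mult qcnj_qpair real mult_ac)
qed

lemma spin_invertible:
  assumes "orthogonal_transformation F" "orthogonal_transformation G"
    "0 < qre ((spin G F ** spin F G) $ 1 $ 1)"
  shows "\<exists>B. B ** spin F G = mat 1"
proof -
  obtain r where r: "spin G F ** spin F G = r *\<^sub>R mat 1" "0 < r"
    using spin_product[OF assms(2,1)] assms(3) by metis
  then have "((1 / r) *\<^sub>R spin G F) ** spin F G = mat 1"
    by (simp add: qmat.scaleR_left)
  then show ?thesis by blast
qed

lemma orthogonal_rot: "norm \<zeta> = 1 \<Longrightarrow> orthogonal_transformation (rot j k \<zeta>)"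
  unfolding orthogonal_transformation rot_def
  by (auto intro!: linearI simp: norm_Pair norm_mult norm_power algebra_simps split: prod.splits)

text \<open>\<open>spin\<close> and \<open>spin_rot\<close> intertwine the same two families, hence
  they differ by a real scalar. The corner of \<open>spin_rot\<close> has the cosine as its real
  part, so comparing corners makes the scalar positive.\<close>

lemma spin_rot_increment:
  assumes "0 < qre (spin (rot j k (cis (a + h))) (rot j k (cis a)) $ 1 $ 1)"
    "0 < cos ((real k + real j) * h / 2)"
  shows "\<exists>\<mu>>0. spin (rot j k (cis (a + h))) (rot j k (cis a)) = \<mu> *\<^sub>R spin_rot j k h"
proof -
  let ?F = "rot j k (cis (a + h))" and ?G = "rot j k (cis a)"
  let ?M = "spin ?F ?G" and ?S = "spin_rot j k h" and ?S' = "spin_rot j k (- h)"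
  have o: "orthogonal_transformation ?F" "orthogonal_transformation ?G" by (simp_all add: orthogonal_rot)
  have FG: "?F x = rot j k (cis h) (?G x)" for x
    by (auto simp: rot_def cis_mult[symmetric] power_mult_distrib split: prod.splits)
  have SS: "?S' ** ?S = mat 1" "?S ** ?S' = mat 1" by (simp_all add: spin_rot_add spin_rot_0)
  have "cl (?G v) ** (?S' ** ?M) = ?S' ** ?M ** cl (?G v)" for v
  proof -
    have "cl (?G v) ** (?S' ** ?M) = ?S' ** (?S ** cl (?G v)) ** ?S' ** ?M"
      by (simp add: qmat_assoc SS flip: qmat_assoc[of ?S' ?S])
    also have "?S ** cl (?G v) = cl (?F v) ** ?S" by (simp add: FG rot_intertwines)
    also have "?S' ** (cl (?F v) ** ?S) ** ?S' ** ?M = ?S' ** (cl (?F v) ** ?M)"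
      by (simp add: qmat_assoc SS flip: qmat_assoc[of ?S ?S'])
    also have "\<dots> = ?S' ** ?M ** cl (?G v)" by (simp add: spin_intertwines[OF o] qmat_assoc)
    finally show ?thesis .
  qed
  then obtain \<mu> where "?S' ** ?M = \<mu> *\<^sub>R mat 1"
    using orthogonal_transformation_commute_scalar[OF o(2)] by meson
  then have "?S ** (?S' ** ?M) = \<mu> *\<^sub>R ?S" by (simp add: qmat.scaleR_right)
  then have M: "?M = \<mu> *\<^sub>R ?S" by (simp add: SS flip: qmat_assoc)
  have "qre (?M $ 1 $ 1) = \<mu> * cos ((real k + real j) * h / 2)"
    by (simp add: M spin_rot_def diag2_def quat_of_complex_def scaleR_quat_def)
  then have "0 < \<mu>" using assms zero_less_mult_pos2 by metis
  with M show ?thesis by blast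
qed

section \<open>Multiplying intertwiners along a loop\<close>

fun spin_path :: "(real \<Rightarrow> fib \<Rightarrow> fib) \<Rightarrow> real \<Rightarrow> nat \<Rightarrow> quat ^ 2 ^ 2" where
  "spin_path F h 0 = mat 1"
| "spin_path F h (Suc n) = spin (F (real (Suc n) * h)) (F (real n * h)) ** spin_path F h n"

text \<open>A discrete form of lifting a homotopy to Spin(5). Uniform continuity yields one step
  length \<open>h\<close> for which the factors are invertible for every \<open>s\<close> at once,
  so the holonomy is a continuous function of \<open>s\<close> without zeros. The homotopy is free:
  the base point \<open>F s 0\<close> may move with \<open>s\<close>.\<close>

lemma rot_loop_not_null_homotopic:
  fixes F :: "real \<Rightarrow> real \<Rightarrow> fib \<Rightarrow> fib"
  assumes "odd (j + k)"
    and cont: "\<And>v. continuous_on ({0..1} \<times> {0..2 * pi}) (\<lambda>p. F (fst p) (snd p) v)"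
    and orth: "\<And>s \<theta>. s \<in> {0..1} \<Longrightarrow> \<theta> \<in> {0..2 * pi} \<Longrightarrow> orthogonal_transformation (F s \<theta>)"
    and F0: "\<And>\<theta>. \<theta> \<in> {0..2 * pi} \<Longrightarrow> F 0 \<theta> = F 0 0"
    and F1: "\<And>\<theta>. \<theta> \<in> {0..2 * pi} \<Longrightarrow> F 1 \<theta> = rot j k (cis \<theta>)"
    and loop: "\<And>s. s \<in> {0..1} \<Longrightarrow> F s (2 * pi) = F s 0"
  shows False
proof -
  let ?K = "{0..1::real} \<times> {0..2 * pi} \<times> {0..2 * pi}"
  let ?L = "length basis_list"
  \<comment> \<open>Positivity of \<open>lam\<close> makes a factor of the holonomy invertible;
    positivity of the corner of \<open>g\<close> determines the sign of the factors of the rotation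
    loop.\<close>
  define g where "g = (\<lambda>p. spin (F (fst p) (fst (snd p))) (F (fst p) (snd (snd p))))"
  define lam where "lam = (\<lambda>p. qre ((spin (F (fst p) (snd (snd p))) (F (fst p) (fst (snd p))) **
     spin (F (fst p) (fst (snd p))) (F (fst p) (snd (snd p)))) $ 1 $ 1))"
  have cqre: "continuous_on UNIV (\<lambda>A :: quat ^ 2 ^ 2. qre (A $ 1 $ 1))"
    by (rule linear_continuous_on)
      (auto simp: linear_conv_bounded_linear[symmetric] plus_quat_def scaleR_quat_def intro!: linearI)
  have c1: "continuous_on ?K (\<lambda>p. F (fst p) (fst (snd p)) v)" and c2: "continuous_on ?K (\<lambda>p. F (fst p) (snd (snd p)) v)" for v
    by (rule continuous_on_compose2[OF cont[of v], of _ "\<lambda>p. (fst p, fst (snd p))", simplified];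
        auto intro!: continuous_intros)
     (rule continuous_on_compose2[OF cont[of v], of _ "\<lambda>p. (fst p, snd (snd p))", simplified];
        auto intro!: continuous_intros)
  have cg: "continuous_on ?K (\<lambda>p. qre (g p $ 1 $ 1))" and cl: "continuous_on ?K lam"
    unfolding g_def lam_def
    by (intro continuous_on_compose2[OF cqre] qmat.continuous_on continuous_on_spin_lift c1 c2; simp)+
  obtain \<delta>1 where d1: "\<delta>1 > 0" "\<And>p q. p \<in> ?K \<Longrightarrow> q \<in> ?K \<Longrightarrow> dist q p < \<delta>1 \<Longrightarrow> dist (lam q) (lam p) < 1"
    using compact_uniformly_continuous[OF cl] unfolding uniformly_continuous_on_def
    by (metis compact_Times compact_Icc zero_less_one)
  obtain \<delta>2 where d2: "\<delta>2 > 0" "\<And>p q. p \<in> ?K \<Longrightarrow> q \<in> ?K \<Longrightarrow> dist q p < \<delta>2 \<Longrightarrow>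
      dist (qre (g q $ 1 $ 1)) (qre (g p $ 1 $ 1)) < 1"
    using compact_uniformly_continuous[OF cg] unfolding uniformly_continuous_on_def
    by (metis compact_Times compact_Icc zero_less_one)
  have diag: "g (s, \<theta>, \<theta>) = 2 ^ ?L *\<^sub>R mat 1" if "s \<in> {0..1}" "\<theta> \<in> {0..2 * pi}" for s \<theta>
    unfolding g_def using spin_lift_same[OF orth[OF that]] basis_list(2) by simp
  \<comment> \<open>The third bound keeps (k + j) h / 2 below pi / 2, so the cosine in
    \<open>spin_rot_increment\<close> is positive; the added 1 covers k + j = 0.\<close>
  obtain N :: nat where N: "N > 0" "2 * pi / N < min \<delta>1 (min \<delta>2 (pi / (real k + real j + 1)))"
  proof -
    define m where "m = min \<delta>1 (min \<delta>2 (pi / (real k + real j + 1)))"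
    have m: "m > 0" using d1 d2 by (simp add: m_def)
    obtain N :: nat where N: "2 * pi / m < N" using reals_Archimedean2 by blast
    have "0 < 2 * pi / m" using m by simp
    then have "0 < real N" using N by linarith
    then have "N > 0" "2 * pi / N < m" using m N by (auto simp: field_simps)
    then show ?thesis using that by (simp add: m_def)
  qed
  define h where "h = 2 * pi / N"
  have h: "h > 0" "h < \<delta>1" "h < \<delta>2" "h < pi / (real k + real j + 1)" "N * h = 2 * pi"
    using N by (auto simp: h_def)
  have \<theta>: "real n * h \<in> {0..2 * pi}" if "n \<le> N" for n
    using h(1) h(5)[symmetric] that by (simp add: mult_right_mono)
  have close: "0 < lam (s, real (Suc n) * h, real n * h)" "0 < qre (g (s, real (Suc n) * h, real n * h) $ 1 $ 1)"
    if "s \<in> {0..1}" "n < N" for s n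
  proof -
    let ?p = "(s, real n * h, real n * h)" and ?q = "(s, real (Suc n) * h, real n * h)"
    have K: "?p \<in> ?K" "?q \<in> ?K" using that \<theta>[of n] \<theta>[of "Suc n"] by auto
    have "dist ?q ?p = h" using h(1) by (simp add: dist_Pair_Pair dist_real_def algebra_simps)
    \<comment> \<open>On the diagonal both quantities are powers of 2, hence at least 1, and one
      step of length \<open>h\<close> changes them by less than 1.\<close>
    then have "dist (lam ?q) (lam ?p) < 1" "dist (qre (g ?q $ 1 $ 1)) (qre (g ?p $ 1 $ 1)) < 1"
      using d1(2)[OF K] d2(2)[OF K] h by auto
    moreover have gp: "g ?p = 2 ^ ?L *\<^sub>R mat 1" using that \<theta>[of n] by (intro diag) auto
    have "lam ?p = 2 ^ ?L * 2 ^ ?L"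
      using gp by (simp add: lam_def g_def qmat.scaleR_left qmat.scaleR_right)
        (simp add: mat_def scaleR_quat_def one_quat_def)
    moreover have "qre (g ?p $ 1 $ 1) = 2 ^ ?L" by (simp add: gp mat_def scaleR_quat_def one_quat_def)
    ultimately have "\<bar>lam ?q - 2 ^ ?L * 2 ^ ?L\<bar> < 1" "\<bar>qre (g ?q $ 1 $ 1) - 2 ^ ?L\<bar> < 1"
      by (simp_all only: dist_real_def)
    moreover have 1: "(1::real) \<le> 2 ^ ?L" by simp
    moreover have "(1::real) \<le> 2 ^ ?L * 2 ^ ?L" using mult_mono[OF 1 1] by simp
    ultimately show "0 < lam ?q" "0 < qre (g ?q $ 1 $ 1)" by linarith+
  qed
  define G where "G s n = spin_path (F s) h n" for s n
  \<comment> \<open>The product telescopes to an intertwiner between angle 0 and angle n h. Once the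
    loop has closed, the two families agree and the product is in their centralizer.\<close>
  have inter: "cl (F s (real n * h) v) ** G s n = G s n ** cl (F s 0 v)" if "s \<in> {0..1}" "n \<le> N" for s n v
    using that(2)
  proof (induction n)
    case (Suc n)
    have o: "orthogonal_transformation (F s (real (Suc n) * h))" "orthogonal_transformation (F s (real n * h))"
      using that(1) \<theta>[of n] \<theta>[of "Suc n"] Suc.prems by (auto intro!: orth)
    have IH: "cl (F s (real n * h) v) ** G s n = G s n ** cl (F s 0 v)" using Suc by simp
    show ?case
      unfolding G_def spin_path.simps
      using spin_intertwines[OF o, of v] IH
      by (simp add: G_def qmat_assoc[symmetric] del: of_nat_Suc) (simp add: qmat_assoc del: of_nat_Suc)
  qed (simp add: G_def)
  have inv: "\<exists>B. B ** G s n = mat 1" if s: "s \<in> {0..1}" and "n \<le> N" for s n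
    using that(2)
  proof (induction n)
    case (Suc n)
    obtain B where B: "B ** G s n = mat 1" using Suc by auto
    have o: "orthogonal_transformation (F s (real (Suc n) * h))" "orthogonal_transformation (F s (real n * h))"
      using that(1) \<theta>[of n] \<theta>[of "Suc n"] Suc.prems by (auto intro!: orth)
    obtain C where "C ** spin (F s (real (Suc n) * h)) (F s (real n * h)) = mat 1"
      using spin_invertible[OF o] close(1)[OF s, of n] Suc.prems by (auto simp: lam_def)
    then have "(B ** C) ** G s (Suc n) = mat 1"
      using B by (simp add: G_def qmat_assoc[of B C] del: of_nat_Suc)
        (simp add: qmat_assoc[of C, symmetric] del: of_nat_Suc)
    then show ?case by blast
  qed (auto simp: G_def intro: exI[of _ "mat 1"])
  let ?t = "\<lambda>s. qre (G s N $ 1 $ 1)"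
  have nz: "?t s \<noteq> 0" if s: "s \<in> {0..1}" for s
  proof
    assume t: "?t s = 0"
    have "cl (F s 0 v) ** G s N = G s N ** cl (F s 0 v)" for v
      using inter[OF s, of N v] loop[OF s] h(5) by simp
    then obtain r where r: "G s N = r *\<^sub>R mat 1"
      using orthogonal_transformation_commute_scalar[of "F s 0" "G s N"] orth[OF s, of 0] by force
    then have "r = 0" using t by (simp add: mat_def scaleR_quat_def one_quat_def)
    then obtain B :: "quat ^ 2 ^ 2" where "B ** 0 = mat 1" using inv[OF s, of N] r by auto
    then have "(0 :: quat ^ 2 ^ 2) = mat 1" by simp
    then show False by (simp add: qmat_eq_iff mat_def)
  qed
  have contG: "continuous_on {0..1} (\<lambda>s. G s n)" if "n \<le> N" for n
    using that
  proof (induction n)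
    case (Suc n)
    have c: "continuous_on {0..1} (\<lambda>s. F s (real i * h) v)" if "i \<le> N" for i v
    proof -
      have 1: "continuous_on {0..1} (\<lambda>s. (s, real i * h))" by (intro continuous_intros)
      have 2: "(\<lambda>s. (s, real i * h)) ` {0..1} \<subseteq> {0..1} \<times> {0..2 * pi}" using \<theta>[OF that] by auto
      show ?thesis using continuous_on_compose2[OF cont[of v] 1 2] by simp
    qed
    show ?case
      unfolding G_def spin_path.simps using Suc c[of n] c[of "Suc n"]
      by (intro qmat.continuous_on continuous_on_spin_lift) (simp_all add: G_def del: of_nat_Suc)
  qed (simp add: G_def)
  have "continuous_on {0..1} ?t"
    by (rule continuous_on_compose2[OF cqre contG]) auto
  moreover have "0 < ?t 0"
  proof -
    have "\<exists>\<mu>>0. G 0 n = \<mu> *\<^sub>R mat 1" if "n \<le> N" for n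
      using that
    proof (induction n)
      case (Suc n)
      then obtain \<mu> where \<mu>: "\<mu> > 0" "G 0 n = \<mu> *\<^sub>R mat 1" by auto
      have "F 0 (real (Suc n) * h) = F 0 0" "F 0 (real n * h) = F 0 0"
        by (rule F0, rule \<theta>, use Suc.prems in simp)+
      then have "G 0 (Suc n) = spin (F 0 0) (F 0 0) ** G 0 n" by (simp only: G_def spin_path.simps)
      also have "spin (F 0 0) (F 0 0) = 2 ^ ?L *\<^sub>R mat 1" using diag[of 0 0] by (simp add: g_def)
      finally have "G 0 (Suc n) = (2 ^ ?L * \<mu>) *\<^sub>R mat 1"
        by (simp add: \<mu> qmat.scaleR_left qmat.scaleR_right)
      then show ?case using \<mu> by (intro exI[of _ "2 ^ ?L * \<mu>"]) simp
    qed (auto simp: G_def intro: exI[of _ 1])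
    then obtain \<mu> where "\<mu> > 0" "G 0 N = \<mu> *\<^sub>R mat 1" by blast
    then show ?thesis by (simp add: mat_def scaleR_quat_def one_quat_def)
  qed
  moreover have "?t 1 < 0"
  proof -
    have "(real k + real j) * h / 2 < pi / 2"
      using h(1,4) by (simp add: field_simps)
    then have c: "0 < cos ((real k + real j) * h / 2)"
      using h(1) by (intro cos_gt_zero_pi) (auto intro: less_le_trans[of _ 0])
    have "\<exists>\<mu>>0. G 1 n = \<mu> *\<^sub>R spin_rot j k (n * h)" if "n \<le> N" for n
      using that
    proof (induction n)
      case (Suc n)
      then obtain \<mu> where \<mu>: "\<mu> > 0" "G 1 n = \<mu> *\<^sub>R spin_rot j k (n * h)" by auto
      have F: "F 1 (real (Suc n) * h) = rot j k (cis (n * h + h))" "F 1 (real n * h) = rot j k (cis (n * h))"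
        using F1[OF \<theta>, of "Suc n"] F1[OF \<theta>, of n] Suc.prems by (simp_all add: algebra_simps)
      have "0 < qre (spin (rot j k (cis (n * h + h))) (rot j k (cis (n * h))) $ 1 $ 1)"
        using close(2)[of 1 n] Suc.prems by (simp only: g_def fst_conv snd_conv F) simp
      then obtain \<nu> where \<nu>: "\<nu> > 0" "spin (rot j k (cis (n * h + h))) (rot j k (cis (n * h))) = \<nu> *\<^sub>R spin_rot j k h"
        using spin_rot_increment[OF _ c] by meson
      have "G 1 (Suc n) = (\<nu> * \<mu>) *\<^sub>R (spin_rot j k h ** spin_rot j k (n * h))"
        using \<mu> \<nu> F by (simp only: G_def spin_path.simps qmat.scaleR_left qmat.scaleR_right scaleR_scaleR
            mult.commute[of \<nu>])
      also have "spin_rot j k h ** spin_rot j k (n * h) = spin_rot j k (Suc n * h)"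
        by (simp add: spin_rot_add algebra_simps)
      finally show ?case using \<mu> \<nu> by (intro exI[of _ "\<nu> * \<mu>"]) simp
    qed (auto simp: G_def spin_rot_0 intro: exI[of _ 1])
    then obtain \<mu> where \<mu>: "\<mu> > 0" "G 1 N = \<mu> *\<^sub>R spin_rot j k (N * h)" by blast
    \<comment> \<open>After a full turn the half angle is (j + k) pi, so the lift ends at (-1)^(j +
      k); here the parity enters.\<close>
    have "cis ((real k + real j) * (N * h) / 2) = cis (real (j + k) * pi)"
      unfolding h(5) by (rule arg_cong[where f = cis]) simp
    also have "\<dots> = -1" using assms(1)
      by (simp add: Complex.DeMoivre[symmetric] minus_one_power_iff del: of_nat_add)
    finally show ?thesis using \<mu>
      by (simp add: spin_rot_def diag2_def quat_of_complex_def scaleR_quat_def)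
  qed
  ultimately obtain s where "s \<in> {0..1}" "?t s = 0"
    using IVT2'[of ?t 1 0 0] by auto
  then show False using nz by blast
qed

section \<open>A linear sphere bundle over the sphere\<close>

type_synonym total = "(complex \<times> real) \<times> real \<times> (complex \<times> complex) \<times> complex \<times> complex"

definition hopf :: "complex \<Rightarrow> complex \<Rightarrow> complex \<times> real" where
  "hopf a b = (2 * a * cnj b, (norm a)\<^sup>2 - (norm b)\<^sup>2)"

text \<open>The classes of \<open>((a, b), p)\<close> and \<open>((a / \<zeta>, b / \<zeta>), rot j k \<zeta> p)\<close> in \<open>S\<^sup>3 \<times>\<^bsub>S\<^sup>1\<^esub> S\<^sup>4\<close> have the same
  image.\<close>

definition emb :: "nat \<Rightarrow> nat \<Rightarrow> complex \<Rightarrow> complex \<Rightarrow> fib \<Rightarrow>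
    total" where
  "emb j k a b p = (hopf a b, fst p, snd (rot j k a p), snd (rot j k b p))"

definition bundle_set :: "nat \<Rightarrow> nat \<Rightarrow> total set" where
  "bundle_set j k = {emb j k a b p | a b p. (norm a)\<^sup>2 + (norm b)\<^sup>2 = 1 \<and> norm p = 1}"

section \<open>Trivialisations over the complements of the two poles\<close>

definition north :: "(complex \<times> real) \<Rightarrow> real" where
  "north x = sqrt ((1 + snd x) / 2)"

text \<open>At \<open>emb j k a b p\<close> the function \<open>north\<close> is |a|. Dividing by
  its powers leaves \<open>rot j k (a / norm a) p\<close>, the fibre coordinate of the
  representative whose first entry is positive.\<close>

definition triv1 :: "nat \<Rightarrow> nat \<Rightarrow> total \<Rightarrow>
    (complex \<times> real) \<times> fib" where
  "triv1 j k y = (fst y, fst (snd y),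
     (1 / north (fst y)) ^ j *\<^sub>R fst (fst (snd (snd y))), (1 / north (fst y)) ^ k *\<^sub>R snd (fst (snd (snd y))))"

text \<open>The second entry b that belongs to the positive first entry a = \<open>north x\<close>,
  solved from 2 a cnj b = \<open>fst x\<close>.\<close>

definition lift1 :: "complex \<times> real \<Rightarrow> complex" where
  "lift1 x = (1 / (2 * north x)) *\<^sub>R cnj (fst x)"

definition triv1_inv :: "nat \<Rightarrow> nat \<Rightarrow> (complex \<times> real) \<times> fib \<Rightarrow>
    total" where
  "triv1_inv j k w = emb j k (of_real (north (fst w))) (lift1 (fst w)) (snd w)"

definition S2N :: "(complex \<times> real) set" where "S2N = sphere 0 1 \<inter> {x. - 1 < snd x}"
definition S2S :: "(complex \<times> real) set" where "S2S = sphere 0 1 \<inter> {x. snd x < 1}"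

text \<open>The effect on the Hopf map of exchanging a and b. As it exchanges \<open>S2N\<close> and
  \<open>S2S\<close>, the southern trivialisation is the northern one conjugated by the
  flip.\<close>

definition flip_base :: "complex \<times> real \<Rightarrow> complex \<times> real" where
  "flip_base x = (cnj (fst x), - snd x)"

definition flip :: "total \<Rightarrow>
    total" where
  "flip y = (flip_base (fst y), fst (snd y), snd (snd (snd y)), fst (snd (snd y)))"

definition triv2 where "triv2 j k y = map_prod flip_base id (triv1 j k (flip y))"
definition triv2_inv where "triv2_inv j k w = flip (triv1_inv j k (map_prod flip_base id w))"

lemma norm_hopf: "norm (hopf a b) = (norm a)\<^sup>2 + (norm b)\<^sup>2"
proof -
  have "(norm (hopf a b))\<^sup>2 = ((norm a)\<^sup>2 + (norm b)\<^sup>2)\<^sup>2"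
    by (simp add: hopf_def norm_Pair norm_mult power2_eq_square algebra_simps)
  then show ?thesis by (simp add: power2_eq_iff_nonneg)
qed

lemma rot_rot: "rot j k a (rot j k b p) = rot j k (a * b) p"
  by (simp add: rot_def power_mult_distrib mult.assoc split: prod.splits)

lemma rot_1 [simp]: "rot j k 1 p = p"
  by (simp add: rot_def split: prod.splits)

lemma fst_rot [simp]: "fst (rot j k a p) = fst p"
  by (simp add: rot_def split: prod.splits)

lemma norm_rot: "norm a = 1 \<Longrightarrow> norm (rot j k a p) = norm p"
  using orthogonal_rot orthogonal_transformation_norm by blast

lemma emb_invariant:
  assumes "norm \<zeta> = 1"
  shows "emb j k (a * \<zeta>) (b * \<zeta>) p = emb j k a b (rot j k \<zeta> p)"
proof -
  have "\<zeta> * cnj \<zeta> = 1" using assms by (metis complex_norm_square of_real_1 one_power2)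
  then have "hopf (a * \<zeta>) (b * \<zeta>) = hopf a b"
    using assms by (simp add: hopf_def norm_mult power_mult_distrib mult_ac)
  then show ?thesis by (simp add: emb_def rot_rot)
qed

lemma emb_in_bundle_set: "(norm a)\<^sup>2 + (norm b)\<^sup>2 = 1 \<Longrightarrow> norm p = 1 \<Longrightarrow> emb j k a b p \<in> bundle_set j k"
  unfolding bundle_set_def by blast

lemma flip_emb: "flip (emb j k a b p) = emb j k b a p"
  by (simp add: flip_def emb_def hopf_def flip_base_def mult_ac)

lemma flip_base_hopf: "flip_base (hopf a b) = hopf b a"
  by (simp add: hopf_def flip_base_def mult_ac)

lemma flip_flip [simp]: "flip (flip y) = y" and flip_base_flip_base [simp]: "flip_base (flip_base x) = x"
  by (simp_all add: flip_def flip_base_def)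

lemma north_lift1:
  assumes "x \<in> S2N"
  shows "0 < north x" "(norm (of_real (north x) :: complex))\<^sup>2 + (norm (lift1 x))\<^sup>2 = 1"
    "hopf (of_real (north x)) (lift1 x) = x"
proof -
  have s: "- 1 < snd x" "(norm (fst x))\<^sup>2 + (snd x)\<^sup>2 = 1"
    using assms by (auto simp: S2N_def norm_prod_def)
  show n: "0 < north x" using s by (simp add: north_def)
  have n2: "(north x)\<^sup>2 = (1 + snd x) / 2" using s by (simp add: north_def)
  have "(norm (fst x))\<^sup>2 = (1 - snd x) * (1 + snd x)" using s by (simp add: algebra_simps power2_eq_square)
  also have "\<dots> = (1 - snd x) * (2 * (north x)\<^sup>2)" using n2 by simp
  finally have l2: "(norm (lift1 x))\<^sup>2 = (1 - snd x) / 2"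
    using n by (simp add: lift1_def power_mult_distrib power_divide)
  show "(norm (of_real (north x) :: complex))\<^sup>2 + (norm (lift1 x))\<^sup>2 = 1"
    using n2 l2 by (simp add: field_simps)
  have "2 * of_real (north x) * cnj (lift1 x) = fst x"
    using n by (simp add: lift1_def scaleR_conv_of_real)
  then show "hopf (of_real (north x)) (lift1 x) = x"
    using n2 l2 by (simp add: hopf_def prod_eq_iff field_simps)
qed

lemma bundle_set_fst: "y \<in> bundle_set j k \<Longrightarrow> fst y \<in> sphere 0 1"
  by (auto simp: bundle_set_def emb_def norm_hopf)

lemma triv1_emb:
  assumes "a \<noteq> 0" "(norm a)\<^sup>2 + (norm b)\<^sup>2 = 1"
  shows "triv1 j k (emb j k a b p) = (hopf a b, rot j k (a / norm a) p)"
proof -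
  have "(1 + snd (hopf a b)) / 2 = (norm a)\<^sup>2" using assms by (simp add: hopf_def)
  then have "north (hopf a b) = norm a" by (simp add: north_def)
  then show ?thesis
    by (simp add: triv1_def emb_def rot_def scaleR_conv_of_real power_divide split: prod.splits)
qed

lemma triv1_inv_mem: "x \<in> S2N \<Longrightarrow> norm p = 1 \<Longrightarrow> triv1_inv j k (x, p) \<in> bundle_set j k"
  unfolding triv1_inv_def fst_conv snd_conv using north_lift1[of x] by (intro emb_in_bundle_set)

lemma S2N_hopf:
  assumes "(norm a)\<^sup>2 + (norm b)\<^sup>2 = 1"
  shows "hopf a b \<in> S2N \<longleftrightarrow> a \<noteq> 0"
proof -
  have "snd (hopf a b) = 2 * (norm a)\<^sup>2 - 1" using assms by (simp add: hopf_def)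
  then show ?thesis using assms by (auto simp: S2N_def norm_hopf)
qed

lemma triv1_inverse:
  assumes "y \<in> bundle_set j k" "fst y \<in> S2N"
  shows "triv1_inv j k (triv1 j k y) = y" "triv1 j k y \<in> S2N \<times> sphere 0 1"
proof -
  obtain a b p where y: "y = emb j k a b p" "(norm a)\<^sup>2 + (norm b)\<^sup>2 = 1" "norm p = 1"
    using assms(1) by (auto simp: bundle_set_def)
  have f: "fst y = hopf a b" by (simp add: y emb_def)
  then have a: "a \<noteq> 0" using S2N_hopf[OF y(2)] assms(2) by simp
  \<comment> \<open>The phase that makes the first entry positive: multiplication by
    \<open>z\<close> turns (a, b) into \<open>north\<close> and \<open>lift1\<close> of its Hopf
    image, and \<open>emb_invariant\<close> lets \<open>z\<close> cancel the phase a / |a| in the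
    fibre coordinate.\<close>
  define z where "z = cnj (a / norm a)"
  have z: "norm z = 1" using a by (simp add: z_def norm_divide)
  have "(1 + snd (hopf a b)) / 2 = (norm a)\<^sup>2" using y(2) by (simp add: hopf_def)
  then have north: "north (hopf a b) = norm a" by (simp add: north_def)
  have aa: "a * cnj a = of_real (norm a) * of_real (norm a)"
    by (simp add: complex_norm_square[symmetric] power2_eq_square)
  have n: "complex_of_real (norm a) = a * z" using a aa by (simp add: z_def field_simps)
  have l: "lift1 (hopf a b) = b * z"
    using a by (simp add: lift1_def north) (simp add: z_def hopf_def scaleR_conv_of_real field_simps)
  have t: "triv1 j k y = (hopf a b, rot j k (a / norm a) p)"
    unfolding y(1) by (rule triv1_emb[OF a y(2)])
  have "z * (a / norm a) = 1" using a aa by (simp add: z_def field_simps)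
  then show "triv1_inv j k (triv1 j k y) = y"
    unfolding t triv1_inv_def fst_conv snd_conv north l n emb_invariant[OF z] rot_rot by (simp add: y)
  have "norm (a / norm a) = 1" using a by (simp add: norm_divide)
  then show "triv1 j k y \<in> S2N \<times> sphere 0 1"
    using assms(2) f y(3) unfolding t by (simp add: norm_rot)
qed

lemma triv1_triv1_inv:
  assumes "x \<in> S2N"
  shows "triv1 j k (triv1_inv j k (x, p)) = (x, p)" "fst (triv1_inv j k (x, p)) = x"
proof -
  note n = north_lift1[OF assms]
  show "triv1 j k (triv1_inv j k (x, p)) = (x, p)"
    using triv1_emb[OF _ n(2), of j k p] n(1,3) by (simp add: triv1_inv_def)
  show "fst (triv1_inv j k (x, p)) = x" by (simp add: triv1_inv_def emb_def n)
qed

lemma smooth_north: "smooth_on_subset {x. - 1 < snd x} north"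
  unfolding north_def by (intro smooth_intros) auto

lemma north_nz: "- 1 < snd x \<Longrightarrow> north x \<noteq> 0"
  by (simp add: north_def)

lemma smooth_rot: "smooth_on_subset U f \<Longrightarrow> smooth_on_subset U g \<Longrightarrow> smooth_on_subset U (\<lambda>x. rot j k (f x) (g x))"
  unfolding rot_def case_prod_unfold by (intro smooth_intros)

lemma smooth_emb: "smooth_on_subset U f \<Longrightarrow> smooth_on_subset U g \<Longrightarrow> smooth_on_subset U h \<Longrightarrow>
    smooth_on_subset U (\<lambda>x. emb j k (f x) (g x) (h x))"
  unfolding emb_def hopf_def power2_norm_eq_inner by (intro smooth_intros smooth_rot)

lemma smooth_lift1: "smooth_on_subset {x. - 1 < snd x} lift1"
  unfolding lift1_def by (intro smooth_intros smooth_north) (auto simp: north_nz)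

lemma ediff_triv1: "ediff (bundle_set j k \<inter> fst -` S2N) (S2N \<times> sphere 0 1) (triv1 j k) (triv1_inv j k)"
  unfolding ediff_def
proof (intro conjI ballI)
  have N: "smooth_on_subset (fst -` S2N) (\<lambda>y. north (fst y))"
    by (rule smooth_on_subset_compose[OF _ smooth_north]) (auto intro!: smooth_intros simp: S2N_def)
  show "smooth_on_subset (bundle_set j k \<inter> fst -` S2N) (triv1 j k)"
    unfolding triv1_def
    by (intro smooth_intros smooth_on_subset_mono[OF N]) (auto simp: S2N_def north_nz)
  have "smooth_on_subset (S2N \<times> sphere 0 1) (\<lambda>y :: (complex \<times> real) \<times> fib. north (fst y))"
    by (rule smooth_on_subset_compose[OF _ smooth_north]) (auto intro!: smooth_intros simp: S2N_def)
  moreover have "smooth_on_subset (S2N \<times> sphere 0 1) (\<lambda>y :: (complex \<times> real) \<times> fib. lift1 (fst y))"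
    by (rule smooth_on_subset_compose[OF _ smooth_lift1]) (auto intro!: smooth_intros simp: S2N_def)
  ultimately show "smooth_on_subset (S2N \<times> sphere 0 1) (triv1_inv j k)"
    unfolding triv1_inv_def by (intro smooth_emb smooth_intros)
next
  show "triv1 j k ` (bundle_set j k \<inter> fst -` S2N) \<subseteq> S2N \<times> sphere 0 1"
    using triv1_inverse(2) by blast
  show "triv1_inv j k ` (S2N \<times> sphere 0 1) \<subseteq> bundle_set j k \<inter> fst -` S2N"
  proof (intro image_subsetI)
    fix w :: "(complex \<times> real) \<times> fib" assume "w \<in> S2N \<times> sphere 0 1"
    then have "fst w \<in> S2N" "norm (snd w) = 1" by auto
    then show "triv1_inv j k w \<in> bundle_set j k \<inter> fst -` S2N"
      using triv1_inv_mem[of "fst w" "snd w"] triv1_triv1_inv(2)[of "fst w" j k "snd w"] by simp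
  qed
  fix w :: "(complex \<times> real) \<times> fib" assume "w \<in> S2N \<times> sphere 0 1"
  then show "triv1 j k (triv1_inv j k w) = w"
    using triv1_triv1_inv(1)[of "fst w" j k "snd w"] by (simp add: mem_Times_iff)
qed (use triv1_inverse(1) in blast)

lemma bounded_linear_flip_base: "bounded_linear flip_base"
proof -
  have "linear flip_base" by (rule linearI) (simp_all add: flip_base_def scaleR_conv_of_real)
  then show ?thesis by (simp add: linear_conv_bounded_linear)
qed

lemma bounded_linear_flip: "bounded_linear flip"
proof -
  have "linear flip" by (rule linearI) (simp_all add: flip_def flip_base_def scaleR_conv_of_real)
  then show ?thesis by (simp add: linear_conv_bounded_linear)
qed

lemma flip_bundle_set: "y \<in> bundle_set j k \<Longrightarrow> flip y \<in> bundle_set j k"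
  unfolding bundle_set_def by (clarsimp simp only: flip_emb mem_Collect_eq) (metis add.commute)

lemma flip_S2 [simp]: "flip_base x \<in> S2N \<longleftrightarrow> x \<in> S2S" "flip_base x \<in> S2S \<longleftrightarrow> x \<in> S2N"
  by (auto simp: S2N_def S2S_def flip_base_def norm_prod_def)

lemma fst_flip [simp]: "fst (flip y) = flip_base (fst y)"
  by (simp add: flip_def)

lemma ediff_triv2: "ediff (bundle_set j k \<inter> fst -` S2S) (S2S \<times> sphere 0 1) (triv2 j k) (triv2_inv j k)"
proof -
  have 1: "ediff (bundle_set j k \<inter> fst -` S2S) (bundle_set j k \<inter> fst -` S2N) flip flip"
    unfolding ediff_def
    by (intro conjI ballI image_subsetI smooth_on_subset_bounded_linear[OF bounded_linear_flip])
      (simp_all add: flip_bundle_set)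
  have "ediff S2N S2S flip_base flip_base"
    unfolding ediff_def
    by (intro conjI ballI image_subsetI smooth_on_subset_bounded_linear[OF bounded_linear_flip_base])
      simp_all
  moreover have "ediff (sphere 0 1) (sphere 0 1) (id :: fib \<Rightarrow> _) id"
    by (auto simp: ediff_def id_def intro: smooth_intros)
  ultimately have 2: "ediff (S2N \<times> sphere (0 :: fib) 1) (S2S \<times> sphere 0 1)
      (map_prod flip_base id) (map_prod flip_base id)"
    by (rule ediff_times)
  show ?thesis
    using ediff_trans[OF ediff_trans[OF 1 ediff_triv1] 2]
    unfolding triv2_def[abs_def] triv2_inv_def[abs_def] .
qed

lemma openin_S2: "openin (top_of_set (sphere 0 1)) S2N" "openin (top_of_set (sphere 0 1)) S2S"
  unfolding S2N_def S2S_def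
  by (auto intro!: openin_open_Int open_Collect_less continuous_intros)

lemma S2_cover: "S2N \<union> S2S = sphere 0 1"
  by (auto simp: S2N_def S2S_def)

lemma fst_triv [simp]: "fst (triv1 j k y) = fst y" "fst (triv2 j k y) = fst y"
  by (simp_all add: triv1_def triv2_def)

text \<open>The clutching function. The fibre coordinates are \<open>p\<close> rotated by a / |a|
  and by b / |b|, and their quotient depends on the base point alone because 2 a cnj b, the complex
  part of the Hopf image, has the phase of a / b.\<close>

lemma triv_transition:
  assumes "y \<in> bundle_set j k" "fst y \<in> S2N" "fst y \<in> S2S"
  shows "snd (triv2 j k y) = rot j k (cnj (fst (fst y)) / norm (fst (fst y))) (snd (triv1 j k y))"
    "fst (fst y) \<noteq> 0"
proof -
  obtain a b p where y: "y = emb j k a b p" "(norm a)\<^sup>2 + (norm b)\<^sup>2 = 1" "norm p = 1"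
    using assms(1) by (auto simp: bundle_set_def)
  have f: "fst y = hopf a b" by (simp add: y emb_def)
  have ba: "(norm b)\<^sup>2 + (norm a)\<^sup>2 = 1" using y(2) by simp
  have a: "a \<noteq> 0" using S2N_hopf[OF y(2)] f assms(2) by simp
  have "flip_base (hopf a b) \<in> S2N" using assms(3) f flip_S2 by simp
  then have b: "b \<noteq> 0" using S2N_hopf[OF ba] by (simp add: flip_base_hopf)
  have 1: "snd (triv1 j k y) = rot j k (a / norm a) p"
    unfolding y(1) by (simp add: triv1_emb[OF a y(2)])
  have 2: "snd (triv2 j k y) = rot j k (b / norm b) p"
    unfolding y(1) by (simp add: triv2_def flip_emb triv1_emb[OF b ba])
  have aa: "a * cnj a = of_real (norm a) * of_real (norm a)"
    by (simp add: complex_norm_square[symmetric] power2_eq_square)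
  have "cnj (fst (fst y)) / norm (fst (fst y)) * (a / norm a) = b / norm b"
    using a b aa by (simp add: f hopf_def norm_mult field_simps)
  then show "snd (triv2 j k y) = rot j k (cnj (fst (fst y)) / norm (fst (fst y))) (snd (triv1 j k y))"
    unfolding 1 2 rot_rot by simp
  show "fst (fst y) \<noteq> 0" using a b by (simp add: f hopf_def)
qed

lemma bundle_set_openin:
  assumes "openin (top_of_set (sphere 0 1)) U"
  shows "openin (top_of_set (bundle_set j k)) (bundle_set j k \<inter> fst -` U)"
  by (rule continuous_openin_preimage[OF _ _ assms]) (auto intro!: continuous_intros dest: bundle_set_fst)

lemma submfd_bundle_set: "submfd TYPE(real ^ 6) (bundle_set j k)"
proof (rule submfd_model[where 'e = "(real ^ 2) \<times> (real ^ 4)"])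
  have S: "submfd TYPE(real ^ 2) (sphere (0 :: complex \<times> real) 1)" "submfd TYPE(real ^ 4) (sphere (0 :: fib) 1)"
    by (auto intro!: submfd_sphere)
  show "submfd TYPE((real ^ 2) \<times> (real ^ 4)) (bundle_set j k)"
  proof (rule submfd_local)
    fix y assume y: "y \<in> bundle_set j k"
    have sm: "submfd TYPE((real ^ 2) \<times> (real ^ 4)) (U \<times> sphere (0 :: fib) 1)"
      if "openin (top_of_set (sphere 0 1)) U" for U :: "(complex \<times> real) set"
      by (rule submfd_times[OF submfd_open[OF S(1) that] S(2)])
    have "fst y \<in> S2N \<or> fst y \<in> S2S" using bundle_set_fst[OF y] S2_cover by blast
    then show "\<exists>U (S :: ((complex \<times> real) \<times> fib) set) f g. y \<in> U \<and>
      openin (top_of_set (bundle_set j k)) U \<and> submfd TYPE((real ^ 2) \<times> (real ^ 4)) S \<and> ediff U S f g"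
    proof
      assume "fst y \<in> S2N"
      then show ?thesis
        using y bundle_set_openin[OF openin_S2(1)] sm[OF openin_S2(1)] ediff_triv1[of j k]
        by (intro exI[of _ "bundle_set j k \<inter> fst -` S2N"] exI[of _ "S2N \<times> sphere 0 1"]
            exI[of _ "triv1 j k"] exI[of _ "triv1_inv j k"]) auto
    next
      assume "fst y \<in> S2S"
      then show ?thesis
        using y bundle_set_openin[OF openin_S2(2)] sm[OF openin_S2(2)] ediff_triv2[of j k]
        by (intro exI[of _ "bundle_set j k \<inter> fst -` S2S"] exI[of _ "S2S \<times> sphere 0 1"]
            exI[of _ "triv2 j k"] exI[of _ "triv2_inv j k"]) auto
    qed
  qed
qed simp

section \<open>Nontriviality\<close>

lemma orthogonal_transformation_eqI:
  fixes f g :: "'a::euclidean_space \<Rightarrow> 'b::real_vector"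
  assumes "linear f" "linear g" "\<And>v. norm v = 1 \<Longrightarrow> f v = g v"
  shows "f = g"
  by (rule linear_eq_stdbasis[OF assms(1,2)]) (use assms(3) in auto)

text \<open>The inverse is the transpose. In this form it visibly depends continuously on parameters
  whenever \<open>f\<close> does.\<close>

lemma orthogonal_transformation_inv_expand:
  fixes f :: "'a::euclidean_space \<Rightarrow> 'a"
  assumes "orthogonal_transformation f"
  shows "inv_into UNIV f w = (\<Sum>b\<in>Basis. (w \<bullet> f b) *\<^sub>R b)"
proof -
  have "inv_into UNIV f w \<bullet> b = w \<bullet> f b" for b
    using assms by (metis orthogonal_transformation_def orthogonal_transformation_surj surj_f_inv_f)
  then show ?thesis by (metis (no_types, lifting) euclidean_representation sum.cong)
qed

text \<open>Sphere bundle trivialisations give continuity at unit vectors only; homogeneity extends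
  it to all vectors.\<close>

lemma continuous_on_orthogonal_family:
  fixes f :: "'a::topological_space \<Rightarrow> 'b::euclidean_space \<Rightarrow> 'b"
  assumes "\<And>x. x \<in> K \<Longrightarrow> orthogonal_transformation (f x)"
    "\<And>v. norm v = 1 \<Longrightarrow> continuous_on K (\<lambda>x. f x v)"
  shows "continuous_on K (\<lambda>x. f x v)"
proof (cases "v = 0")
  case True
  have "f x v = 0" if "x \<in> K" for x
    using assms(1)[OF that] True by (simp add: orthogonal_transformation_linear linear_0)
  then show ?thesis by (simp cong: continuous_on_cong)
next
  case False
  then have "f x v = norm v *\<^sub>R f x (v /\<^sub>R norm v)" if "x \<in> K" for x
    using assms(1)[OF that] by (simp add: orthogonal_transformation_linear linear_scale)
  moreover have "continuous_on K (\<lambda>x. norm v *\<^sub>R f x (v /\<^sub>R norm v))"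
    by (intro continuous_intros assms(2)) (use False in simp)
  ultimately show ?thesis by (simp cong: continuous_on_cong)
qed

text \<open>\<open>\<tau>\<close> plays the fibre coordinate of a global trivialisation. Compared
  with the northern and southern ones it yields orthogonal families \<open>g\<close> and
  \<open>h\<close>, each defined on a whole closed hemisphere. On the equator they differ by the
  clutching function, so shrinking the equator to the poles would contract the clutching
  loop.\<close>

lemma bundle_set_nontrivial:
  fixes \<tau> :: "total \<Rightarrow> fib"
  assumes jk: "odd (j + k)" and cont: "continuous_on (bundle_set j k) \<tau>"
    and N: "\<And>x. x \<in> S2N \<Longrightarrow> \<exists>g. orthogonal_transformation g \<and>
      (\<forall>y\<in>bundle_set j k. fst y = x \<longrightarrow> \<tau> y = g (snd (triv1 j k y)))"
    and S: "\<And>x. x \<in> S2S \<Longrightarrow> \<exists>g. orthogonal_transformation g \<and>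
      (\<forall>y\<in>bundle_set j k. fst y = x \<longrightarrow> \<tau> y = g (snd (triv2 j k y)))"
  shows False
proof -
  obtain g where g: "\<And>x. x \<in> S2N \<Longrightarrow> orthogonal_transformation (g x)"
      "\<And>x y. x \<in> S2N \<Longrightarrow> y \<in> bundle_set j k \<Longrightarrow> fst y = x \<Longrightarrow> \<tau> y = g x (snd (triv1 j k y))"
    using N by metis
  obtain h where h: "\<And>x. x \<in> S2S \<Longrightarrow> orthogonal_transformation (h x)"
      "\<And>x y. x \<in> S2S \<Longrightarrow> y \<in> bundle_set j k \<Longrightarrow> fst y = x \<Longrightarrow> \<tau> y = h x (snd (triv2 j k y))"
    using S by metis
  note e1 = ediff_triv1[of j k, unfolded ediff_def] and e2 = ediff_triv2[of j k, unfolded ediff_def]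
  have m1: "triv1_inv j k (x, v) \<in> bundle_set j k" "fst (triv1_inv j k (x, v)) = x" "triv1 j k (triv1_inv j k (x, v)) = (x, v)"
    if "x \<in> S2N" "norm v = 1" for x v
    using that triv1_inv_mem triv1_triv1_inv by blast+
  have m2: "triv2_inv j k (x, v) \<in> bundle_set j k" "fst (triv2_inv j k (x, v)) = x" "triv2 j k (triv2_inv j k (x, v)) = (x, v)"
    if "x \<in> S2S" "norm v = 1" for x v
  proof -
    have "(x, v) \<in> S2S \<times> sphere 0 1" using that by simp
    then show "triv2_inv j k (x, v) \<in> bundle_set j k" "triv2 j k (triv2_inv j k (x, v)) = (x, v)" using e2 by blast+
    then show "fst (triv2_inv j k (x, v)) = x" by (metis fst_conv fst_triv(2))
  qed
  have geq: "g x v = \<tau> (triv1_inv j k (x, v))" if "x \<in> S2N" "norm v = 1" for x v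
    using g(2)[OF that(1) m1(1,2)[OF that]] m1(3)[OF that] by simp
  have heq: "h x v = \<tau> (triv2_inv j k (x, v))" if "x \<in> S2S" "norm v = 1" for x v
    using h(2)[OF that(1) m2(1,2)[OF that]] m2(3)[OF that] by simp
  have gh: "g x v = h x (rot j k (cnj (fst x) / norm (fst x)) v)" if x: "x \<in> S2N" "x \<in> S2S" and v: "norm v = 1" for x v
    using geq[OF x(1) v] m1[OF x(1) v] h(2)[OF x(2) m1(1,2)[OF x(1) v]] triv_transition[of "triv1_inv j k (x, v)" j k] x
    by simp
  let ?K = "{0..1::real} \<times> {0..2 * pi}"
  \<comment> \<open>Polar coordinates on the closed hemispheres: s = 0 is a pole for every angle,
    and s = 1 is the equator, where \<open>up\<close> and \<open>dn\<close> agree. The sign of the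
    angle undoes the conjugation in \<open>triv_transition\<close>.\<close>
  define up where "up p = (fst p *\<^sub>R cis (- snd p), sqrt (1 - (fst p)\<^sup>2))" for p :: "real \<times> real"
  define dn where "dn p = (fst p *\<^sub>R cis (- snd p), - sqrt (1 - (fst p)\<^sup>2))" for p :: "real \<times> real"
  have sq: "(fst p)\<^sup>2 \<le> 1" if "p \<in> ?K" for p using that by (auto simp: power_le_one)
  have up: "up p \<in> S2N" and dn: "dn p \<in> S2S" if "p \<in> ?K" for p
  proof -
    have "0 \<le> sqrt (1 - (fst p)\<^sup>2)" using sq[OF that] by simp
    then have "-1 < sqrt (1 - (fst p)\<^sup>2)" by linarith
    then show "up p \<in> S2N" "dn p \<in> S2S"
      using sq[OF that] by (simp_all add: up_def dn_def S2N_def S2S_def norm_prod_def)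
  qed
  have c: "continuous_on ?K up" "continuous_on ?K dn"
    unfolding up_def[abs_def] dn_def[abs_def]
    by (intro continuous_on_Pair continuous_on_scaleR continuous_on_cis continuous_on_minus
        continuous_on_real_sqrt continuous_on_diff continuous_on_power continuous_on_fst continuous_on_snd
        continuous_on_const continuous_on_id)+
  have cg: "continuous_on ?K (\<lambda>p. g (up p) v)" for v
  proof (rule continuous_on_orthogonal_family[of ?K "\<lambda>p. g (up p)" v])
    fix v :: "fib" assume v: "norm v = 1"
    have "continuous_on (S2N \<times> sphere 0 1) (triv1_inv j k)" using e1 by (intro smooth_on_subset_imp_continuous_on) simp
    moreover have "(\<lambda>p. (up p, v)) ` ?K \<subseteq> S2N \<times> sphere 0 1"
      using v by (intro image_subsetI SigmaI up) simp_all
    ultimately have "continuous_on ?K (\<lambda>p. triv1_inv j k (up p, v))"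
      using continuous_on_compose2[OF _ continuous_on_Pair[OF c(1) continuous_on_const]] by blast
    moreover have "(\<lambda>p. triv1_inv j k (up p, v)) ` ?K \<subseteq> bundle_set j k"
      by (intro image_subsetI m1(1) up v)
    ultimately have "continuous_on ?K (\<lambda>p. \<tau> (triv1_inv j k (up p, v)))"
      using continuous_on_compose2[OF cont] by blast
    then show "continuous_on ?K (\<lambda>p. g (up p) v)" using geq[OF up v] by (simp cong: continuous_on_cong)
  qed (use g(1) up in auto)
  have ch: "continuous_on ?K (\<lambda>p. h (dn p) v)" for v
  proof (rule continuous_on_orthogonal_family[of ?K "\<lambda>p. h (dn p)" v])
    fix v :: "fib" assume v: "norm v = 1"
    have "continuous_on (S2S \<times> sphere 0 1) (triv2_inv j k)" using e2 by (intro smooth_on_subset_imp_continuous_on) simp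
    moreover have "(\<lambda>p. (dn p, v)) ` ?K \<subseteq> S2S \<times> sphere 0 1"
      using v by (intro image_subsetI SigmaI dn) simp_all
    ultimately have "continuous_on ?K (\<lambda>p. triv2_inv j k (dn p, v))"
      using continuous_on_compose2[OF _ continuous_on_Pair[OF c(2) continuous_on_const]] by blast
    moreover have "(\<lambda>p. triv2_inv j k (dn p, v)) ` ?K \<subseteq> bundle_set j k"
      by (intro image_subsetI m2(1) dn v)
    ultimately have "continuous_on ?K (\<lambda>p. \<tau> (triv2_inv j k (dn p, v)))"
      using continuous_on_compose2[OF cont] by blast
    then show "continuous_on ?K (\<lambda>p. h (dn p) v)" using heq[OF dn v] by (simp cong: continuous_on_cong)
  qed (use h(1) dn in auto)
  \<comment> \<open>By \<open>gh\<close> this is the clutching loop at s = 1, and at s = 0 it does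
    not depend on the angle.\<close>
  define F where "F s \<theta> = inv_into UNIV (h (dn (s, \<theta>))) \<circ> g (up (s, \<theta>))" for s \<theta>
  show False
  proof (rule rot_loop_not_null_homotopic[OF jk, of F])
    fix v
    have "F (fst p) (snd p) v = (\<Sum>b\<in>Basis. (g (up p) v \<bullet> h (dn p) b) *\<^sub>R b)" if "p \<in> ?K" for p
      using orthogonal_transformation_inv_expand[OF h(1)[OF dn[OF that]]] by (simp add: F_def)
    moreover have "continuous_on ?K (\<lambda>p. (\<Sum>b\<in>Basis. (g (up p) v \<bullet> h (dn p) b) *\<^sub>R b))"
      by (intro continuous_intros cg ch)
    ultimately show "continuous_on ?K (\<lambda>p. F (fst p) (snd p) v)" by (simp cong: continuous_on_cong)
  next
    fix s \<theta> :: real assume "s \<in> {0..1}" "\<theta> \<in> {0..2 * pi}"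
    then have "(s, \<theta>) \<in> ?K" by simp
    then show "orthogonal_transformation (F s \<theta>)"
      unfolding F_def using g(1)[OF up] h(1)[OF dn]
      by (intro orthogonal_transformation_compose orthogonal_transformation_inv)
  next
    show "F 0 \<theta> = F 0 0" for \<theta> by (simp add: F_def up_def dn_def)
    show "F s (2 * pi) = F s 0" for s by (simp add: F_def up_def dn_def cis.ctr)
    fix \<theta> :: real assume "\<theta> \<in> {0..2 * pi}"
    then have K: "(1, \<theta>) \<in> ?K" by simp
    let ?x = "up (1, \<theta>)"
    have x: "dn (1, \<theta>) = ?x" "cnj (fst ?x) / norm (fst ?x) = cis \<theta>" by (simp_all add: up_def dn_def cis_cnj)
    then have xS: "?x \<in> S2N" "?x \<in> S2S" using up[OF K] dn[OF K] by simp_all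
    have "g ?x = (\<lambda>v. h ?x (rot j k (cis \<theta>) v))"
      using g(1)[OF xS(1)] orthogonal_transformation_compose[OF h(1)[OF xS(2)] orthogonal_rot[of "cis \<theta>" j k]] gh[OF xS]
      by (intro orthogonal_transformation_eqI) (auto simp: x(2) orthogonal_transformation_linear comp_def)
    moreover have "inj (h ?x)" using h(1)[OF xS(2)] orthogonal_transformation_inj by blast
    ultimately show "F 1 \<theta> = rot j k (cis \<theta>)" by (auto simp: F_def x(1))
  qed
qed


section \<open>The bundle on the set \<open>S\<^sup>2 \<times> S\<^sup>4\<close>\<close>

lemma exists_isometry:
  assumes "DIM('a::euclidean_space) = DIM('b::euclidean_space)"
  obtains f :: "'a::euclidean_space \<Rightarrow> 'b::euclidean_space" and g where "linear f" "linear g" "\<And>x. norm (f x) = norm x" "\<And>y. norm (g y) = norm y"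
    "\<And>x. g (f x) = x" "\<And>y. f (g y) = y"
proof -
  have "dim (UNIV :: 'a set) = dim (UNIV :: 'b set)" using assms by (simp add: dim_UNIV)
  from isometries_subspaces[OF subspace_UNIV subspace_UNIV this] that show thesis by (metis UNIV_I)
qed

lemma diffeomorphism_sym: "diffeomorphism M N f \<Longrightarrow> \<exists>g. diffeomorphism N M g"
  unfolding diffeomorphism_def by blast

text \<open>The isometries \<open>\<beta>\<close> and \<open>\<kappa>\<close> replace the complex
  coordinates of base and fibre by \<open>real ^ 3\<close> and \<open>real ^ 5\<close>. Conjugation
  with \<open>\<kappa>\<close> keeps transition maps orthogonal in both directions, so a compatible
  global trivialisation would pull back to the situation of
  \<open>bundle_set_nontrivial\<close>.\<close>

lemma exists_twisted_bundle:
  assumes jk: "odd (j + k)"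
  shows "\<exists>(E :: ((real ^ 3) \<times> (real ^ 5), real ^ 6) mfd) f. is_S4_twisted_S2 E \<and>
    diffeomorphism E (euclidean_submfd (bundle_set j k)) f"
proof -
  obtain \<beta> :: "complex \<times> real \<Rightarrow> real ^ 3" and \<beta>' where B: "linear \<beta>" "linear \<beta>'" "\<And>x. norm (\<beta> x) = norm x"
      "\<And>y. norm (\<beta>' y) = norm y" "\<And>x. \<beta>' (\<beta> x) = x" "\<And>y. \<beta> (\<beta>' y) = y"
    by (rule exists_isometry[where 'a = "complex \<times> real" and 'b = "real ^ 3"]) auto
  obtain \<kappa> :: "fib \<Rightarrow> real ^ 5" and \<kappa>' where P: "linear \<kappa>" "linear \<kappa>'" "\<And>x. norm (\<kappa> x) = norm x"
      "\<And>y. norm (\<kappa>' y) = norm y" "\<And>x. \<kappa>' (\<kappa> x) = x" "\<And>y. \<kappa> (\<kappa>' y) = y"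
    by (rule exists_isometry[where 'a = "fib" and 'b = "real ^ 5"]) auto
  let ?X = "bundle_set j k"
  let ?M = "euclidean_submfd ?X :: (_, real ^ 6) mfd"
  let ?S = "sphere (0 :: real ^ 3) 1"
  define \<Phi>1 where "\<Phi>1 = map_prod \<beta> \<kappa> \<circ> triv1 j k"
  define \<Phi>2 where "\<Phi>2 = map_prod \<beta> \<kappa> \<circ> triv2 j k"
  \<comment> \<open>\<open>\<iota>\<close> is discontinuous at the fibre that \<open>triv1\<close> misses; only its injectivity matters.\<close>
  define \<iota> where "\<iota> y = (if fst y \<in> S2N then \<Phi>1 y else \<Phi>2 y)" for y
  have fst\<Phi>: "fst (\<Phi>1 y) = \<beta> (fst y)" "fst (\<Phi>2 y) = \<beta> (fst y)" "fst (\<iota> y) = \<beta> (fst y)" for y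
    by (simp_all add: \<Phi>1_def \<Phi>2_def \<iota>_def fst_map_prod)
  have inj\<beta>: "\<beta> x = \<beta> y \<longleftrightarrow> x = y" for x y using B(5) by metis
  have inj\<kappa>: "map_prod \<beta> \<kappa> x = map_prod \<beta> \<kappa> y \<longleftrightarrow> x = y" for x y
    using B(5) P(5) by (metis prod.collapse map_prod_simp prod.inject)
  have S2: "x \<in> S2N \<or> x \<in> S2S" if "x \<in> sphere 0 1" for x using that S2_cover by blast
  have "inj_on \<iota> ?X"
  proof (rule inj_onI)
    fix x y assume x: "x \<in> ?X" and y: "y \<in> ?X" and eq: "\<iota> x = \<iota> y"
    have f: "fst x = fst y" using fst\<Phi>(3)[of x] fst\<Phi>(3)[of y] eq inj\<beta> by simp
    show "x = y"
    proof (cases "fst y \<in> S2N")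
      case True
      then have "triv1 j k x = triv1 j k y" using eq f by (simp add: \<iota>_def \<Phi>1_def inj\<kappa>)
      then show ?thesis using triv1_inverse(1)[OF x] triv1_inverse(1)[OF y] f True by metis
    next
      case False
      then have "triv2 j k x = triv2 j k y" "fst y \<in> S2S"
        using eq f S2[OF bundle_set_fst[OF y]] by (auto simp: \<iota>_def \<Phi>2_def inj\<kappa>)
      moreover have "triv2_inv j k (triv2 j k z) = z" if "z \<in> ?X" "fst z \<in> S2S" for z
        using ediff_triv2[of j k] that by (auto simp: ediff_def)
      ultimately show ?thesis using x y f by metis
    qed
  qed
  define Y where "Y = \<iota> ` ?X"
  define \<gamma> where "\<gamma> = inv_into ?X \<iota>"
  have "bij_betw \<iota> ?X Y" using \<open>inj_on \<iota> ?X\<close> by (simp add: bij_betw_def Y_def)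
  then have bij: "bij_betw \<gamma> Y ?X" "bij_betw \<iota> ?X Y" unfolding \<gamma>_def by (simp_all add: bij_betw_inv_into)
  have \<gamma>\<iota>: "\<gamma> (\<iota> y) = y" "\<iota> y \<in> Y" if "y \<in> ?X" for y
    using \<open>inj_on \<iota> ?X\<close> that by (simp_all add: \<gamma>_def Y_def)
  have \<gamma>X: "\<gamma> z \<in> ?X" if "z \<in> Y" for z using that bij(1) by (auto simp: bij_betw_def)
  define E where "E = transport Y \<gamma> ?M"
  have smX: "submfd TYPE(real ^ 6) ?X" by (rule submfd_bundle_set)
  have M: "smooth_manifold ?M" by (rule smooth_manifold_euclidean_submfd[OF smX])
  have bijM: "bij_betw \<gamma> Y (topspace (mtop ?M))" using bij(1) by simp
  have E: "smooth_manifold E" and dE: "diffeomorphism E ?M \<gamma>" and tE: "topspace (mtop E) = Y"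
    unfolding E_def using smooth_manifold_transport[OF bijM M] diffeomorphism_transport[OF bijM M]
      topspace_transport[OF bijM M] by auto
  define p where "p z = \<beta> (fst (\<gamma> z))" for z
  define T where "T = {(\<beta> ` S2N, \<Phi>1 \<circ> \<gamma>), (\<beta> ` S2S, \<Phi>2 \<circ> \<gamma>)}"
  have blB: "bounded_linear \<beta>" "bounded_linear \<beta>'" and blP: "bounded_linear \<kappa>" "bounded_linear \<kappa>'"
    using B P by (auto simp: linear_conv_bounded_linear)
  have pS: "p z \<in> ?S" if "z \<in> Y" for z
    using bundle_set_fst[OF \<gamma>X[OF that]] B(3) by (simp add: p_def)
  have "continuous_map (mtop E) (mtop ?M) \<gamma>" using dE by (simp add: diffeomorphism_def smooth_map_def)
  moreover have "continuous_on ?X (\<lambda>y. \<beta> (fst y))"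
    by (rule linear_continuous_on_compose[OF continuous_on_fst[OF continuous_on_id] B(1)])
  then have "continuous_map (mtop ?M) (top_of_set ?S) (\<lambda>y. \<beta> (fst y))"
    using bundle_set_fst[of _ j k] B(3) by (simp add: Pi_iff)
  ultimately have "continuous_map (mtop E) (top_of_set ?S) ((\<lambda>y. \<beta> (fst y)) \<circ> \<gamma>)"
    by (rule continuous_map_compose)
  moreover have "(\<lambda>y. \<beta> (fst y)) \<circ> \<gamma> = p" by (simp add: p_def fun_eq_iff)
  ultimately have cp: "continuous_map (mtop E) (top_of_set ?S) p" by simp
  have S2im: "\<beta> ` S2N \<union> \<beta> ` S2S = ?S"
  proof -
    have "\<beta> ` sphere 0 1 = ?S"
      using B by (auto simp: image_iff) (metis (no_types, opaque_lifting) B(4) mem_sphere_0)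
    then show ?thesis by (metis S2_cover image_Un)
  qed
  have op: "openin (top_of_set ?S) (\<beta> ` U)" if "openin (top_of_set (sphere 0 1)) U" for U
  proof -
    have "\<beta> ` U = ?S \<inter> \<beta>' -` U"
    proof (intro equalityI subsetI)
      fix x assume "x \<in> \<beta> ` U"
      then obtain u where "x = \<beta> u" "u \<in> U" by blast
      then show "x \<in> ?S \<inter> \<beta>' -` U" using B(3,5) openin_imp_subset[OF that] by auto
    next
      fix x assume "x \<in> ?S \<inter> \<beta>' -` U"
      then show "x \<in> \<beta> ` U" using B(6)[of x] by (intro image_eqI[of _ _ "\<beta>' x"]) auto
    qed
    moreover have "openin (top_of_set ?S) (?S \<inter> \<beta>' -` U)"
      by (rule continuous_openin_preimage[OF linear_continuous_on[OF blB(2)] _ that]) (use B(4) in auto)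
    ultimately show ?thesis by simp
  qed
  \<comment> \<open>The part of \<open>E\<close> over \<open>U\<close> is itself a transport of an
    open piece of the embedded bundle, so its trivialisation is \<open>\<gamma>\<close> followed by
    \<open>f\<close> and the two isometries.\<close>
  have triv: "diffeomorphism (open_submfd E (topspace (mtop E) \<inter> p -` (\<beta> ` U)))
      (euclidean_submfd ((\<beta> ` U) \<times> sphere 0 1)) ((map_prod \<beta> \<kappa> \<circ> f) \<circ> \<gamma>)"
    if U: "openin (top_of_set (sphere 0 1)) U" and f: "ediff (?X \<inter> fst -` U) (U \<times> sphere 0 1) f f'" for U f f'
  proof -
    let ?W = "?X \<inter> fst -` U"
    have "p z \<in> \<beta> ` U \<longleftrightarrow> fst (\<gamma> z) \<in> U" for z
      using inj\<beta> by (simp add: p_def inj_image_mem_iff inj_on_def)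
    then have Y: "topspace (mtop E) \<inter> p -` (\<beta> ` U) = Y \<inter> \<gamma> -` ?W"
      unfolding set_eq_iff Int_iff vimage_eq tE using \<gamma>X by blast
    have W: "openin (top_of_set ?X) ?W"
      by (rule bundle_set_openin[OF U])
    have eq: "open_submfd E (topspace (mtop E) \<inter> p -` (\<beta> ` U)) =
        transport (Y \<inter> \<gamma> -` ?W) \<gamma> (euclidean_submfd ?W)"
      unfolding Y by (simp only: E_def transport_open_submfd open_submfd_euclidean[OF W])
    have smW: "submfd TYPE(real ^ 6) ?W" by (rule submfd_open[OF smX W])
    have "bij_betw \<gamma> (Y \<inter> \<gamma> -` ?W) ?W"
    proof (rule bij_betw_subset[OF bij(1)])
      show "\<gamma> ` (Y \<inter> \<gamma> -` ?W) = ?W"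
      proof (intro equalityI subsetI)
        fix x assume "x \<in> ?W"
        then show "x \<in> \<gamma> ` (Y \<inter> \<gamma> -` ?W)" using \<gamma>\<iota>[of x] by (intro image_eqI[of _ _ "\<iota> x"]) simp_all
      qed blast
    qed blast
    then have 1: "diffeomorphism (transport (Y \<inter> \<gamma> -` ?W) \<gamma> (euclidean_submfd ?W :: (_, real ^ 6) mfd)) (euclidean_submfd ?W) \<gamma>"
      by (intro diffeomorphism_transport smooth_manifold_euclidean_submfd[OF smW]) simp
    have "ediff U (\<beta> ` U) \<beta> \<beta>'" "ediff (sphere 0 1) (sphere 0 1) \<kappa> \<kappa>'"
      using B P by (auto simp: ediff_def intro: smooth_on_subset_bounded_linear[OF blB(1)]
         smooth_on_subset_bounded_linear[OF blB(2)] smooth_on_subset_bounded_linear[OF blP(1)] smooth_on_subset_bounded_linear[OF blP(2)])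
    from ediff_trans[OF f ediff_times[OF this]]
    have 2: "ediff ?W ((\<beta> ` U) \<times> sphere 0 1) (map_prod \<beta> \<kappa> \<circ> f) (f' \<circ> map_prod \<beta>' \<kappa>')" by (simp add: comp_def)
    have "submfd TYPE((real ^ 2) \<times> (real ^ 4)) ((\<beta> ` U) \<times> sphere (0 :: real ^ 5) 1)"
      by (intro submfd_times submfd_open[OF _ op[OF U]] submfd_sphere) auto
    then have "submfd TYPE(real ^ 6) ((\<beta> ` U) \<times> sphere (0 :: real ^ 5) 1)"
      by (rule submfd_model) simp
    then show ?thesis
      unfolding eq using diffeomorphism_compose[OF 1 ediff_imp_diffeomorphism[OF smW _ 2]] by blast
  qed
  have orth: "orthogonal_transformation (\<lambda>v. \<kappa> (g (\<kappa>' v)))" if g: "orthogonal_transformation g" for g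
    unfolding orthogonal_transformation
  proof (intro conjI allI)
    have "linear g" using g by (rule orthogonal_transformation_linear)
    from linear_compose[OF linear_compose[OF P(2) this] P(1)]
    show "linear (\<lambda>v. \<kappa> (g (\<kappa>' v)))" by (simp add: comp_def)
    show "norm (\<kappa> (g (\<kappa>' v))) = norm v" for v
      using orthogonal_transformation_norm[OF g] by (simp only: P(3,4))
  qed
  have orth': "orthogonal_transformation (\<lambda>v. \<kappa>' (g (\<kappa> v)))" if g: "orthogonal_transformation g" for g
    unfolding orthogonal_transformation
  proof (intro conjI allI)
    have "linear g" using g by (rule orthogonal_transformation_linear)
    from linear_compose[OF linear_compose[OF P(1) this] P(2)]
    show "linear (\<lambda>v. \<kappa>' (g (\<kappa> v)))" by (simp add: comp_def)
    show "norm (\<kappa>' (g (\<kappa> v))) = norm v" for v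
      using orthogonal_transformation_norm[OF g] by (simp only: P(3,4))
  qed
  \<comment> \<open>Both directions are recorded because the compatibility condition runs over
    ordered pairs from \<open>T\<close>.\<close>
  have trans12: "\<exists>g g'. orthogonal_transformation g \<and> orthogonal_transformation g' \<and> (\<forall>z\<in>Y. p z = x \<longrightarrow>
      snd (\<Phi>2 (\<gamma> z)) = g (snd (\<Phi>1 (\<gamma> z))) \<and> snd (\<Phi>1 (\<gamma> z)) = g' (snd (\<Phi>2 (\<gamma> z))))"
    if xN: "x \<in> \<beta> ` S2N" and xS: "x \<in> \<beta> ` S2S" for x
  proof -
    obtain x' where x1: "x = \<beta> x'" "x' \<in> S2N" using xN by blast
    have "inj \<beta>" using inj\<beta> by (simp add: inj_on_def)
    then have "x' \<in> S2S" using xS x1(1) inj_image_mem_iff by metis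
    note x' = x1 this
    define z0 where "z0 = cnj (fst x') / norm (fst x')"
    have "x' \<in> sphere 0 1" using x'(2) by (simp add: S2N_def)
    \<comment> \<open>The vector (1, 0, 0) just supplies some point over \<open>x'\<close>; applied
      to it, \<open>triv_transition\<close> shows that the phase of \<open>fst x'\<close> is
      defined.\<close>
    then have "triv1_inv j k (x', (1, 0, 0)) \<in> ?X" "fst (triv1_inv j k (x', (1, 0, 0))) = x'"
      using triv1_inv_mem[OF x'(2)] triv1_triv1_inv[OF x'(2)] by (auto simp: norm_Pair)
    then have "fst x' \<noteq> 0" using triv_transition(2) x' by metis
    then have "norm z0 = 1" by (simp add: z0_def norm_divide)
    moreover from this have "z0 \<noteq> 0" by auto
    ultimately have z: "norm z0 = 1" "inverse z0 * z0 = 1" by simp_all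
    then have z': "norm (inverse z0) = 1" by (metis norm_inverse inverse_1)
    have "snd (\<Phi>2 (\<gamma> y)) = \<kappa> (rot j k z0 (\<kappa>' (snd (\<Phi>1 (\<gamma> y))))) \<and>
        snd (\<Phi>1 (\<gamma> y)) = \<kappa> (rot j k (inverse z0) (\<kappa>' (snd (\<Phi>2 (\<gamma> y)))))" if y: "y \<in> Y" "p y = x" for y
    proof -
      have "fst (\<gamma> y) = x'" using y x' inj\<beta> by (simp add: p_def)
      then have "snd (triv2 j k (\<gamma> y)) = rot j k z0 (snd (triv1 j k (\<gamma> y)))"
        using triv_transition(1)[OF \<gamma>X[OF y(1)]] x' by (simp add: z0_def)
      then show ?thesis
        by (simp add: \<Phi>1_def \<Phi>2_def snd_map_prod P(5) rot_rot z del: divide_inverse)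
    qed
    then show ?thesis using orth[OF orthogonal_rot[OF z(1)]] orth[OF orthogonal_rot[OF z']] by blast
  qed
  have idorth: "orthogonal_transformation (\<lambda>v :: real ^ 5. v)" by (simp add: orthogonal_transformation_id)
  have lin: "linear_sphere_bundle ?S E p T"
    unfolding linear_sphere_bundle_def
  proof (intro conjI E cp)
    show "(\<Union>(U, \<Phi>)\<in>T. U) = ?S" using S2im by (simp add: T_def)
    show "\<forall>(U, \<Phi>)\<in>T. openin (top_of_set ?S) U \<and>
        diffeomorphism (open_submfd E (topspace (mtop E) \<inter> p -` U)) (euclidean_submfd (U \<times> sphere 0 1)) \<Phi> \<and>
        (\<forall>y\<in>topspace (mtop E) \<inter> p -` U. fst (\<Phi> y) = p y)"
      using op openin_S2 triv[OF openin_S2(1) ediff_triv1] triv[OF openin_S2(2) ediff_triv2] fst\<Phi>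
      by (simp add: T_def p_def \<Phi>1_def[symmetric] \<Phi>2_def[symmetric])
    show "\<forall>(U, \<Phi>)\<in>T. \<forall>(V, \<Psi>)\<in>T. \<forall>x\<in>U \<inter> V. \<exists>g. orthogonal_transformation g \<and>
        (\<forall>y\<in>topspace (mtop E) \<inter> p -` {x}. snd (\<Psi> y) = g (snd (\<Phi> y)))"
    proof (intro ballI, clarify)
      fix U \<Phi> V \<Psi> x assume T: "(U, \<Phi>) \<in> T" "(V, \<Psi>) \<in> T" and x: "x \<in> U" "x \<in> V"
      show "\<exists>g. orthogonal_transformation g \<and>
        (\<forall>y\<in>topspace (mtop E) \<inter> p -` {x}. snd (\<Psi> y) = g (snd (\<Phi> y)))"
      proof (cases "\<Phi> = \<Psi>")
        case True
        then show ?thesis using idorth by blast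
      next
        case False
        then have x': "x \<in> \<beta> ` S2N" "x \<in> \<beta> ` S2S" and
          or: "\<Phi> = \<Phi>1 \<circ> \<gamma> \<and> \<Psi> = \<Phi>2 \<circ> \<gamma> \<or> \<Phi> = \<Phi>2 \<circ> \<gamma> \<and> \<Psi> = \<Phi>1 \<circ> \<gamma>" using T x by (auto simp: T_def)
        obtain g g' where "orthogonal_transformation g" "orthogonal_transformation g'" "\<forall>z\<in>Y. p z = x \<longrightarrow>
            snd (\<Phi>2 (\<gamma> z)) = g (snd (\<Phi>1 (\<gamma> z))) \<and> snd (\<Phi>1 (\<gamma> z)) = g' (snd (\<Phi>2 (\<gamma> z)))"
          using trans12[OF x'] by blast
        note gg = this
        from or show ?thesis
        proof
          assume "\<Phi> = \<Phi>1 \<circ> \<gamma> \<and> \<Psi> = \<Phi>2 \<circ> \<gamma>"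
          then have eq: "\<Phi> y = \<Phi>1 (\<gamma> y)" "\<Psi> y = \<Phi>2 (\<gamma> y)" for y by simp_all
          show ?thesis
          proof (intro exI[of _ g] conjI ballI gg(1))
            fix y assume "y \<in> topspace (mtop E) \<inter> p -` {x}"
            then have "y \<in> Y" "p y = x" by (simp_all add: tE)
            then show "snd (\<Psi> y) = g (snd (\<Phi> y))" unfolding eq using gg(3) by blast
          qed
        next
          assume "\<Phi> = \<Phi>2 \<circ> \<gamma> \<and> \<Psi> = \<Phi>1 \<circ> \<gamma>"
          then have eq: "\<Phi> y = \<Phi>2 (\<gamma> y)" "\<Psi> y = \<Phi>1 (\<gamma> y)" for y by simp_all
          show ?thesis
          proof (intro exI[of _ g'] conjI ballI gg(2))
            fix y assume "y \<in> topspace (mtop E) \<inter> p -` {x}"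
            then have "y \<in> Y" "p y = x" by (simp_all add: tE)
            then show "snd (\<Psi> y) = g' (snd (\<Phi> y))" unfolding eq using gg(3) by blast
          qed
        qed
      qed
    qed
  qed
  have nontriv: "\<not> linear_sphere_bundle ?S E p (insert (?S, \<Psi>) T)" for \<Psi> :: "(real ^ 3) \<times> (real ^ 5) \<Rightarrow> (real ^ 3) \<times> (real ^ 5)"
  proof
    assume triv: "linear_sphere_bundle ?S E p (insert (?S, \<Psi>) T)"
    note L = triv[unfolded linear_sphere_bundle_def, THEN conjunct2, THEN conjunct2, THEN conjunct2]
    have "topspace (mtop E) \<inter> p -` ?S = Y" unfolding tE
    proof (intro equalityI subsetI)
      fix z assume "z \<in> Y" then show "z \<in> Y \<inter> p -` ?S" using pS[of z] by (intro IntI vimageI2)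
    qed (erule IntD1)
    then have "diffeomorphism (open_submfd E Y) (euclidean_submfd (?S \<times> sphere 0 1) :: (_, real ^ 6) mfd) \<Psi>"
      using bspec[OF conjunct1[OF L] insertI1] by (simp only: split conj_assoc)
    then have "continuous_map (subtopology (mtop E) Y) (top_of_set (?S \<times> sphere 0 1)) \<Psi>"
      by (simp add: diffeomorphism_def smooth_map_def open_submfd_def)
    then have c\<Psi>: "continuous_map (mtop E) (top_of_set (?S \<times> sphere 0 1)) \<Psi>"
      using tE by (metis subtopology_topspace)
    obtain \<delta> where \<delta>: "continuous_map (mtop ?M) (mtop E) \<delta>" "\<And>z. z \<in> Y \<Longrightarrow> \<delta> (\<gamma> z) = z"
      using dE tE by (auto simp: diffeomorphism_def smooth_map_def)
    \<comment> \<open>\<open>\<delta>\<close> is a continuous inverse of \<open>\<gamma>\<close>, so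
      the fibre coordinate of \<open>\<Psi>\<close> becomes a continuous function on the embedded
      bundle.\<close>
    define \<tau> where "\<tau> y = \<kappa>' (snd (\<Psi> (\<delta> y)))" for y
    have "continuous_on ?X (\<Psi> \<circ> \<delta>)"
      using continuous_map_compose[OF \<delta>(1) c\<Psi>] by simp
    then have "continuous_on ?X \<tau>"
      unfolding \<tau>_def comp_def by (intro linear_continuous_on_compose[OF _ P(2)] continuous_on_snd)
    then show False
    proof (rule bundle_set_nontrivial[OF jk])
      have *: "\<exists>g. orthogonal_transformation g \<and> (\<forall>y\<in>?X. fst y = x \<longrightarrow> \<tau> y = g (\<kappa>' (snd (\<Phi> y))))"
        if "(\<beta> ` U, \<Phi> \<circ> \<gamma>) \<in> T" "x \<in> U" "x \<in> S2N \<union> S2S" for U \<Phi> x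
      proof -
        have "\<beta> x \<in> \<beta> ` U \<inter> ?S" using that(2,3) B(3) by (simp add: S2_cover)
        moreover have "(\<beta> ` U, \<Phi> \<circ> \<gamma>) \<in> insert (?S, \<Psi>) T" "(?S, \<Psi>) \<in> insert (?S, \<Psi>) T" using that(1) by simp_all
        ultimately have "\<exists>g. orthogonal_transformation g \<and>
           (\<forall>y\<in>topspace (mtop E) \<inter> p -` {\<beta> x}. snd (\<Psi> y) = g (snd ((\<Phi> \<circ> \<gamma>) y)))"
          using bspec[OF bspec[OF conjunct2[OF L], unfolded split_beta], unfolded split_beta, of "(\<beta> ` U, \<Phi> \<circ> \<gamma>)" "(?S, \<Psi>)"]
          unfolding fst_conv snd_conv by blast
        then obtain g where g: "orthogonal_transformation g"
           "\<forall>y\<in>topspace (mtop E) \<inter> p -` {\<beta> x}. snd (\<Psi> y) = g (snd ((\<Phi> \<circ> \<gamma>) y))" by blast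
        have "\<tau> y = \<kappa>' (g (\<kappa> (\<kappa>' (snd (\<Phi> y)))))" if y: "y \<in> ?X" "fst y = x" for y
        proof -
          have "\<iota> y \<in> topspace (mtop E) \<inter> p -` {\<beta> x}" using y \<gamma>\<iota> by (simp add: tE p_def)
          then show ?thesis using g(2) y \<gamma>\<iota> \<delta>(2)[of "\<iota> y"] by (simp add: \<tau>_def P(6))
        qed
        then show ?thesis using orth'[OF g(1)] by blast
      qed
      have k: "\<kappa>' (snd (\<Phi>1 y)) = snd (triv1 j k y)" "\<kappa>' (snd (\<Phi>2 y)) = snd (triv2 j k y)" for y
        by (simp_all add: \<Phi>1_def \<Phi>2_def snd_map_prod P(5))
      show "\<exists>g. orthogonal_transformation g \<and> (\<forall>y\<in>?X. fst y = x \<longrightarrow> \<tau> y = g (snd (triv1 j k y)))" if "x \<in> S2N" for x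
        using *[of S2N \<Phi>1 x] that by (simp add: T_def k)
      show "\<exists>g. orthogonal_transformation g \<and> (\<forall>y\<in>?X. fst y = x \<longrightarrow> \<tau> y = g (snd (triv2 j k y)))" if "x \<in> S2S" for x
        using *[of S2S \<Phi>2 x] that by (simp add: T_def k)
    qed
  qed
  have "is_S4_twisted_S2 E"
    unfolding is_S4_twisted_S2_def nontrivial_linear_sphere_bundle_def using lin nontriv by blast
  then show ?thesis using dE by blast
qed

section \<open>The manifold \<open>Sp(2) \<times> Sp(1)\<close>\<close>

lemma DIM_quat: "DIM(quat) = 4"
  by (simp add: Basis_quat_def)

lemma qcnj_mult_self: "qcnj x * x = (norm x)\<^sup>2 *\<^sub>R 1" "x * qcnj x = (norm x)\<^sup>2 *\<^sub>R 1"
  by (simp_all add: power2_norm_eq_inner inner_quat_def quat_defs)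

lemma norm_qcnj [simp]: "norm (qcnj x) = norm x"
  by (simp add: norm_quat_def inner_quat_def qcnj_def)

lemma bounded_linear_qcnj: "bounded_linear qcnj"
  unfolding linear_conv_bounded_linear[symmetric] by (rule linearI) (simp_all add: quat_defs)

lemma qcnj_scaleR [simp]: "qcnj (r *\<^sub>R x) = r *\<^sub>R qcnj x"
  by (simp add: quat_defs)

lemma qcnj_minus [simp]: "qcnj (- x) = - qcnj x"
  by (simp add: quat_defs)

definition qm :: "quat \<Rightarrow> quat \<Rightarrow> quat \<Rightarrow> quat \<Rightarrow> quat ^ 2 ^ 2" where
  "qm a b c d = vector [vector [a, b], vector [c, d]]"

lemma qm_nth [simp]: "qm a b c d $ 1 $ 1 = a" "qm a b c d $ 1 $ 2 = b" "qm a b c d $ 2 $ 1 = c" "qm a b c d $ 2 $ 2 = d"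
  by (simp_all add: qm_def)

text \<open>The two off-diagonal entries of each of the products with the adjoint are conjugate to
  one another, so one orthogonality relation for the rows and one for the columns suffice.\<close>

lemma Sp_iff: "(A :: quat ^ 2 ^ 2) \<in> carrier Sp \<longleftrightarrow>
    (norm (A $ 1 $ 1))\<^sup>2 + (norm (A $ 1 $ 2))\<^sup>2 = 1 \<and> (norm (A $ 2 $ 1))\<^sup>2 + (norm (A $ 2 $ 2))\<^sup>2 = 1 \<and>
    (norm (A $ 1 $ 1))\<^sup>2 + (norm (A $ 2 $ 1))\<^sup>2 = 1 \<and> (norm (A $ 1 $ 2))\<^sup>2 + (norm (A $ 2 $ 2))\<^sup>2 = 1 \<and>
    A $ 2 $ 1 * qcnj (A $ 1 $ 1) + A $ 2 $ 2 * qcnj (A $ 1 $ 2) = 0 \<and>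
    qcnj (A $ 1 $ 1) * A $ 1 $ 2 + qcnj (A $ 2 $ 1) * A $ 2 $ 2 = 0"
proof -
  have s: "r *\<^sub>R 1 + s *\<^sub>R 1 = (1 :: quat) \<longleftrightarrow> r + s = 1" for r s :: real by (simp add: quat_defs)
  have c: "qcnj x * y + qcnj z * w = 0 \<longleftrightarrow> qcnj y * x + qcnj w * z = 0"
    "x * qcnj y + z * qcnj w = 0 \<longleftrightarrow> y * qcnj x + w * qcnj z = 0" for x y z w
    by (metis qcnj_0 qcnj_add qcnj_mult qcnj_qcnj)+
  let ?a = "A $ 1 $ 1" and ?b = "A $ 1 $ 2" and ?c = "A $ 2 $ 1" and ?d = "A $ 2 $ 2"
  have "A \<in> carrier Sp \<longleftrightarrow> A ** qadjoint A = mat 1 \<and> qadjoint A ** A = mat 1" by (simp add: Sp_def)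
  also have "\<dots> \<longleftrightarrow> ((norm ?a)\<^sup>2 + (norm ?b)\<^sup>2 = 1 \<and> ?a * qcnj ?c + ?b * qcnj ?d = 0 \<and>
      ?c * qcnj ?a + ?d * qcnj ?b = 0 \<and> (norm ?c)\<^sup>2 + (norm ?d)\<^sup>2 = 1) \<and>
      ((norm ?a)\<^sup>2 + (norm ?c)\<^sup>2 = 1 \<and> qcnj ?a * ?b + qcnj ?c * ?d = 0 \<and>
      qcnj ?b * ?a + qcnj ?d * ?c = 0 \<and> (norm ?b)\<^sup>2 + (norm ?d)\<^sup>2 = 1)"
    by (simp add: qmat_eq_iff qmat_mult_nth qadjoint_def mat_def qcnj_mult_self s)
  finally show ?thesis using c(2)[of ?a ?c ?b ?d] c(1)[of ?a ?b ?c ?d] by blast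
qed

lemma smooth_norm [smooth_intros]:
  "smooth_on_subset U f \<Longrightarrow> (\<And>x. x \<in> U \<Longrightarrow> f x \<noteq> 0) \<Longrightarrow> smooth_on_subset U (\<lambda>x. norm (f x))"
  unfolding norm_eq_sqrt_inner by (intro smooth_intros) auto

lemma smooth_qm [smooth_intros]:
  assumes "smooth_on_subset U a" "smooth_on_subset U b" "smooth_on_subset U c" "smooth_on_subset U d"
  shows "smooth_on_subset U (\<lambda>x. qm (a x) (b x) (c x) (d x))"
proof -
  let ?L = "\<lambda>p. qm (fst (fst p)) (snd (fst p)) (fst (snd p)) (snd (snd p))"
  have "linear ?L" by (rule linearI) (simp_all add: qmat_eq_iff)
  then have "bounded_linear ?L" by (simp add: linear_conv_bounded_linear)
  from smooth_on_subset_linear_compose[OF this smooth_on_subset_Pair[OF smooth_on_subset_Pair[OF assms(1,2)]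
    smooth_on_subset_Pair[OF assms(3,4)]]] show ?thesis by simp
qed

lemma smooth_entry [smooth_intros]:
  fixes f :: "'a::euclidean_space \<Rightarrow> quat ^ 2 ^ 2"
  shows "smooth_on_subset U f \<Longrightarrow> smooth_on_subset U (\<lambda>x. f x $ i $ j)"
  by (rule smooth_on_subset_linear_compose[where L = "\<lambda>A. A $ i $ j"])
    (rule bounded_linear_compose[OF bounded_linear_vec_nth bounded_linear_vec_nth])

lemmas [smooth_intros] = smooth_on_subset_linear_compose[OF bounded_linear_qcnj]

text \<open>Where the corner a of the matrix with rows (a, b) and (c, d) is nonzero, orthogonality
  of the rows gives c = - d \<open>qcnj b\<close> a / |a|^2, and |d| = |a| holds. So the first row
  in S^7 and d / |a| in S^3 are coordinates.\<close>

lemma submfd_Sp: "submfd TYPE((real ^ 7) \<times> (real ^ 3)) (carrier (Sp :: (quat ^ 2 ^ 2) monoid))"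
proof -
  let ?S = "carrier (Sp :: (quat ^ 2 ^ 2) monoid)"
  let ?U = "\<lambda>j. ?S \<inter> {A. A $ 1 $ j \<noteq> 0}"
  let ?V = "(sphere 0 1 \<inter> {p :: quat \<times> quat. fst p \<noteq> 0}) \<times> sphere (0 :: quat) 1"
  define f where "f A = ((A $ 1 $ 1, A $ 1 $ 2), (1 / norm (A $ 1 $ 1)) *\<^sub>R A $ 2 $ 2)" for A :: "quat ^ 2 ^ 2"
  define g where "g w = qm (fst (fst w)) (snd (fst w))
     (- (1 / norm (fst (fst w))) *\<^sub>R (snd w * qcnj (snd (fst w)) * fst (fst w))) (norm (fst (fst w)) *\<^sub>R snd w)"
    for w :: "(quat \<times> quat) \<times> quat"
  have fg: "ediff (?U 1) ?V f g"
    unfolding ediff_def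
  proof (intro conjI ballI image_subsetI)
    show "smooth_on_subset (?U 1) f" unfolding f_def by (intro smooth_intros) auto
    show "smooth_on_subset ?V g" unfolding g_def by (intro smooth_intros) auto
  next
    fix A assume A: "A \<in> ?U 1"
    then have a: "A $ 1 $ 1 \<noteq> 0" and S: "A \<in> ?S" by auto
    note S = S[unfolded Sp_iff]
    have "(norm (A $ 2 $ 2))\<^sup>2 = (norm (A $ 1 $ 1))\<^sup>2" using S by linarith
    then have d: "norm (A $ 2 $ 2) = norm (A $ 1 $ 1)" by (simp add: power2_eq_iff_nonneg)
    then show "f A \<in> ?V" using a S by (simp add: f_def norm_Pair)
    have "A $ 2 $ 1 * qcnj (A $ 1 $ 1) = - (A $ 2 $ 2 * qcnj (A $ 1 $ 2))" using S by (simp add: add_eq_0_iff2)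
    then have "A $ 2 $ 1 * (qcnj (A $ 1 $ 1) * A $ 1 $ 1) = - (A $ 2 $ 2 * qcnj (A $ 1 $ 2) * A $ 1 $ 1)"
      by (simp add: mult.assoc[symmetric])
    then have "(norm (A $ 1 $ 1))\<^sup>2 *\<^sub>R A $ 2 $ 1 = - (A $ 2 $ 2 * qcnj (A $ 1 $ 2) * A $ 1 $ 1)"
      by (simp add: qcnj_mult_self)
    then have "A $ 2 $ 1 = (1 / (norm (A $ 1 $ 1))\<^sup>2) *\<^sub>R (- (A $ 2 $ 2 * qcnj (A $ 1 $ 2) * A $ 1 $ 1))"
      using a by (metis (no_types, lifting) divide_self_if norm_eq_zero power_not_zero scaleR_one scaleR_scaleR times_divide_eq_left mult_1)
    then show "g (f A) = A"
      using a by (simp add: g_def f_def qmat_eq_iff power2_eq_square)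
  next
    fix w assume w: "w \<in> ?V"
    obtain a b q where w': "w = ((a, b), q)" by (cases w) auto
    have a: "a \<noteq> 0" and q: "norm q = 1" and ab: "(norm a)\<^sup>2 + (norm b)\<^sup>2 = 1"
      using w by (auto simp: w' norm_Pair)
    have qq: "qcnj q * q = 1" using q by (simp add: qcnj_mult_self)
    have "- (1 / norm a) *\<^sub>R (q * qcnj b * a) * qcnj a = - (norm a *\<^sub>R (q * qcnj b))"
      using a by (simp add: mult.assoc qcnj_mult_self power2_eq_square)
    moreover have "qcnj (- (1 / norm a) *\<^sub>R (q * qcnj b * a)) * (norm a *\<^sub>R q) = - (qcnj a * b)"
      using a by (simp add: qcnj_mult mult.assoc qq)
    ultimately have "g w \<in> ?S"
      using a q ab unfolding Sp_iff by (simp add: g_def w' norm_mult power_mult_distrib)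
    then show "g w \<in> ?U 1" using a by (simp add: g_def w')
    show "f (g w) = w" using a by (simp add: f_def g_def w')
  qed
  \<comment> \<open>Exchanging the columns moves a nonzero \<open>A $ 1 $ 2\<close> into the
    corner.\<close>
  define sw where "sw A = qm (A $ 1 $ 2) (A $ 1 $ 1) (A $ 2 $ 2) (A $ 2 $ 1)" for A :: "quat ^ 2 ^ 2"
  have sw: "sw (sw A) = A" for A by (simp add: sw_def qmat_eq_iff)
  have swS: "sw A \<in> ?S" if "A \<in> ?S" for A
  proof -
    note S = that[unfolded Sp_iff]
    have "qcnj (qcnj (A $ 1 $ 1) * A $ 1 $ 2 + qcnj (A $ 2 $ 1) * A $ 2 $ 2) = qcnj 0" using S by metis
    then have "qcnj (A $ 1 $ 2) * A $ 1 $ 1 + qcnj (A $ 2 $ 2) * A $ 2 $ 1 = 0"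
      by (simp add: qcnj_add qcnj_mult)
    then show ?thesis unfolding Sp_iff sw_def qm_nth using S by (simp add: add.commute)
  qed
  have "ediff (?U 2) (?U 1) sw sw"
    unfolding ediff_def
  proof (intro conjI ballI image_subsetI)
    show "smooth_on_subset (?U 2) sw" "smooth_on_subset (?U 1) sw"
      unfolding sw_def by (intro smooth_intros)+
  qed (use swS sw in \<open>auto simp: sw_def\<close>)
  from ediff_trans[OF this fg] have fg2: "ediff (?U 2) ?V (\<lambda>A. f (sw A)) (\<lambda>w. sw (g w))" .
  have op: "openin (top_of_set ?S) (?U j)" for j
  proof -
    have "open {A :: quat ^ 2 ^ 2. A $ 1 $ j \<noteq> 0}"
      by (intro open_Collect_neq continuous_intros)
    then show ?thesis by (rule openin_open_Int)
  qed
  have "openin (top_of_set (sphere 0 1)) (sphere 0 1 \<inter> {p :: quat \<times> quat. fst p \<noteq> 0})"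
    by (intro openin_open_Int open_Collect_neq continuous_intros)
  then have V: "submfd TYPE((real ^ 7) \<times> (real ^ 3)) ?V"
    by (intro submfd_times submfd_open[OF submfd_sphere] submfd_sphere) (auto simp: DIM_quat)
  show ?thesis
  proof (rule submfd_local)
    fix A assume A: "A \<in> ?S"
    then have "A $ 1 $ 1 \<noteq> 0 \<or> A $ 1 $ 2 \<noteq> 0" by (auto simp: Sp_iff)
    then show "\<exists>U (S :: ((quat \<times> quat) \<times> quat) set) f g. A \<in> U \<and>
      openin (top_of_set ?S) U \<and> submfd TYPE((real ^ 7) \<times> (real ^ 3)) S \<and> ediff U S f g"
    proof
      assume "A $ 1 $ 1 \<noteq> 0"
      then show ?thesis using A op[of 1] V fg
        by (intro exI[of _ "?U 1"] exI[of _ ?V] exI[of _ f] exI[of _ g]) simp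
    next
      assume "A $ 1 $ 2 \<noteq> 0"
      then show ?thesis using A op[of 2] V fg2
        by (intro exI[of _ "?U 2"] exI[of _ ?V] exI[of _ "\<lambda>A. f (sw A)"] exI[of _ "\<lambda>w. sw (g w)"]) simp
    qed
  qed
qed

lemma carrier_GG: "carrier GG = carrier Sp \<times> sphere 0 1"
  by (auto simp: GG_def Sp1_def)

lemma submfd_GG: "submfd TYPE(real ^ 13) (carrier GG)"
proof (rule submfd_model)
  show "submfd TYPE(((real ^ 7) \<times> (real ^ 3)) \<times> (real ^ 3)) (carrier GG)"
    unfolding carrier_GG by (intro submfd_times submfd_Sp submfd_sphere) (simp add: DIM_quat)
qed simp


section \<open>The action and its invariants\<close>

abbreviation "qc \<equiv> quat_of_complex"

lemma GG_mult: "(A, r) \<otimes>\<^bsub>GG\<^esub> (B, s) = (A ** B, r * s)" "\<one>\<^bsub>GG\<^esub> = (mat 1, 1)"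
  by (simp_all add: GG_def Sp_def Sp1_def)

lemma action_eq:
  assumes "norm p = 1" "norm q = 1" "norm z = 1" "(A, r) \<in> carrier GG"
  shows "biquotient_action GG (ff l m n) (p, q, qc z) (A, r) =
    (diag2 p q ** A ** diag2 (qc (z powi (- m))) (qc (z powi (- n))), r * qc (z powi (- l)))"
proof -
  have z: "z \<noteq> 0" using assms(3) by auto
  have d1: "diag2 1 1 = (mat 1 :: quat ^ 2 ^ 2)" by (simp add: diag2_def qmat_eq_iff mat_def)
  have zz: "qc (z powi (- i)) * qc (z powi i) = 1" for i
    using z by (simp add: quat_of_complex_mult[symmetric] power_int_minus)
  have n: "norm (z powi i) = 1" for i using assms(3) by (simp add: norm_power_int)
  have "inv\<^bsub>GG\<^esub> (diag2 (qc (z powi m)) (qc (z powi n)), qc (z powi l)) =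
      (diag2 (qc (z powi (- m))) (qc (z powi (- n))), qc (z powi (- l)))"
  proof (rule group.inv_equality[OF group_GG])
    show "(diag2 (qc (z powi (- m))) (qc (z powi (- n))), qc (z powi (- l))) \<otimes>\<^bsub>GG\<^esub>
      (diag2 (qc (z powi m)) (qc (z powi n)), qc (z powi l)) = \<one>\<^bsub>GG\<^esub>"
      unfolding GG_mult diag2_mult zz d1 ..
  qed (simp_all add: carrier_GG diag2_Sp n)
  moreover have "snd (ff l m n (p, q, qc z)) = (diag2 (qc (z powi m)) (qc (z powi n)), qc (z powi l))"
    by (simp add: ff_def quat_of_complex_powi)
  ultimately show ?thesis
    using assms(4) by (simp add: biquotient_action_def) (simp add: ff_def GG_mult)
qed

lemma carrier_HH: "h \<in> carrier HH \<longleftrightarrow> (\<exists>p q z. h = (p, q, qc z) \<and> norm p = 1 \<and> norm q = 1 \<and> norm z = 1)"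
  by (auto simp: HH_def Sp1_def S1_def)

section \<open>Complex coordinates and the quaternionic Hopf map\<close>

definition c1 :: "quat \<Rightarrow> complex" where "c1 w = Complex (qre w) (qi w)"
definition c2 :: "quat \<Rightarrow> complex" where "c2 w = Complex (qj w) (qk w)"

lemma qpair_c [simp]: "qpair (c1 w) (c2 w) = w" "c1 (qpair u v) = u" "c2 (qpair u v) = v"
  by (simp_all add: qpair_def c1_def c2_def)

lemma norm_c: "(norm (c1 w))\<^sup>2 + (norm (c2 w))\<^sup>2 = (norm w)\<^sup>2"
  by (simp add: c1_def c2_def cmod_def power2_norm_eq_inner inner_quat_def power2_eq_square[symmetric])

text \<open>Conjugation is used to make the exponents of the circle action nonnegative.\<close>

definition cj :: "bool \<Rightarrow> complex \<Rightarrow> complex" where "cj s u = (if s then u else cnj u)"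

lemma cj_cj [simp]: "cj s (cj s u) = u" and norm_cj [simp]: "norm (cj s u) = norm u"
  by (simp_all add: cj_def)

text \<open>The quaternionic Hopf map (|a|^2 - |b|^2, 2 \<open>qcnj a * b\<close>) of the first row
  (a, b), with its two complex coordinates conjugated as the flags demand. A common left factor from
  Sp(1) cancels.\<close>

definition pt :: "bool \<Rightarrow> bool \<Rightarrow> quat \<Rightarrow> quat \<Rightarrow> fib" where
  "pt s1 s2 a b = ((norm a)\<^sup>2 - (norm b)\<^sup>2, cj s1 (c1 (2 *\<^sub>R (qcnj a * b))), cj s2 (c2 (2 *\<^sub>R (qcnj a * b))))"

lemma norm_pt: "norm (pt s1 s2 a b) = (norm a)\<^sup>2 + (norm b)\<^sup>2"
proof -
  have "(norm (pt s1 s2 a b))\<^sup>2 = ((norm a)\<^sup>2 - (norm b)\<^sup>2)\<^sup>2 + (norm (2 *\<^sub>R (qcnj a * b)))\<^sup>2"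
    by (simp add: pt_def norm_Pair norm_c)
  also have "\<dots> = ((norm a)\<^sup>2 + (norm b)\<^sup>2)\<^sup>2"
    by (simp add: norm_mult power2_eq_square algebra_simps)
  finally show ?thesis by (simp add: power2_eq_iff_nonneg)
qed

text \<open>Conjugation inverts a unit complex number, so for negative \<open>d\<close> it turns the
  exponent 2 d into 2 |d|.\<close>

lemma cj_powi:
  assumes "norm z = 1"
  shows "cj (0 \<le> d) (z powi (2 * d) * u) = (z\<^sup>2) ^ nat \<bar>d\<bar> * cj (0 \<le> d) u"
proof -
  have pw: "z powi (2 * int i) = (z\<^sup>2) ^ i" for i
  proof -
    have "z powi (2 * int i) = z powi (int (2 * i))" by simp
    also have "\<dots> = z ^ (2 * i)" by (rule power_int_of_nat)
    finally show ?thesis by (simp only: power_mult)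
  qed
  show ?thesis
  proof (cases "0 \<le> d")
    case True
    then obtain i where "d = int i" using nonneg_int_cases by blast
    then show ?thesis by (simp add: cj_def pw)
  next
    case False
    then obtain i where i: "d = - int i" by (metis int_cases2 of_nat_0_le_iff)
    have "cnj z * z = 1" using assms complex_norm_square[of z] by (simp add: mult.commute)
    then have c: "cnj (inverse z) = z" by (metis complex_cnj_inverse complex_cnj_cnj inverse_unique mult.commute)
    have "z powi (2 * d) = inverse (z powi (2 * int i))" by (simp add: i flip: power_int_minus)
    also have "\<dots> = (inverse z)\<^sup>2 ^ i" by (simp add: pw power_inverse)
    finally show ?thesis using False c by (simp add: cj_def i)
  qed
qed

text \<open>The circle sends w = \<open>qcnj a * b\<close> to z^m w z^(-n). Writing w = u + v j and
  moving j past z^(-n), which conjugates it, gives u the weight m - n and v the weight m +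
  n.\<close>

lemma pt_act:
  assumes "norm p = 1" "norm z = 1" "m - n = 2 * d" "m + n = 2 * e"
  shows "pt (0 \<le> d) (0 \<le> e) (p * a * qc (z powi (- m))) (p * b * qc (z powi (- n))) =
    rot (nat \<bar>d\<bar>) (nat \<bar>e\<bar>) (z\<^sup>2) (pt (0 \<le> d) (0 \<le> e) a b)"
proof -
  have z: "z \<noteq> 0" using assms(2) by auto
  have cz: "cnj (z powi (- i)) = z powi i" for i
  proof -
    have "cnj z * z = 1" using assms(2) complex_norm_square[of z] by (simp add: mult.commute)
    then have "cnj z = inverse z" by (metis inverse_unique mult.commute)
    then show ?thesis by (simp add: power_int_minus flip: power_int_inverse)
  qed
  have pp: "qcnj p * p = 1" using assms(1) by (simp add: qcnj_mult_self)
  have qcc: "qcnj (qc w) = qc (cnj w)" for w by (simp add: quat_of_complex_def qcnj_def)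
  have "qcnj (p * a * qc (z powi (- m))) * (p * b * qc (z powi (- n))) =
      qc (z powi m) * (qcnj a * ((qcnj p * p) * b)) * qc (z powi (- n))"
    by (simp only: qcnj_mult qcc cz mult.assoc)
  also have "\<dots> = qc (z powi m) * qpair (c1 (qcnj a * b)) (c2 (qcnj a * b)) * qc (z powi (- n))"
    by (simp add: pp)
  also have "\<dots> = qpair (z powi m * z powi (- n) * c1 (qcnj a * b)) (z powi m * z powi n * c2 (qcnj a * b))"
    by (simp only: qpair_mult cz mult_ac)
  also have "z powi m * z powi (- n) = z powi (2 * d)" using z assms(3) by (simp flip: power_int_add)
  also have "z powi m * z powi n = z powi (2 * e)" using z assms(4) by (simp flip: power_int_add)
  finally have w: "qcnj (p * a * qc (z powi (- m))) * (p * b * qc (z powi (- n))) =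
     qpair (z powi (2 * d) * c1 (qcnj a * b)) (z powi (2 * e) * c2 (qcnj a * b))" .
  have c: "c1 (2 *\<^sub>R x) = 2 * c1 x" "c2 (2 *\<^sub>R x) = 2 * c2 x" for x
    by (simp_all add: c1_def c2_def scaleR_quat_def complex_eq_iff)
  have "norm (p * a * qc (z powi (- m))) = norm a" "norm (p * b * qc (z powi (- n))) = norm b"
    using assms by (simp_all add: norm_mult norm_power_int)
  then show ?thesis
    unfolding pt_def w c qpair_c mult.left_commute[of 2] cj_powi[OF assms(2)] by (simp add: rot_def)
qed

text \<open>Right multiplication by a unit complex number acts on \<open>c1\<close> and
  \<open>c2\<close> with opposite weights. Conjugating \<open>c2\<close> makes the weights equal, so
  the circle acts on S^3 as in the Hopf fibration.\<close>

definition quotient_map_GG :: "int \<Rightarrow> int \<Rightarrow> (quat ^ 2 ^ 2) \<times> quat \<Rightarrow>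
    total" where
  "quotient_map_GG d e g = emb (nat \<bar>d\<bar>) (nat \<bar>e\<bar>) (c1 (snd g)) (cnj (c2 (snd g)))
     (pt (0 \<le> d) (0 \<le> e) (fst g $ 1 $ 1) (fst g $ 1 $ 2))"

lemma c_mult_qc: "c1 (r * qc w) = c1 r * w" "cnj (c2 (r * qc w)) = cnj (c2 r) * w"
proof -
  have "r * qc w = qpair (c1 r * w) (c2 r * cnj w)" by (metis qpair_c(1) qpair_mult(2))
  then show "c1 (r * qc w) = c1 r * w" "cnj (c2 (r * qc w)) = cnj (c2 r) * w" by simp_all
qed

lemma diag2_nth: "diag2 a b $ 1 $ 1 = a" "diag2 a b $ 1 $ 2 = 0" "diag2 a b $ 2 $ 1 = 0" "diag2 a b $ 2 $ 2 = b"
  by (simp_all add: diag2_def)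

lemma action_entries:
  "(diag2 p q ** A ** diag2 x y) $ 1 $ 1 = p * A $ 1 $ 1 * x" "(diag2 p q ** A ** diag2 x y) $ 1 $ 2 = p * A $ 1 $ 2 * y"
  "(diag2 p q ** A ** diag2 x y) $ 2 $ 1 = q * A $ 2 $ 1 * x" "(diag2 p q ** A ** diag2 x y) $ 2 $ 2 = q * A $ 2 $ 2 * (y :: quat)"
  by (simp_all add: qmat_mult_nth diag2_nth)

lemma Sp_mult: "A \<in> carrier Sp \<Longrightarrow> B \<in> carrier Sp \<Longrightarrow> (A :: quat ^ 2 ^ 2) ** B \<in> carrier Sp"
  using monoid.m_closed[OF group.is_monoid[OF group_Sp], of A B] by (simp add: Sp_def)

lemma Sp_adjoint: "A \<in> carrier Sp \<Longrightarrow> qadjoint A \<in> carrier Sp"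
  by (simp add: Sp_def)

context
  fixes m n d e :: int
  assumes mn: "m - n = 2 * d" "m + n = 2 * e"
begin

private abbreviation "act \<equiv> biquotient_action GG (ff 2 m n)"
private abbreviation "\<pi> \<equiv> quotient_map_GG d e"
private abbreviation "X \<equiv> bundle_set (nat \<bar>d\<bar>) (nat \<bar>e\<bar>)"

lemma act_closed:
  assumes "h \<in> carrier HH" "g \<in> carrier GG"
  shows "act h g \<in> carrier GG"
proof -
  obtain p q z where h: "h = (p, q, qc z)" "norm p = 1" "norm q = 1" "norm z = 1"
    using assms(1) carrier_HH by auto
  obtain A r where g: "g = (A, r)" "A \<in> carrier Sp" "norm r = 1" using assms(2) by (auto simp: carrier_GG)
  have gG: "(A, r) \<in> carrier GG" using assms(2) g by simp
  show ?thesis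
    unfolding h(1) g(1) action_eq[OF h(2-4) gG] carrier_GG
    using g h by (simp add: Sp_mult diag2_Sp norm_mult norm_power_int)
qed

text \<open>The circle multiplies the S^3 coordinates by z^(-2) and rotates the S^4 coordinate by
  z^2; \<open>emb_invariant\<close> makes the two cancel.\<close>

lemma quotient_map_act:
  assumes "h \<in> carrier HH" "g \<in> carrier GG"
  shows "\<pi> (act h g) = \<pi> g"
proof -
  obtain p q z where h: "h = (p, q, qc z)" "norm p = 1" "norm q = 1" "norm z = 1"
    using assms(1) carrier_HH by auto
  obtain A r where g: "g = (A, r)" by (cases g) auto
  have gG: "(A, r) \<in> carrier GG" using assms(2) g by simp
  have z: "z \<noteq> 0" using h(4) by auto
  have n: "norm (z powi (- 2)) = 1" using h(4) by (simp add: norm_power_int)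
  have zz: "z powi (- 2) * z\<^sup>2 = 1" using z by (simp add: power_int_minus)
  show ?thesis
    unfolding h(1) g action_eq[OF h(2-4) gG] quotient_map_GG_def fst_conv snd_conv action_entries
      pt_act[OF h(2,4) mn] c_mult_qc emb_invariant[OF n] rot_rot zz rot_1 ..
qed

lemma quotient_map_mem: "g \<in> carrier GG \<Longrightarrow> \<pi> g \<in> X"
  unfolding quotient_map_GG_def
  by (rule emb_in_bundle_set) (auto simp: norm_c carrier_GG norm_pt Sp_iff)

end

section \<open>The fibres of the quotient map are the orbits\<close>

lemma hopf_fibre:
  assumes "(norm a)\<^sup>2 + (norm b)\<^sup>2 = 1" "(norm a')\<^sup>2 + (norm b')\<^sup>2 = 1" "hopf a b = hopf a' b'"
  shows "\<exists>\<zeta>. norm \<zeta> = 1 \<and> a' = a * \<zeta> \<and> b' = b * \<zeta>"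
proof -
  have h: "a * cnj b = a' * cnj b'" "(norm a)\<^sup>2 - (norm b)\<^sup>2 = (norm a')\<^sup>2 - (norm b')\<^sup>2"
    using assms(3) by (simp_all add: hopf_def)
  then have "(norm a)\<^sup>2 = (norm a')\<^sup>2" "(norm b)\<^sup>2 = (norm b')\<^sup>2" using assms by linarith+
  then have n: "norm a = norm a'" "norm b = norm b'" by (simp_all add: power2_eq_iff_nonneg)
  show ?thesis
  proof (cases "a = 0")
    case True
    then have "norm b = 1" using assms(1) by (simp add: power2_eq_1_iff) (use norm_ge_zero[of b] in linarith)
    then have "b \<noteq> 0" by auto
    then show ?thesis using True n \<open>norm b = 1\<close> by (intro exI[of _ "b' / b"]) (auto simp: norm_divide)
  next
    case False
    let ?z = "a' / a"
    have z: "norm ?z = 1" using False n[symmetric] by (simp add: norm_divide)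
    then have zc: "?z * cnj ?z = 1" by (metis complex_norm_square of_real_1 one_power2)
    have "cnj b = ?z * cnj b'" using h(1) False by (simp add: field_simps)
    then have "b = cnj ?z * b'" by (metis complex_cnj_cnj complex_cnj_mult)
    then have "b * ?z = b' * (?z * cnj ?z)" by (simp only: mult_ac)
    then have "b' = b * ?z" unfolding zc by simp
    then show ?thesis using z False by (intro exI[of _ ?z]) simp
  qed
qed

lemma emb_inj:
  assumes "emb j k a b p = emb j k a b p'" "a \<noteq> 0 \<or> b \<noteq> 0"
  shows "p = p'"
proof -
  have f: "fst p = fst p'" and s: "snd (rot j k a p) = snd (rot j k a p')" "snd (rot j k b p) = snd (rot j k b p')"
    using assms(1) by (simp_all add: emb_def)
  have "snd p = snd p'" if "snd (rot j k c p) = snd (rot j k c p')" "c \<noteq> 0" for c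
    using that by (auto simp: rot_def prod_eq_iff split: prod.splits)
  then show ?thesis using f s assms(2) by (metis prod_eqI)
qed

text \<open>The norms of corresponding entries agree, so a' a^(-1) is a unit quaternion, and the
  shared value of \<open>qcnj a * b\<close> forces it to take b to b' as well. For a = 0 the factor
  is read off from b.\<close>

lemma pt_fibre:
  assumes "(norm a)\<^sup>2 + (norm b)\<^sup>2 = 1" "(norm a')\<^sup>2 + (norm b')\<^sup>2 = 1" "pt s1 s2 a b = pt s1 s2 a' b'"
  shows "\<exists>p. norm p = 1 \<and> a' = p * a \<and> b' = p * b"
proof -
  have "(norm a)\<^sup>2 - (norm b)\<^sup>2 = (norm a')\<^sup>2 - (norm b')\<^sup>2" using assms(3) by (simp add: pt_def)
  then have "(norm a)\<^sup>2 = (norm a')\<^sup>2" "(norm b)\<^sup>2 = (norm b')\<^sup>2" using assms by linarith+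
  then have n: "norm a = norm a'" "norm b = norm b'" by (simp_all add: power2_eq_iff_nonneg)
  have "c1 (2 *\<^sub>R (qcnj a * b)) = c1 (2 *\<^sub>R (qcnj a' * b'))" "c2 (2 *\<^sub>R (qcnj a * b)) = c2 (2 *\<^sub>R (qcnj a' * b'))"
    using assms(3) unfolding pt_def prod.inject by (metis cj_cj)+
  then have "2 *\<^sub>R (qcnj a * b) = 2 *\<^sub>R (qcnj a' * b')" by (metis qpair_c(1))
  then have w: "qcnj a * b = qcnj a' * b'" by simp
  show ?thesis
  proof (cases "a = 0")
    case True
    then have "norm b = 1" using assms(1) by (simp add: power2_eq_1_iff) (use norm_ge_zero[of b] in linarith)
    then have "b \<noteq> 0" by auto
    then show ?thesis using True n \<open>norm b = 1\<close>
      by (intro exI[of _ "b' * inverse b"]) (auto simp: norm_mult norm_inverse mult.assoc)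
  next
    case False
    let ?p = "a' * inverse a"
    have a': "qcnj a' \<noteq> 0" using False n by (metis norm_eq_zero norm_qcnj)
    have "qcnj a' * (?p * b) = (qcnj a' * a') * (inverse a * b)" by (simp only: mult.assoc)
    also have "\<dots> = (norm a)\<^sup>2 *\<^sub>R (inverse a * b)" by (simp add: qcnj_mult_self n)
    also have "\<dots> = qcnj a * (a * inverse a) * b" by (simp add: mult.assoc[symmetric] qcnj_mult_self)
    also have "\<dots> = qcnj a' * b'" using False w by simp
    finally have "?p * b = b'" using a' by simp
    moreover have "?p * a = a'" using False by (simp add: mult.assoc)
    moreover have "norm ?p = 1" using False n[symmetric] by (simp add: norm_mult norm_inverse)
    ultimately show ?thesis by metis
  qed
qed

text \<open>\<open>B ** qadjoint A\<close> has first row (p, 0). A matrix of Sp(2) with such a row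
  is diagonal, and its last entry is the required \<open>q\<close>.\<close>

lemma Sp_same_row:
  fixes A B :: "quat ^ 2 ^ 2"
  assumes "A \<in> carrier Sp" "B \<in> carrier Sp" "norm p = 1" "B $ 1 $ 1 = p * A $ 1 $ 1" "B $ 1 $ 2 = p * A $ 1 $ 2"
  shows "\<exists>q. norm q = 1 \<and> B = diag2 p q ** A"
proof -
  define C where "C = B ** qadjoint A"
  have C: "C \<in> carrier Sp" unfolding C_def by (intro Sp_mult Sp_adjoint assms)
  have "A ** qadjoint A = mat 1" "qadjoint A ** A = mat 1" using assms(1) by (simp_all add: Sp_def)
  then have a: "A $ 1 $ 1 * qcnj (A $ 1 $ 1) + A $ 1 $ 2 * qcnj (A $ 1 $ 2) = 1" and B: "B = C ** A"
    by (auto simp: C_def qmat_assoc) (simp add: qmat_eq_iff qmat_mult_nth qadjoint_def mat_def)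
  have "C $ 1 $ 1 = p * (A $ 1 $ 1 * qcnj (A $ 1 $ 1) + A $ 1 $ 2 * qcnj (A $ 1 $ 2))"
    by (simp add: C_def qmat_mult_nth qadjoint_def assms(4,5) distrib_left mult.assoc)
  then have p: "C $ 1 $ 1 = p" using a by simp
  then have c: "C $ 1 $ 2 = 0" "C $ 2 $ 1 = 0" "norm (C $ 2 $ 2) = 1"
    using C[unfolded Sp_iff] assms(3) by (auto simp: power2_eq_1_iff) (use norm_ge_zero[of "C $ 2 $ 2"] in linarith)
  have "C = diag2 p (C $ 2 $ 2)" by (simp add: qmat_eq_iff diag2_nth c p)
  then show ?thesis using B c(3) by metis
qed

context
  fixes m n d e :: int
  assumes mn: "m - n = 2 * d" "m + n = 2 * e"
begin

lemma quotient_map_fibre: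
  assumes g: "g \<in> carrier GG" and g': "g' \<in> carrier GG" and eq: "quotient_map_GG d e g = quotient_map_GG d e g'"
  shows "\<exists>h\<in>carrier HH. biquotient_action GG (ff 2 m n) h g = g'"
proof -
  obtain A r where A: "g = (A, r)" "A \<in> carrier Sp" "norm r = 1" using g by (auto simp: carrier_GG)
  obtain A' r' where A': "g' = (A', r')" "A' \<in> carrier Sp" "norm r' = 1" using g' by (auto simp: carrier_GG)
  let ?pt = "pt (0 \<le> d) (0 \<le> e)" and ?rot = "rot (nat \<bar>d\<bar>) (nat \<bar>e\<bar>)"
  have nr: "(norm (c1 r))\<^sup>2 + (norm (cnj (c2 r)))\<^sup>2 = 1" if "norm r = 1" for r
    using norm_c[of r] that by simp
  have "hopf (c1 r) (cnj (c2 r)) = hopf (c1 r') (cnj (c2 r'))"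
    using eq by (simp add: A A' quotient_map_GG_def emb_def)
  then obtain \<zeta> where \<zeta>: "norm \<zeta> = 1" "c1 r' = c1 r * \<zeta>" "cnj (c2 r') = cnj (c2 r) * \<zeta>"
    using hopf_fibre[OF nr[OF A(3)] nr[OF A'(3)]] by blast
  \<comment> \<open>As l = 2, the circle acts on the Sp(1) factor by z^(-2), which has to equal
    \<open>\<zeta>\<close>.\<close>
  define z where "z = csqrt (inverse \<zeta>)"
  have z2: "z\<^sup>2 = inverse \<zeta>" by (simp add: z_def)
  then have "(norm z)\<^sup>2 = 1" using \<zeta>(1) by (metis norm_inverse norm_power inverse_1)
  then have nz: "norm z = 1" by (simp add: power2_eq_1_iff) (use norm_ge_zero[of z] in linarith)
  have zm2: "z powi (- 2) = \<zeta>" by (simp add: power_int_minus z2)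
  have r': "r' = r * qc (z powi (- 2))"
    using \<zeta> c_mult_qc[of r \<zeta>] by (metis complex_cnj_cnj qpair_c(1) zm2)
  have \<zeta>0: "\<zeta> \<noteq> 0" using \<zeta>(1) by auto
  have "emb (nat \<bar>d\<bar>) (nat \<bar>e\<bar>) (c1 r) (cnj (c2 r)) (?pt (A $ 1 $ 1) (A $ 1 $ 2)) =
      emb (nat \<bar>d\<bar>) (nat \<bar>e\<bar>) (c1 r) (cnj (c2 r)) (?rot \<zeta> (?pt (A' $ 1 $ 1) (A' $ 1 $ 2)))"
    using eq by (simp add: A A' quotient_map_GG_def \<zeta> emb_invariant)
  moreover have "c1 r \<noteq> 0 \<or> cnj (c2 r) \<noteq> 0" using nr[OF A(3)] by auto
  ultimately have "?pt (A $ 1 $ 1) (A $ 1 $ 2) = ?rot \<zeta> (?pt (A' $ 1 $ 1) (A' $ 1 $ 2))" by (rule emb_inj)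
  then have "?rot (z\<^sup>2) (?pt (A $ 1 $ 1) (A $ 1 $ 2)) = ?pt (A' $ 1 $ 1) (A' $ 1 $ 2)"
    using \<zeta>0 by (simp add: rot_rot z2)
  then have pt: "?pt (1 * A $ 1 $ 1 * qc (z powi (- m))) (1 * A $ 1 $ 2 * qc (z powi (- n))) = ?pt (A' $ 1 $ 1) (A' $ 1 $ 2)"
    using pt_act[OF _ nz mn, of 1 "A $ 1 $ 1" "A $ 1 $ 2"] by simp
  \<comment> \<open>The result of acting on \<open>A\<close> by \<open>z\<close> alone. Its first
    row has the same Hopf image as that of \<open>A'\<close>, so only \<open>p\<close> and
    \<open>q\<close> remain to be found.\<close>
  let ?B = "diag2 1 1 ** A ** diag2 (qc (z powi (- m))) (qc (z powi (- n)))"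
  have nzi: "norm (qc (z powi i)) = 1" for i using nz by (simp add: norm_power_int)
  have B: "?B \<in> carrier Sp" by (intro Sp_mult A diag2_Sp nzi) simp_all
  have "(norm (?B $ 1 $ 1))\<^sup>2 + (norm (?B $ 1 $ 2))\<^sup>2 = 1" "(norm (A' $ 1 $ 1))\<^sup>2 + (norm (A' $ 1 $ 2))\<^sup>2 = 1"
    using B A'(2) by (simp_all add: Sp_iff)
  then obtain p where p: "norm p = 1" "A' $ 1 $ 1 = p * ?B $ 1 $ 1" "A' $ 1 $ 2 = p * ?B $ 1 $ 2"
    using pt_fibre[of "?B $ 1 $ 1" "?B $ 1 $ 2" "A' $ 1 $ 1" "A' $ 1 $ 2"] pt unfolding action_entries by blast
  then obtain q where q: "norm q = 1" "A' = diag2 p q ** ?B" using Sp_same_row[OF B A'(2)] by blast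
  have "A' = diag2 p q ** A ** diag2 (qc (z powi (- m))) (qc (z powi (- n)))"
    unfolding q(2) qmat_assoc[symmetric] diag2_mult by simp
  moreover have "(A, r) \<in> carrier GG" using g A by simp
  ultimately have "biquotient_action GG (ff 2 m n) (p, q, qc z) g = g'"
    using action_eq[OF p(1) q(1) nz] r' by (simp add: A A')
  moreover have "(p, q, qc z) \<in> carrier HH" using p q nz carrier_HH by blast
  ultimately show ?thesis by blast
qed

end

section \<open>Local sections\<close>

text \<open>The complex formula for a unitary matrix with given first row. Over the quaternions it
  requires some commutation, which holds below because one of the two entries is real.\<close>

lemma qm_Sp:
  assumes "(norm a)\<^sup>2 + (norm b)\<^sup>2 = 1" "qcnj a * b = b * qcnj a" "qcnj a * qcnj b = qcnj b * qcnj a"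
  shows "qm a b (- qcnj b) (qcnj a) \<in> carrier Sp"
  using assms by (simp add: Sp_iff add.commute)

lemma smooth_qpair [smooth_intros]:
  assumes "smooth_on_subset U u" "smooth_on_subset U v"
  shows "smooth_on_subset U (\<lambda>x. qpair (u x) (v x))"
proof -
  have "linear (\<lambda>p. qpair (fst p) (snd p))" by (rule linearI) (simp_all add: qpair_def quat_defs)
  then have "bounded_linear (\<lambda>p. qpair (fst p) (snd p))" by (simp add: linear_conv_bounded_linear)
  from smooth_on_subset_linear_compose[OF this smooth_on_subset_Pair[OF assms]] show ?thesis by simp
qed

lemma smooth_cj [smooth_intros]: "smooth_on_subset U u \<Longrightarrow> smooth_on_subset U (\<lambda>x. cj s (u x))"
  unfolding cj_def by (cases s) (auto intro: smooth_intros)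

text \<open>A section of the quaternionic Hopf map away from the pole with first coordinate -1: the
  first entry is normalised to be real and positive, and then 2 t b is the quaternionic coordinate
  of \<open>p\<close>. In \<open>pt_inv2\<close> the second entry is normalised, which covers the
  missing pole.\<close>

definition pt_inv1 :: "bool \<Rightarrow> bool \<Rightarrow> fib \<Rightarrow> quat ^ 2 ^ 2" where
  "pt_inv1 s1 s2 p = (let t = sqrt ((1 + fst p) / 2); b = (1 / (2 * t)) *\<^sub>R qpair (cj s1 (fst (snd p))) (cj s2 (snd (snd p)))
     in qm (t *\<^sub>R 1) b (- qcnj b) (t *\<^sub>R 1))"

definition pt_inv2 :: "bool \<Rightarrow> bool \<Rightarrow> fib \<Rightarrow> quat ^ 2 ^ 2" where
  "pt_inv2 s1 s2 p = (let t = sqrt ((1 - fst p) / 2); b = (1 / (2 * t)) *\<^sub>R qpair (cj s1 (fst (snd p))) (cj s2 (snd (snd p)))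
     in qm (qcnj b) (t *\<^sub>R 1) (- (t *\<^sub>R 1)) b)"

lemma norm_qpair: "(norm (qpair u v))\<^sup>2 = (norm u)\<^sup>2 + (norm v)\<^sup>2"
  using norm_c[of "qpair u v"] by simp

lemma pt_inv:
  assumes "norm p = 1"
  shows "- 1 < fst p \<Longrightarrow> pt_inv1 s1 s2 p \<in> carrier Sp \<and> pt s1 s2 (pt_inv1 s1 s2 p $ 1 $ 1) (pt_inv1 s1 s2 p $ 1 $ 2) = p"
    and "fst p < 1 \<Longrightarrow> pt_inv2 s1 s2 p \<in> carrier Sp \<and> pt s1 s2 (pt_inv2 s1 s2 p $ 1 $ 1) (pt_inv2 s1 s2 p $ 1 $ 2) = p"
proof -
  obtain t u v where p: "p = (t, u, v)" by (cases p) auto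
  define w where "w = qpair (cj s1 u) (cj s2 v)"
  have w: "(norm w)\<^sup>2 = 1 - t\<^sup>2"
    using assms by (simp add: p w_def norm_qpair norm_Pair)
  have pw: "cj s1 (c1 w) = u" "cj s2 (c2 w) = v" by (simp_all add: w_def)
  {
    assume "- 1 < fst p"
    define s where "s = sqrt ((1 + t) / 2)"
    have s: "s > 0" "s\<^sup>2 = (1 + t) / 2" using \<open>- 1 < fst p\<close> by (simp_all add: s_def p)
    \<comment> \<open>Since |w|^2 = 1 - t^2, this factorisation cancels the s^2 in the denominator
      of |b|^2.\<close>
    have k: "4 * s\<^sup>2 * ((1 - t) / 2) = 1 - t\<^sup>2" unfolding s(2) by (simp add: power2_eq_square field_simps)
    have "(norm ((1 / (2 * s)) *\<^sub>R w))\<^sup>2 = (norm w)\<^sup>2 / (4 * s\<^sup>2)"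
      using s(1) by (simp add: power_mult_distrib power_divide)
    also have "\<dots> = 4 * s\<^sup>2 * ((1 - t) / 2) / (4 * s\<^sup>2)" unfolding k w ..
    also have "\<dots> = (1 - t) / 2" using s(1) by simp
    finally have nb: "(norm ((1 / (2 * s)) *\<^sub>R w))\<^sup>2 = (1 - t) / 2" .
    have e: "pt_inv1 s1 s2 p = qm (s *\<^sub>R 1) ((1 / (2 * s)) *\<^sub>R w) (- qcnj ((1 / (2 * s)) *\<^sub>R w)) (qcnj (s *\<^sub>R 1))"
      by (simp add: pt_inv1_def p s_def w_def Let_def)
    have "pt_inv1 s1 s2 p \<in> carrier Sp"
      unfolding e
    proof (rule qm_Sp)
      show "(norm (s *\<^sub>R (1 :: quat)))\<^sup>2 + (norm ((1 / (2 * s)) *\<^sub>R w))\<^sup>2 = 1"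
        unfolding nb by (simp add: s(2) field_simps)
    qed simp_all
    moreover have "2 *\<^sub>R (qcnj (s *\<^sub>R 1) * ((1 / (2 * s)) *\<^sub>R w)) = w" using s(1) by simp
    then have "pt s1 s2 (s *\<^sub>R 1) ((1 / (2 * s)) *\<^sub>R w) = p"
      unfolding pt_def nb by (simp add: pw p s(2) field_simps)
    then have "pt s1 s2 (pt_inv1 s1 s2 p $ 1 $ 1) (pt_inv1 s1 s2 p $ 1 $ 2) = p" unfolding e qm_nth .
    ultimately show "pt_inv1 s1 s2 p \<in> carrier Sp \<and> pt s1 s2 (pt_inv1 s1 s2 p $ 1 $ 1) (pt_inv1 s1 s2 p $ 1 $ 2) = p" ..
  next
    assume "fst p < 1"
    define s where "s = sqrt ((1 - t) / 2)"
    have s: "s > 0" "s\<^sup>2 = (1 - t) / 2" using \<open>fst p < 1\<close> by (simp_all add: s_def p)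
    have k: "4 * s\<^sup>2 * ((1 + t) / 2) = 1 - t\<^sup>2" unfolding s(2) by (simp add: power2_eq_square field_simps)
    have "(norm ((1 / (2 * s)) *\<^sub>R w))\<^sup>2 = (norm w)\<^sup>2 / (4 * s\<^sup>2)"
      using s(1) by (simp add: power_mult_distrib power_divide)
    also have "\<dots> = 4 * s\<^sup>2 * ((1 + t) / 2) / (4 * s\<^sup>2)" unfolding k w ..
    also have "\<dots> = (1 + t) / 2" using s(1) by simp
    finally have nb: "(norm ((1 / (2 * s)) *\<^sub>R w))\<^sup>2 = (1 + t) / 2" .
    have e: "pt_inv2 s1 s2 p = qm (qcnj ((1 / (2 * s)) *\<^sub>R w)) (s *\<^sub>R 1) (- qcnj (s *\<^sub>R 1)) (qcnj (qcnj ((1 / (2 * s)) *\<^sub>R w)))"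
      by (simp add: pt_inv2_def p s_def w_def Let_def)
    have "pt_inv2 s1 s2 p \<in> carrier Sp"
      unfolding e
    proof (rule qm_Sp)
      show "(norm (qcnj ((1 / (2 * s)) *\<^sub>R w)))\<^sup>2 + (norm (s *\<^sub>R (1 :: quat)))\<^sup>2 = 1"
        unfolding norm_qcnj nb by (simp add: s(2) field_simps)
    qed simp_all
    moreover have "2 *\<^sub>R (qcnj (qcnj ((1 / (2 * s)) *\<^sub>R w)) * (s *\<^sub>R 1)) = w" using s(1) by simp
    then have "pt s1 s2 (qcnj ((1 / (2 * s)) *\<^sub>R w)) (s *\<^sub>R 1) = p"
      unfolding pt_def norm_qcnj nb by (simp add: pw p s(2) field_simps)
    then have "pt s1 s2 (pt_inv2 s1 s2 p $ 1 $ 1) (pt_inv2 s1 s2 p $ 1 $ 2) = p" unfolding e qm_nth .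
    ultimately show "pt_inv2 s1 s2 p \<in> carrier Sp \<and> pt s1 s2 (pt_inv2 s1 s2 p $ 1 $ 1) (pt_inv2 s1 s2 p $ 1 $ 2) = p" ..
  }
qed

lemma pt_local_section:
  assumes "norm p = 1"
  shows "\<exists>V M. open V \<and> p \<in> V \<and> smooth_on_subset V M \<and>
    (\<forall>x\<in>V. norm x = 1 \<longrightarrow> (M x :: quat ^ 2 ^ 2) \<in> carrier Sp \<and> pt s1 s2 (M x $ 1 $ 1) (M x $ 1 $ 2) = x)"
proof (cases "- 1 < fst p")
  case True
  have "open {x :: fib. - 1 < fst x}" by (intro open_Collect_less continuous_intros)
  moreover have "smooth_on_subset {x. - 1 < fst x} (pt_inv1 s1 s2)"
    unfolding pt_inv1_def Let_def by (intro smooth_intros) auto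
  ultimately show ?thesis using True pt_inv(1)
    by (intro exI[of _ "{x. - 1 < fst x}"] exI[of _ "pt_inv1 s1 s2"]) auto
next
  case False
  then have "fst p < 1" by simp
  have "open {x :: fib. fst x < 1}" by (intro open_Collect_less continuous_intros)
  moreover have "smooth_on_subset {x. fst x < 1} (pt_inv2 s1 s2)"
    unfolding pt_inv2_def Let_def by (intro smooth_intros) auto
  ultimately show ?thesis using \<open>fst p < 1\<close> pt_inv(2)
    by (intro exI[of _ "{x. fst x < 1}"] exI[of _ "pt_inv2 s1 s2"]) auto
qed

text \<open>A point is represented with a positive first entry over \<open>S2N\<close> and with a
  positive second entry over \<open>S2S\<close>.\<close>

lemma emb_local_section:
  assumes y: "y \<in> bundle_set j k"
  shows "\<exists>W a b p. openin (top_of_set (bundle_set j k)) W \<and> y \<in> W \<and>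
     smooth_on_subset W a \<and> smooth_on_subset W b \<and> smooth_on_subset W p \<and>
     (\<forall>x\<in>W. (norm (a x))\<^sup>2 + (norm (b x))\<^sup>2 = 1 \<and> norm (p x) = 1 \<and> emb j k (a x) (b x) (p x) = x)"
proof -
  let ?X = "bundle_set j k"
  let ?N = "?X \<inter> fst -` S2N" and ?S = "?X \<inter> fst -` S2S"
  let ?a = "\<lambda>x :: total. complex_of_real (north (fst x))"
    and ?b = "\<lambda>x :: total. lift1 (fst x)"
    and ?p = "\<lambda>x. snd (triv1 j k x)"
  have s: "smooth_on_subset ?N ?a" "smooth_on_subset ?N ?b" "smooth_on_subset ?N ?p"
  proof -
    have "smooth_on_subset ?N (\<lambda>x. north (fst x))"
      by (rule smooth_on_subset_compose[OF _ smooth_north]) (auto intro!: smooth_intros simp: S2N_def)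
    then show "smooth_on_subset ?N ?a" by (intro smooth_intros)
    show "smooth_on_subset ?N ?b"
      by (rule smooth_on_subset_compose[OF _ smooth_lift1]) (auto intro!: smooth_intros simp: S2N_def)
    show "smooth_on_subset ?N ?p"
      using ediff_triv1[of j k] by (intro smooth_intros) (simp add: ediff_def)
  qed
  have eq: "(norm (?a x))\<^sup>2 + (norm (?b x))\<^sup>2 = 1 \<and> norm (?p x) = 1 \<and> emb j k (?a x) (?b x) (?p x) = x" if "x \<in> ?N" for x
  proof -
    have x: "x \<in> ?X" "fst x \<in> S2N" using that by auto
    show ?thesis
      using north_lift1(2)[OF x(2)] triv1_inverse[OF x] by (simp add: triv1_inv_def mem_Times_iff)
  qed
  have "fst y \<in> S2N \<or> fst y \<in> S2S" using bundle_set_fst[OF y] S2_cover by blast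
  then show ?thesis
  proof
    assume "fst y \<in> S2N"
    then have "y \<in> ?N" using y by simp
    moreover have "\<forall>x\<in>?N. (norm (?a x))\<^sup>2 + (norm (?b x))\<^sup>2 = 1 \<and> norm (?p x) = 1 \<and> emb j k (?a x) (?b x) (?p x) = x"
      using eq by blast
    ultimately show ?thesis
      by (intro exI[of _ ?N] exI[of _ ?a] exI[of _ ?b] exI[of _ ?p] conjI s bundle_set_openin[OF openin_S2(1)])
  next
    assume "fst y \<in> S2S"
    then have y: "y \<in> ?S" using y by simp
    have fl: "flip x \<in> ?N" if "x \<in> ?S" for x using that flip_bundle_set by simp
    have sfl: "smooth_on_subset ?S flip" by (rule smooth_on_subset_bounded_linear[OF bounded_linear_flip])
    have im: "flip ` ?S \<subseteq> ?N" using fl by (rule image_subsetI)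
    have sf2: "smooth_on_subset ?S (\<lambda>x. ?p (flip x))"
      by (rule smooth_on_subset_compose[OF sfl s(3) im])
    have sf1: "smooth_on_subset ?S (\<lambda>x. ?a (flip x))" "smooth_on_subset ?S (\<lambda>x. ?b (flip x))"
      by (rule smooth_on_subset_compose[OF sfl s(1) im], rule smooth_on_subset_compose[OF sfl s(2) im])
    have eqS: "(norm (?b (flip x)))\<^sup>2 + (norm (?a (flip x)))\<^sup>2 = 1 \<and> norm (?p (flip x)) = 1 \<and>
        emb j k (?b (flip x)) (?a (flip x)) (?p (flip x)) = x" if "x \<in> ?S" for x
      using eq[OF fl[OF that]] by (metis add.commute flip_emb flip_flip)
    then have "\<forall>x\<in>?S. (norm (?b (flip x)))\<^sup>2 + (norm (?a (flip x)))\<^sup>2 = 1 \<and> norm (?p (flip x)) = 1 \<and>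
        emb j k (?b (flip x)) (?a (flip x)) (?p (flip x)) = x" by blast
    then show ?thesis
      by (intro exI[of _ ?S] exI[of _ "\<lambda>x. ?b (flip x)"] exI[of _ "\<lambda>x. ?a (flip x)"] exI[of _ "\<lambda>x. ?p (flip x)"]
          conjI sf1 sf2 y bundle_set_openin[OF openin_S2(2)])
  qed
qed

text \<open>The section is assembled from a lift of the bundle point to S^3 x S^4 and a lift of its
  S^4 component to Sp(2).\<close>

lemma quotient_map_local_section:
  assumes y: "y \<in> bundle_set (nat \<bar>d\<bar>) (nat \<bar>e\<bar>)"
  shows "\<exists>W s. openin (top_of_set (bundle_set (nat \<bar>d\<bar>) (nat \<bar>e\<bar>))) W \<and> y \<in> W \<and> smooth_on_subset W s \<and>
    s ` W \<subseteq> carrier GG \<and> (\<forall>x\<in>W. quotient_map_GG d e (s x) = x)"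
proof -
  let ?X = "bundle_set (nat \<bar>d\<bar>) (nat \<bar>e\<bar>)"
  obtain W a b p where W: "openin (top_of_set ?X) W" "y \<in> W"
     "smooth_on_subset W a" "smooth_on_subset W b" "smooth_on_subset W p"
     and eq: "\<And>x. x \<in> W \<Longrightarrow> (norm (a x))\<^sup>2 + (norm (b x))\<^sup>2 = 1 \<and> norm (p x) = 1 \<and>
       emb (nat \<bar>d\<bar>) (nat \<bar>e\<bar>) (a x) (b x) (p x) = x"
    using emb_local_section[OF y] by metis
  obtain V and M :: "_ \<Rightarrow> quat ^ 2 ^ 2" where V: "open V" "p y \<in> V" "smooth_on_subset V M"
    and M: "\<And>x. x \<in> V \<Longrightarrow> norm x = 1 \<Longrightarrow> M x \<in> carrier Sp \<and> pt (0 \<le> d) (0 \<le> e) (M x $ 1 $ 1) (M x $ 1 $ 2) = x"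
    using pt_local_section[of "p y" "0 \<le> d" "0 \<le> e"] eq[OF W(2)] by metis
  let ?W = "W \<inter> p -` V"
  let ?s = "\<lambda>x. (M (p x), qpair (a x) (cnj (b x)))"
  have "openin (top_of_set W) ?W"
    using smooth_on_subset_imp_continuous_on[OF W(5)] V(1) by (rule continuous_openin_preimage_gen)
  then have op: "openin (top_of_set ?X) ?W" using W(1) openin_trans by blast
  have "smooth_on_subset ?W p" using W(5) by (rule smooth_on_subset_mono) simp
  then have "smooth_on_subset ?W (\<lambda>x. M (p x))" by (rule smooth_on_subset_compose[OF _ V(3)]) auto
  moreover have "smooth_on_subset ?W a" "smooth_on_subset ?W b"
    by (rule smooth_on_subset_mono[OF W(3)], simp, rule smooth_on_subset_mono[OF W(4)], simp)
  ultimately have sm: "smooth_on_subset ?W ?s" by (intro smooth_intros)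
  have "?s x \<in> carrier GG \<and> quotient_map_GG d e (?s x) = x" if "x \<in> ?W" for x
  proof
    have x: "x \<in> W" "p x \<in> V" using that by auto
    note E = eq[OF x(1)]
    have "(norm (qpair (a x) (cnj (b x))))\<^sup>2 = 1" using E by (simp add: norm_qpair)
    then have "norm (qpair (a x) (cnj (b x))) = 1"
      by (simp add: power2_eq_1_iff) (use norm_ge_zero[of "qpair (a x) (cnj (b x))"] in linarith)
    then show "?s x \<in> carrier GG" using M[OF x(2)] E by (simp add: carrier_GG)
    show "quotient_map_GG d e (?s x) = x" using M[OF x(2)] E by (simp add: quotient_map_GG_def)
  qed
  then have "?s ` ?W \<subseteq> carrier GG" and "\<forall>x\<in>?W. quotient_map_GG d e (?s x) = x"
    by (intro image_subsetI, blast, blast)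
  moreover have "y \<in> ?W" using W(2) V(2) by simp
  ultimately show ?thesis using op sm by (intro exI[of _ ?W] exI[of _ ?s] conjI)
qed

section \<open>Effective freeness and the orbit manifold\<close>

lemma smooth_quotient_map: "smooth_on_subset U (quotient_map_GG d e)"
proof -
  have l: "bounded_linear c1" "bounded_linear c2"
    unfolding linear_conv_bounded_linear[symmetric]
    by (rule linearI; simp add: c1_def c2_def quat_defs complex_eq_iff)+
  show ?thesis
    unfolding quotient_map_GG_def pt_def power2_norm_eq_inner
    by (intro smooth_emb smooth_intros smooth_on_subset_linear_compose[OF l(1)] smooth_on_subset_linear_compose[OF l(2)])
qed

text \<open>The Sp(1) factor of a fixed point forces z^2 = 1. For odd \<open>m\<close> and
  \<open>n\<close> both powers of z are then the same sign as z, and cancelling a nonzero entry in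
  each row of \<open>A\<close> shows that \<open>p\<close> and \<open>q\<close> equal this sign too.
  Such an element fixes every point because the signs on the two sides of a matrix multiply to
  1.\<close>

lemma effectively_free_action:
  assumes "odd m" "odd n"
  shows "effectively_free HH (carrier GG) (biquotient_action GG (ff 2 m n))"
  unfolding effectively_free_def
proof (intro ballI impI, elim bexE)
  fix h x y assume "h \<in> carrier HH" and x: "x \<in> carrier GG" and y: "y \<in> carrier GG"
    and fx: "biquotient_action GG (ff 2 m n) h x = x"
  then obtain p q z where h: "h = (p, q, qc z)" "norm p = 1" "norm q = 1" "norm z = 1"
    using carrier_HH by auto
  obtain A r where A: "x = (A, r)" "A \<in> carrier Sp" "norm r = 1" using x by (auto simp: carrier_GG)
  obtain B s where B: "y = (B, s)" by (cases y)
  note eq = action_eq[OF h(2-4), of _ _ 2 m n]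
  have e: "diag2 p q ** A ** diag2 (qc (z powi (- m))) (qc (z powi (- n))) = A" "r * qc (z powi (- 2)) = r"
    using fx eq[of A r] x by (simp_all add: h A)
  have "r \<noteq> 0" using A(3) by auto
  then have "qc (z powi (- 2)) = 1" using e(2) by simp
  then have "qc (z powi (- 2)) = qc 1" by simp
  then have z1: "z powi (- 2) = 1" by (simp add: quat_of_complex_def complex_eq_iff)
  then have "z\<^sup>2 = 1" by (simp add: power_int_minus)
  then have "z = 1 \<or> z = - 1" by (simp add: power2_eq_1_iff)
  then have "\<exists>\<epsilon>. z = of_real \<epsilon> \<and> \<epsilon> * \<epsilon> = 1 \<and> z powi (- m) = z \<and> z powi (- n) = z"
  proof
    assume "z = 1"
    then show ?thesis by (intro exI[of _ 1]) simp
  next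
    assume "z = - 1"
    then show ?thesis using assms by (intro exI[of _ "- 1"]) (simp add: power_int_minus_left)
  qed
  then obtain \<epsilon> :: real where \<epsilon>: "z = of_real \<epsilon>" "\<epsilon> * \<epsilon> = 1" "z powi (- m) = z" "z powi (- n) = z"
    by blast
  have qz: "qc z = \<epsilon> *\<^sub>R 1" by (simp add: \<epsilon>(1) quat_of_complex_def quat_defs)
  have ne: "A $ 1 $ 1 \<noteq> 0 \<or> A $ 1 $ 2 \<noteq> 0" "A $ 2 $ 1 \<noteq> 0 \<or> A $ 2 $ 2 \<noteq> 0" using A(2) by (auto simp: Sp_iff)
  have cancel: "w = \<epsilon> *\<^sub>R 1" if "w * a * (\<epsilon> *\<^sub>R 1) = a" "a \<noteq> 0" for w a :: quat
  proof -
    have "(\<epsilon> *\<^sub>R w) * a = 1 * a" using that(1) by simp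
    then have "\<epsilon> *\<^sub>R w = 1" by (rule mult_right_cancel[OF that(2), THEN iffD1])
    then have "\<epsilon> *\<^sub>R (\<epsilon> *\<^sub>R w) = \<epsilon> *\<^sub>R 1" by simp
    then show ?thesis using \<epsilon>(2) by simp
  qed
  have "p = \<epsilon> *\<^sub>R 1" "q = \<epsilon> *\<^sub>R 1"
    using e(1) ne cancel unfolding \<epsilon>(3,4) qz qmat_eq_iff action_entries by metis+
  then show "biquotient_action GG (ff 2 m n) h y = y"
    using eq[of B s] y \<epsilon>(2) by (simp add: h(1) B \<epsilon>(3,4) qz z1 qmat_eq_iff action_entries)
qed

lemma orbit_eq_fibre:
  assumes "m - n = 2 * d" "m + n = 2 * e" "g \<in> carrier GG"
  shows "orbit HH (biquotient_action GG (ff 2 m n)) g = {g' \<in> carrier GG. quotient_map_GG d e g' = quotient_map_GG d e g}"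
  using act_closed[OF assms(1,2) _ assms(3)] quotient_map_act[OF assms(1,2) _ assms(3)] quotient_map_fibre[OF assms(1,2) assms(3)]
  unfolding orbit_def by (intro equalityI subsetI) (force, metis (mono_tags, lifting) mem_Collect_eq)

text \<open>The invariant map induces a bijection from the orbits onto the embedded bundle, along
  which the structure is pulled back. The orbit projection becomes a submersion because the
  invariant map has smooth sections through every point of the group.\<close>

lemma orbit_manifold_bundle:
  assumes mn: "m - n = 2 * d" "m + n = 2 * e"
  shows "\<exists>(Q :: (((quat ^ 2 ^ 2) \<times> quat) set, real ^ 6) mfd) f.
     orbit_manifold HH GG_mfd (biquotient_action GG (ff 2 m n)) Q \<and>
     diffeomorphism Q (euclidean_submfd (bundle_set (nat \<bar>d\<bar>) (nat \<bar>e\<bar>))) f"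
proof -
  let ?X = "bundle_set (nat \<bar>d\<bar>) (nat \<bar>e\<bar>)" and ?act = "biquotient_action GG (ff 2 m n)"
  let ?M = "euclidean_submfd ?X :: (_, real ^ 6) mfd" and ?f = "quotient_map_GG d e"
  have top: "topspace (mtop GG_mfd) = carrier GG" by (simp add: GG_mfd_def)
  have fX: "?f ` carrier GG \<subseteq> ?X" using quotient_map_mem[OF mn] by blast
  have linact: "smooth_on_subset U (?act h)" if hH: "h \<in> carrier HH" and U: "U \<subseteq> carrier GG" for h U
  proof -
    obtain p q z where h: "h = (p, q, qc z)" "norm p = 1" "norm q = 1" "norm z = 1"
      using carrier_HH[THEN iffD1, OF hH] by auto
    let ?g = "\<lambda>x. (diag2 p q ** fst x ** diag2 (qc (z powi (- m))) (qc (z powi (- n))), snd x * qc (z powi (- 2)))"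
    have "smooth_on_subset U ?g"
      by (intro smooth_intros smooth_on_subset_bounded_bilinear[OF bounded_bilinear_qmat_mult])
    moreover have "?act h x = ?g x" if "x \<in> U" for x
      using action_eq[OF h(2-4), of "fst x" "snd x" 2 m n] U that by (auto simp: h(1))
    ultimately show ?thesis by (simp cong: smooth_on_subset_cong)
  qed
  have sub: "submersion GG_mfd ?M ?f"
    unfolding GG_mfd_def
  proof (rule submersion_via_sections[OF submfd_GG submfd_bundle_set smooth_quotient_map fX])
    fix x assume x: "x \<in> carrier GG"
    obtain W s where W: "openin (top_of_set ?X) W" "?f x \<in> W" "smooth_on_subset W s" "s ` W \<subseteq> carrier GG"
      "\<forall>y\<in>W. ?f (s y) = y"
      using quotient_map_local_section[OF quotient_map_mem[OF mn x]] by metis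
    have sW: "s y \<in> carrier GG" if "y \<in> W" for y using W(4) that by blast
    \<comment> \<open>The section \<open>s\<close> passes through some point of the orbit of
      \<open>x\<close>. A group element moves it so that it passes through \<open>x\<close> itself,
      and invariance keeps it a section.\<close>
    obtain h where h: "h \<in> carrier HH" "?act h (s (?f x)) = x"
      using quotient_map_fibre[OF mn sW[OF W(2)] x] W(2,5) by metis
    have "smooth_on_subset W (\<lambda>y. ?act h (s y))"
      by (rule smooth_on_subset_compose[OF W(3) linact[OF h(1) subset_refl] W(4)])
    moreover have "(\<lambda>y. ?act h (s y)) ` W \<subseteq> carrier GG"
      by (intro image_subsetI act_closed[OF mn h(1)] sW)
    moreover have "\<forall>y\<in>W. ?f (?act h (s y)) = y" using quotient_map_act[OF mn h(1)] sW W(5) by simp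
    ultimately show "\<exists>W s. openin (top_of_set ?X) W \<and> ?f x \<in> W \<and> smooth_on_subset W s \<and>
       s ` W \<subseteq> carrier GG \<and> s (?f x) = x \<and> (\<forall>y\<in>W. ?f (s y) = y)"
      using W(1,2) h(2) by (intro exI[of _ W] exI[of _ "\<lambda>y. ?act h (s y)"] conjI)
  qed
  define Y where "Y = orbits HH (carrier GG) ?act"
  \<comment> \<open>The invariant map is constant on orbits, so its value does not depend on the
    chosen representative.\<close>
  define \<gamma> where "\<gamma> O' = ?f (SOME g. g \<in> O')" for O'
  have \<gamma>: "\<gamma> (orbit HH ?act g) = ?f g" if "g \<in> carrier GG" for g
  proof -
    have "g \<in> orbit HH ?act g" using that orbit_eq_fibre[OF mn that] by simp
    then have "(SOME g'. g' \<in> orbit HH ?act g) \<in> orbit HH ?act g" by (rule someI)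
    then show ?thesis unfolding \<gamma>_def using orbit_eq_fibre[OF mn that] by simp
  qed
  have "bij_betw \<gamma> Y ?X"
  proof (rule bij_betwI')
    show "\<gamma> a \<in> ?X" if "a \<in> Y" for a
      using that \<gamma> quotient_map_mem[OF mn] by (auto simp: Y_def orbits_def simp del: split_paired_All)
    show "\<exists>a\<in>Y. y = \<gamma> a" if "y \<in> ?X" for y
    proof -
      obtain W s where "y \<in> W" "s ` W \<subseteq> carrier GG" "\<forall>x\<in>W. ?f (s x) = x"
        using quotient_map_local_section[OF \<open>y \<in> ?X\<close>] by metis
      then have "s y \<in> carrier GG" "?f (s y) = y" by auto
      then show ?thesis using \<gamma>[of "s y"] unfolding Y_def orbits_def by (metis (mono_tags, lifting) mem_Collect_eq)
    qed
    fix a b assume "a \<in> Y" "b \<in> Y"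
    then obtain g g' where g: "g \<in> carrier GG" "a = orbit HH ?act g" and g': "g' \<in> carrier GG" "b = orbit HH ?act g'"
      by (auto simp: Y_def orbits_def)
    show "\<gamma> a = \<gamma> b \<longleftrightarrow> a = b"
    proof
      assume "\<gamma> a = \<gamma> b"
      then have "?f g = ?f g'" using \<gamma> g g' by simp
      then show "a = b" unfolding g(2) g'(2) orbit_eq_fibre[OF mn g(1)] orbit_eq_fibre[OF mn g'(1)] by simp
    qed simp
  qed
  then have bij: "bij_betw \<gamma> Y (topspace (mtop ?M))" by simp
  have M: "smooth_manifold ?M" by (rule smooth_manifold_euclidean_submfd[OF submfd_bundle_set])
  have "submersion GG_mfd (transport Y \<gamma> ?M) (orbit HH ?act)"
    by (rule submersion_transport[OF bij M sub]) (auto simp: top \<gamma> Y_def orbits_def)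
  then have "orbit_manifold HH GG_mfd ?act (transport Y \<gamma> ?M)"
    unfolding orbit_manifold_def top topspace_transport[OF bij M] by (simp add: Y_def)
  then show ?thesis using diffeomorphism_transport[OF bij M] by blast
qed

theorem proposition4p8:
  fixes l m n :: int
  assumes "Gcd {l, m, n} = 1"
    and "l = 2" and "odd m" and "odd n"
  shows "effectively_free HH (carrier GG) (biquotient_action GG (ff l m n)) \<and>
    (\<exists>(Q :: (((quat ^ 2 ^ 2) \<times> quat) set, real ^ 6) mfd) (E :: ((real ^ 3) \<times> (real ^ 5), real ^ 6) mfd).
       orbit_manifold HH GG_mfd (biquotient_action GG (ff l m n)) Q \<and>
       is_S4_twisted_S2 E \<and> diffeomorphic Q E)"
proof -
  obtain d e where mn: "m - n = 2 * d" "m + n = 2 * e" using assms(3,4) by (meson even_add even_diff dvdE)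
  have "d + e = m" using mn by linarith
  then have "odd (nat \<bar>d\<bar> + nat \<bar>e\<bar>)" using assms(3) by (auto simp: even_nat_iff)
  then obtain E :: "((real ^ 3) \<times> (real ^ 5), real ^ 6) mfd" and f where
    E: "is_S4_twisted_S2 E" "diffeomorphism E (euclidean_submfd (bundle_set (nat \<bar>d\<bar>) (nat \<bar>e\<bar>))) f"
    using exists_twisted_bundle by metis
  obtain Q :: "(((quat ^ 2 ^ 2) \<times> quat) set, real ^ 6) mfd" and g where
    Q: "orbit_manifold HH GG_mfd (biquotient_action GG (ff 2 m n)) Q"
      "diffeomorphism Q (euclidean_submfd (bundle_set (nat \<bar>d\<bar>) (nat \<bar>e\<bar>))) g"
    using orbit_manifold_bundle[OF mn] by metis
  have "diffeomorphic Q E"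
    unfolding diffeomorphic_def using diffeomorphism_sym[OF E(2)] diffeomorphism_compose[OF Q(2)] by blast
  then show ?thesis using effectively_free_action[OF assms(3,4)] Q(1) E(1) assms(2) by blast
qed

end
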